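(* Let $p$ and $q$ be distinct prime numbers. Let $\prod_{i=1}^n p_i^{k_i}$ and $\prod_{i=1}^s r_i^{d_i}$ be the factorizations of respectively $g_p=x^{q-1}-1$ in $\mathbb{Z}_p[x]$ and $g_q=x^{p-1}-1$ in $\mathbb{Z}_q[x]$ into (powers of pairwise distinct) irreducible divisors. Then the number $k$ of clones on $\mathbb{Z}_{pq}$ containing $\mathrm{Clo}(\langle\mathbb{Z}_{pq},+\rangle)$ satisfies $$2\Big(\prod_{i=1}^n(k_i+1)+\prod_{i=1}^s(d_i+1)\Big)-1\ \le\ k\ \le\ 2^{p+q+2}\prod_{i=1}^n(k_i+1)^{p+1}\prod_{i=1}^s(d_i+1)^{q+1}\ \le\ 2^{2qp+q+p}.$$
   Context: A clone on a set $A$ is a set of finitary operations on $A$ containing all projections and closed under composition. $\mathrm{Clo}(\langle \mathbb{Z}_{pq},+\rangle)$ is the clone on $\mathbb{Z}_{pq}$ generated by the addition. *)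

theory Defs
  imports "HOL-Number_Theory.Residues" "HOL-Algebra.Polynomial_Divisibility"
begin

text \<open>
  An operation on \<open>A\<close> is a pair of its arity and an extensional function on the tuples over \<open>A\<close>,
  a tuple of length \<open>n\<close> being an extensional function on \<open>{..<n}\<close>. Extensionality is what makes
  counting clones meaningful: equal operations on \<open>A\<close> are equal as HOL objects. Keeping the arity
  explicit separates operations of different arities. Arities are positive; with nullary
  operations every clone containing a constant unary operation would be counted twice.
\<close>

type_synonym 'a operation = "nat \<times> ((nat \<Rightarrow> 'a) \<Rightarrow> 'a)"

definition tuples :: "'a set \<Rightarrow> nat \<Rightarrow> (nat \<Rightarrow> 'a) set" where
  "tuples A n = {..<n} \<rightarrow>\<^sub>E A"

definition operations :: "'a set \<Rightarrow> 'a operation set" where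
  "operations A = {(n, f). 0 < n \<and> f \<in> tuples A n \<rightarrow>\<^sub>E A}"

definition projection :: "'a set \<Rightarrow> nat \<Rightarrow> nat \<Rightarrow> 'a operation" where
  "projection A n i = (n, \<lambda>x\<in>tuples A n. x i)"

definition compose_op ::
  "'a set \<Rightarrow> nat \<Rightarrow> nat \<Rightarrow> ((nat \<Rightarrow> 'a) \<Rightarrow> 'a) \<Rightarrow> (nat \<Rightarrow> (nat \<Rightarrow> 'a) \<Rightarrow> 'a) \<Rightarrow> 'a operation" where
  "compose_op A n m f g = (m, \<lambda>x\<in>tuples A m. f (\<lambda>i\<in>{..<n}. g i x))"

definition is_clone :: "'a set \<Rightarrow> 'a operation set \<Rightarrow> bool" where
  "is_clone A C \<longleftrightarrow>
     C \<subseteq> operations A \<and>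
     (\<forall>n. \<forall>i<n. projection A n i \<in> C) \<and>
     (\<forall>n m f g. 0 < m \<longrightarrow> (n, f) \<in> C \<longrightarrow> (\<forall>i<n. (m, g i) \<in> C) \<longrightarrow> compose_op A n m f g \<in> C)"

definition add_op :: "('a, 'b) ring_scheme \<Rightarrow> 'a operation" where
  "add_op R = (2, \<lambda>x\<in>tuples (carrier R) 2. x 0 \<oplus>\<^bsub>R\<^esub> x 1)"

definition Clo_add :: "('a, 'b) ring_scheme \<Rightarrow> 'a operation set" where
  "Clo_add R = is_clone (carrier R) hull {add_op R}"

abbreviation Zmod :: "nat \<Rightarrow> int ring" where
  "Zmod m \<equiv> residue_ring (int m)"

definition X_pow_minus_one :: "('a, 'b) ring_scheme \<Rightarrow> nat \<Rightarrow> 'a list" where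
  "X_pow_minus_one R m = X\<^bsub>R\<^esub> [^]\<^bsub>poly_ring R\<^esub> m \<ominus>\<^bsub>poly_ring R\<^esub> \<one>\<^bsub>poly_ring R\<^esub>"

text \<open>
  Distinctness of the irreducible factors is understood up to units, so that the exponents are
  the multiplicities; the factors need not be monic.
\<close>

definition irreducible_factorization ::
  "('a, 'b) ring_scheme \<Rightarrow> 'a list \<Rightarrow> nat \<Rightarrow> (nat \<Rightarrow> 'a list) \<Rightarrow> (nat \<Rightarrow> nat) \<Rightarrow> bool" where
  "irreducible_factorization R g n f k \<longleftrightarrow>
     (\<forall>i\<in>{1..n}. f i \<in> carrier (poly_ring R) \<and> pirreducible\<^bsub>R\<^esub> (carrier R) (f i) \<and> 0 < k i) \<and>
     (\<forall>i\<in>{1..n}. \<forall>j\<in>{1..n}. i \<noteq> j \<longrightarrow> \<not> f i \<sim>\<^bsub>poly_ring R\<^esub> f j) \<and>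
     g = (\<Otimes>\<^bsub>poly_ring R\<^esub>i\<in>{1..n}. f i [^]\<^bsub>poly_ring R\<^esub> k i)"

end

theory Submission
  imports Defs "HOL-Number_Theory.Residue_Primitive_Roots"
begin

text \<open>
  The map \<open>x \<mapsto> (x mod p, x mod q)\<close> turns \<open>\<int>/pq\<close> into \<open>\<int>/p \<times> \<int>/q\<close>. Let \<open>e\<close> be the idempotent with
  \<open>e = 1\<close> modulo \<open>p\<close> and \<open>e = 0\<close> modulo \<open>q\<close>. A clone \<open>C\<close> containing the addition is closed under
  integral linear combinations, so \<open>F = e F + (1 - e) F\<close> shows that it is determined by its
  \<open>p\<close>-part, the functions \<open>F\<close> with \<open>e F \<in> C\<close> taken modulo \<open>p\<close>, and its \<open>q\<close>-part.

  A function into \<open>\<int>/p\<close> is a reduced polynomial in the \<open>\<int>/p\<close>-components \<open>x\<close> of its arguments whose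
  coefficients depend on the \<open>\<int>/q\<close>-components \<open>y\<close>. Scaling one variable at a time separates the
  powers of that variable (lemma \<open>extract_power\<close>), and substituting \<open>x + x'\<close> for \<open>x\<close> turns
  \<open>x^k\<close> into a product of \<open>k\<close> different variables (lemma \<open>polarize\<close>). Hence the \<open>p\<close>-part is
  determined by the functions \<open>r(y) x\<^sub>1 \<cdots> x\<^sub>d\<close> in it. As \<open>q\<close> is invertible modulo \<open>p\<close>, averaging over
  lines expresses \<open>r\<close> through its restrictions to lines (lemma \<open>plane_identity\<close>), so it suffices to
  know the sets \<open>U\<^sub>d\<close> of the functions \<open>u : \<int>/q \<rightarrow> \<int>/p\<close> for which \<open>u(y) x\<^sub>1 \<cdots> x\<^sub>d\<close> is in the \<open>p\<close>-part.
  Each \<open>U\<^sub>d\<close> is an invariant space: it is closed under addition and under the dilations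
  \<open>u(y) \<mapsto> u(a y)\<close>. Identifying \<open>p\<close> of the variables gives \<open>U\<^bsub>d+p-1\<^esub> \<subseteq> U\<^sub>d\<close> for \<open>d \<ge> 1\<close> because \<open>x^p = x\<close>;
  substituting such a function into itself gives the converse inclusion for \<open>d \<ge> 2\<close> because
  \<open>u^p = u\<close>. So \<open>U\<^sub>0, \<dots>, U\<^sub>p\<close> determine the \<open>p\<close>-part, and with \<open>v(p,q)\<close> the number of
  invariant spaces there are at most \<open>v(p,q)^(p+1) v(q,p)^(q+1)\<close> clones
  (lemma \<open>card_lifted_clones_upper\<close>).

  For the lower bound, an invariant space \<open>U\<close> yields the clone of all sums of a linear form and
  of \<open>e c(y)\<close> with \<open>c(t v)\<close> in \<open>U\<close>, as a function of \<open>t\<close>, for every vector \<open>v\<close>. Its space \<open>U\<^sub>0\<close> is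
  \<open>U\<close>, and the corresponding space of its \<open>q\<close>-part is trivial. The clones obtained in
  this way for \<open>(p,q)\<close> and for \<open>(q,p)\<close> have only the clone of linear forms in common, so there are
  at least \<open>v(p,q) + v(q,p) - 1\<close> clones (lemma \<open>card_lifted_clones_lower\<close>).

  It remains to compute \<open>v(p,q) = 2 \<Prod>\<^sub>i (k\<^sub>i + 1)\<close>. The factor 2 records whether the constant functions
  belong to the space. The functions vanishing at 0 are functions on the cyclic group of
  units modulo \<open>q\<close>; with a generator acting as \<open>X\<close>, they form the module
  \<open>\<int>\<^sub>p[X]/(X^(q-1) - 1)\<close>. The invariant subspaces correspond to the ideals of \<open>\<int>\<^sub>p[X]\<close> that contain
  \<open>X^(q-1) - 1\<close>, and these to its divisors up to units. The last inequality of the theorem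
  holds since \<open>\<Prod>\<^sub>i (k\<^sub>i + 1) \<le> 2^(\<Sum>\<^sub>i k\<^sub>i)\<close> and \<open>\<Sum>\<^sub>i k\<^sub>i \<le> q - 1\<close>.
\<close>

section \<open>Clones as sets of functions on integer sequences\<close>

definition depends_on_first :: "int \<Rightarrow> nat \<Rightarrow> ((nat \<Rightarrow> int) \<Rightarrow> int) \<Rightarrow> bool" where
  "depends_on_first m N F \<longleftrightarrow>
     (\<forall>x y. (\<forall>i<N. [x i = y i] (mod m)) \<longrightarrow> [F x = F y] (mod m))"

text \<open>
  Composing operations of a clone requires equal arities, and tuples over \<open>{0..<m}\<close> are extensional
  functions. Both disappear for functions on infinite integer sequences that
  depend, modulo \<open>m\<close>, on finitely many entries modulo \<open>m\<close>. Such a function represents an operation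
  of every sufficiently large arity; closure under congruence makes the set
  independent of the choice of representatives.
\<close>

definition lifted_clone :: "int \<Rightarrow> ((nat \<Rightarrow> int) \<Rightarrow> int) set \<Rightarrow> bool" where
  "lifted_clone m K \<longleftrightarrow>
     (\<forall>F\<in>K. \<exists>N. depends_on_first m N F) \<and>
     (\<forall>i. (\<lambda>x. x i) \<in> K) \<and> (\<lambda>x. x 0 + x 1) \<in> K \<and>
     (\<forall>F G. F \<in> K \<longrightarrow> (\<forall>i. G i \<in> K) \<longrightarrow> (\<lambda>x. F (\<lambda>i. G i x)) \<in> K) \<and>
     (\<forall>F G. F \<in> K \<longrightarrow> (\<forall>x. [F x = G x] (mod m)) \<longrightarrow> G \<in> K)"

definition op_of :: "int \<Rightarrow> nat \<Rightarrow> ((nat \<Rightarrow> int) \<Rightarrow> int) \<Rightarrow> int operation" where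
  "op_of m N F = (N, \<lambda>x\<in>tuples {0..<m} N. F x mod m)"

definition fun_of :: "int \<Rightarrow> int operation \<Rightarrow> (nat \<Rightarrow> int) \<Rightarrow> int" where
  "fun_of m g x = snd g (\<lambda>i\<in>{..<fst g}. x i mod m)"

definition lift_ops :: "int \<Rightarrow> int operation set \<Rightarrow> ((nat \<Rightarrow> int) \<Rightarrow> int) set" where
  "lift_ops m C = {F. \<exists>N>0. depends_on_first m N F \<and> op_of m N F \<in> C}"

definition lower_funs :: "int \<Rightarrow> ((nat \<Rightarrow> int) \<Rightarrow> int) set \<Rightarrow> int operation set" where
  "lower_funs m K = {g \<in> operations {0..<m}. fun_of m g \<in> K}"

lemma depends_on_first_mono:
  "depends_on_first m N F \<Longrightarrow> N \<le> M \<Longrightarrow> depends_on_first m M F"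
  unfolding depends_on_first_def by (meson order_less_le_trans)

lemma depends_on_firstD:
  "depends_on_first m N F \<Longrightarrow> (\<And>i. i < N \<Longrightarrow> [x i = y i] (mod m)) \<Longrightarrow> [F x = F y] (mod m)"
  unfolding depends_on_first_def by blast

lemma tuples_mod:
  assumes "0 < (m::int)" shows "(\<lambda>i\<in>{..<n}. x i mod m) \<in> tuples {0..<m} n"
  using assms by (auto simp: tuples_def)

lemma op_of_in_operations:
  "0 < m \<Longrightarrow> 0 < N \<Longrightarrow> op_of m N F \<in> operations {0..<m}"
  by (auto simp: op_of_def operations_def)

text \<open>
  Congruent functions represent the same operation, which is what allows calculations with
  integers instead of residues.
\<close>

lemma op_of_cong:
  assumes "\<And>x. x \<in> tuples {0..<m} N \<Longrightarrow> [F x = G x] (mod m)"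
  shows "op_of m N F = op_of m N G"
  using assms by (auto simp: op_of_def cong_def intro!: restrict_ext)

lemma op_of_fun_of:
  assumes "g \<in> operations {0..<m}" shows "op_of m (fst g) (fun_of m g) = g"
proof (cases g)
  case (Pair n f)
  have f: "f \<in> tuples {0..<m} n \<rightarrow>\<^sub>E {0..<m}" using assms Pair by (auto simp: operations_def)
  have "(\<lambda>x\<in>tuples {0..<m} n. fun_of m g x mod m) = f"
  proof
    fix x
    show "(\<lambda>x\<in>tuples {0..<m} n. fun_of m g x mod m) x = f x"
    proof (cases "x \<in> tuples {0..<m} n")
      case True
      then have "(\<lambda>i\<in>{..<n}. x i mod m) = x"
        by (auto simp: tuples_def PiE_iff extensional_def fun_eq_iff)
      moreover have "f x \<in> {0..<m}" using f True by blast
      ultimately show ?thesis using True by (simp add: fun_of_def Pair)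
    next
      case False
      then show ?thesis using f by (auto simp: PiE_def extensional_def)
    qed
  qed
  then show ?thesis by (simp add: op_of_def Pair)
qed

lemma depends_fun_of: "depends_on_first m (fst g) (fun_of m g)"
  unfolding depends_on_first_def fun_of_def cong_def
  by (auto intro!: arg_cong[of _ _ "\<lambda>y. snd g y mod m"] restrict_ext)

lemma fun_of_op_of:
  assumes "0 < m" "depends_on_first m N F"
  shows "[fun_of m (op_of m N F) x = F x] (mod m)"
proof -
  have "fun_of m (op_of m N F) x = F (\<lambda>i\<in>{..<N}. x i mod m) mod m"
    using tuples_mod[OF assms(1)] by (simp add: fun_of_def op_of_def)
  moreover have "[F (\<lambda>i\<in>{..<N}. x i mod m) = F x] (mod m)"
    by (rule depends_on_firstD[OF assms(2)]) simp
  ultimately show ?thesis by simp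
qed

text \<open>
  Reducing the inner values modulo \<open>m\<close> and cutting their sequence off at \<open>N\<close> does not change the
  outer value, so composition of operations is substitution of functions.
\<close>

lemma clone_op_of_comp:
  assumes C: "is_clone {0..<m} C" and "0 < m" "0 < M"
    and F: "depends_on_first m N F" "op_of m N F \<in> C"
    and G: "\<And>i. i < N \<Longrightarrow> op_of m M (G i) \<in> C"
  shows "op_of m M (\<lambda>x. F (\<lambda>i. G i x)) \<in> C"
proof -
  let ?A = "{0..<m}"
  have "compose_op ?A N M (snd (op_of m N F)) (\<lambda>i. snd (op_of m M (G i))) \<in> C"
    using C assms(3) F(2) G unfolding is_clone_def op_of_def by auto
  moreover have "compose_op ?A N M (snd (op_of m N F)) (\<lambda>i. snd (op_of m M (G i)))
      = op_of m M (\<lambda>x. F (\<lambda>i. G i x))"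
  proof -
    have "F (\<lambda>i\<in>{..<N}. (G i x mod m)) mod m = F (\<lambda>i. G i x) mod m" for x
      using depends_on_firstD[OF F(1), of "\<lambda>i\<in>{..<N}. (G i x mod m)" "\<lambda>i. G i x"]
      by (simp add: cong_def)
    moreover have "(\<lambda>i\<in>{..<N}. snd (op_of m M (G i)) x) = (\<lambda>i\<in>{..<N}. G i x mod m)"
      if "x \<in> tuples ?A M" for x using that by (auto simp: op_of_def)
    ultimately show ?thesis using tuples_mod[OF assms(2)]
      by (auto simp: compose_op_def op_of_def intro!: restrict_ext)
  qed
  ultimately show ?thesis by simp
qed

lemma op_of_projection:
  assumes "0 < m" "i < n" shows "op_of m n (\<lambda>x. x i) = projection {0..<m} n i"
proof -
  have "(\<lambda>x\<in>tuples {0..<m} n. x i mod m) = (\<lambda>x\<in>tuples {0..<m} n. x i)"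
    using assms by (intro restrict_ext) (auto simp: tuples_def PiE_iff)
  then show ?thesis by (simp add: op_of_def projection_def)
qed

text \<open>
  Composition with projections adds fictitious variables.
\<close>

lemma op_of_raise:
  assumes C: "is_clone {0..<m} C" and m: "0 < m" and NM: "N \<le> M" "0 < M"
    and F: "depends_on_first m N F" "op_of m N F \<in> C"
  shows "op_of m M F \<in> C"
proof -
  have "op_of m M (\<lambda>x. F (\<lambda>i. x i)) \<in> C"
    using C NM by (intro clone_op_of_comp[OF C m NM(2) F])
      (auto simp: op_of_projection m is_clone_def)
  then show ?thesis by simp
qed

text \<open>
  Conversely, a fictitious variable can be removed by identifying it with the first one. This is
  where positive arities matter.
\<close>

lemma op_of_lower:
  assumes C: "is_clone {0..<m} C" and m: "0 < m" and n: "0 < n"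
    and F: "depends_on_first m N F" "op_of m N F \<in> C" "depends_on_first m n F"
  shows "op_of m n F \<in> C"
proof (cases "N \<le> n")
  case True then show ?thesis using op_of_raise[OF C m True n F(1,2)] by simp
next
  case False
  have "op_of m n (\<lambda>x. F (\<lambda>i. x (if i < n then i else 0))) \<in> C"
    using C n by (intro clone_op_of_comp[OF C m n F(1,2)])
      (auto simp: op_of_projection m is_clone_def)
  moreover have "[F (\<lambda>i. x (if i < n then i else 0)) = F x] (mod m)" for x
    by (rule depends_on_firstD[OF F(3)]) auto
  then have "op_of m n (\<lambda>x. F (\<lambda>i. x (if i < n then i else 0))) = op_of m n F"
    by (rule op_of_cong)
  ultimately show ?thesis by simp
qed

lemma lifted_clone_lift_ops:
  assumes C: "is_clone {0..<m} C" and add: "add_op (residue_ring m) \<in> C" and m: "0 < m"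
  shows "lifted_clone m (lift_ops m C)"
  unfolding lifted_clone_def
proof (intro conjI allI impI ballI)
  fix F assume "F \<in> lift_ops m C" then show "\<exists>N. depends_on_first m N F"
    by (auto simp: lift_ops_def)
next
  fix i
  have "op_of m (Suc i) (\<lambda>x. x i) \<in> C" using C by (simp add: op_of_projection m is_clone_def)
  moreover have "depends_on_first m (Suc i) (\<lambda>x. x i)" by (simp add: depends_on_first_def)
  ultimately show "(\<lambda>x. x i) \<in> lift_ops m C" unfolding lift_ops_def by blast
next
  have "{0..m - 1} = {0..<m}" by auto
  then have "op_of m 2 (\<lambda>x. x 0 + x 1) = add_op (residue_ring m)"
    by (auto simp: op_of_def add_op_def residue_ring_def intro!: restrict_ext)
  moreover have "depends_on_first m 2 (\<lambda>x. x 0 + x 1)"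
    by (simp add: depends_on_first_def cong_add)
  ultimately show "(\<lambda>x. x 0 + x 1) \<in> lift_ops m C"
    unfolding lift_ops_def using add by (auto intro!: exI[of _ 2])
next
  fix F and G :: "nat \<Rightarrow> (nat \<Rightarrow> int) \<Rightarrow> int"
  assume "F \<in> lift_ops m C" and G: "\<forall>i. G i \<in> lift_ops m C"
  then obtain N where N: "0 < N" "depends_on_first m N F" "op_of m N F \<in> C"
    by (auto simp: lift_ops_def)
  have "\<exists>M>0. depends_on_first m M (G i) \<and> op_of m M (G i) \<in> C" for i
    using G by (auto simp: lift_ops_def)
  then obtain h where h: "\<And>i. h i > 0 \<and> depends_on_first m (h i) (G i) \<and> op_of m (h i) (G i) \<in> C"
    by metis
  define M where "M = Max (h ` {..<N})"
  have hM: "h i \<le> M" if "i < N" for i unfolding M_def using that by auto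
  then have M0: "0 < M" using N(1) h[of 0] by fastforce
  have "op_of m M (\<lambda>x. F (\<lambda>i. G i x)) \<in> C"
  proof (rule clone_op_of_comp[OF C m M0 N(2,3)])
    fix i assume "i < N"
    then show "op_of m M (G i) \<in> C" using op_of_raise[OF C m hM M0] h by blast
  qed
  moreover have "depends_on_first m M (\<lambda>x. F (\<lambda>i. G i x))"
    unfolding depends_on_first_def
  proof (intro allI impI)
    fix x y :: "nat \<Rightarrow> int" assume xy: "\<forall>i<M. [x i = y i] (mod m)"
    show "[F (\<lambda>i. G i x) = F (\<lambda>i. G i y)] (mod m)"
    proof (rule depends_on_firstD[OF N(2)])
      fix i assume "i < N"
      then have "depends_on_first m M (G i)" using h[of i] hM[of i] depends_on_first_mono by blast
      then show "[G i x = G i y] (mod m)" using xy unfolding depends_on_first_def by blast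
    qed
  qed
  ultimately show "(\<lambda>x. F (\<lambda>i. G i x)) \<in> lift_ops m C"
    using M0 by (auto simp: lift_ops_def)
next
  fix F G :: "(nat \<Rightarrow> int) \<Rightarrow> int"
  assume "F \<in> lift_ops m C" and FG: "\<forall>x. [F x = G x] (mod m)"
  then obtain N where N: "0 < N" "depends_on_first m N F" "op_of m N F \<in> C"
    by (auto simp: lift_ops_def)
  have "op_of m N F = op_of m N G" using FG by (intro op_of_cong) blast
  with N(3) have "op_of m N G \<in> C" by simp
  moreover have "depends_on_first m N G"
    using N(2) FG unfolding depends_on_first_def by (meson cong_trans cong_sym)
  ultimately show "G \<in> lift_ops m C" using N(1) by (auto simp: lift_ops_def)
qed

lemma lower_lift:
  assumes C: "is_clone {0..<m} C" and m: "0 < m"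
  shows "lower_funs m (lift_ops m C) = C"
proof (intro subset_antisym subsetI)
  fix g assume g: "g \<in> C"
  then have ops: "g \<in> operations {0..<m}" using C by (auto simp: is_clone_def)
  then have "fst g > 0" by (auto simp: operations_def)
  moreover have "op_of m (fst g) (fun_of m g) \<in> C" using g op_of_fun_of[OF ops] by simp
  ultimately have "fun_of m g \<in> lift_ops m C"
    using depends_fun_of unfolding lift_ops_def by blast
  with ops show "g \<in> lower_funs m (lift_ops m C)" by (simp add: lower_funs_def)
next
  fix g assume "g \<in> lower_funs m (lift_ops m C)"
  then obtain N where ops: "g \<in> operations {0..<m}"
    and N: "depends_on_first m N (fun_of m g)" "op_of m N (fun_of m g) \<in> C"
    by (auto simp: lower_funs_def lift_ops_def)
  have "fst g > 0" using ops by (auto simp: operations_def)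
  from op_of_lower[OF C m this N depends_fun_of] show "g \<in> C" by (simp add: op_of_fun_of ops)
qed

lemma lifted_cloneD:
  assumes "lifted_clone m K"
  shows lifted_depends: "F \<in> K \<Longrightarrow> \<exists>N. depends_on_first m N F"
    and lifted_var: "(\<lambda>x. x i) \<in> K"
    and lifted_plus: "(\<lambda>x. x 0 + x 1) \<in> K"
    and lifted_subst: "F \<in> K \<Longrightarrow> (\<And>i. G i \<in> K) \<Longrightarrow> (\<lambda>x. F (\<lambda>i. G i x)) \<in> K"
    and lifted_cong: "F \<in> K \<Longrightarrow> (\<And>x. [F x = F' x] (mod m)) \<Longrightarrow> F' \<in> K"
  using assms unfolding lifted_clone_def by blast+

lemma op_of_mem_lower:
  assumes K: "lifted_clone m K" and m: "0 < m" "0 < N" and F: "F \<in> K" "depends_on_first m N F"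
  shows "op_of m N F \<in> lower_funs m K"
  using lifted_cong[OF K F(1)] fun_of_op_of[OF m(1) F(2)] op_of_in_operations[OF m]
  by (auto simp: lower_funs_def intro: cong_sym)

lemma lift_lower:
  assumes K: "lifted_clone m K" and m: "0 < m"
  shows "lift_ops m (lower_funs m K) = K"
proof (intro subset_antisym subsetI)
  fix F assume F: "F \<in> K"
  then obtain N where N: "depends_on_first m N F" using lifted_depends[OF K] by blast
  then have N': "depends_on_first m (Suc N) F" by (rule depends_on_first_mono) simp
  then show "F \<in> lift_ops m (lower_funs m K)"
    using op_of_mem_lower[OF K m _ F N'] unfolding lift_ops_def by blast
next
  fix F assume "F \<in> lift_ops m (lower_funs m K)"
  then obtain N where N: "depends_on_first m N F" "fun_of m (op_of m N F) \<in> K"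
    by (auto simp: lift_ops_def lower_funs_def)
  show "F \<in> K" by (rule lifted_cong[OF K N(2)]) (rule fun_of_op_of[OF m N(1)])
qed

lemma is_clone_lower_funs:
  assumes K: "lifted_clone m K" and m: "0 < m"
  shows "is_clone {0..<m} (lower_funs m K)" and "add_op (residue_ring m) \<in> lower_funs m K"
proof -
  let ?A = "{0..<m}"
  show "is_clone ?A (lower_funs m K)"
    unfolding is_clone_def
  proof (intro conjI allI impI)
    show "lower_funs m K \<subseteq> operations ?A" by (auto simp: lower_funs_def)
  next
    fix n i :: nat assume i: "i < n"
    have "depends_on_first m n (\<lambda>x. x i)" using i by (simp add: depends_on_first_def)
    then have "op_of m n (\<lambda>x. x i) \<in> lower_funs m K"
      using op_of_mem_lower[OF K m _ lifted_var[OF K]] i by simp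
    then show "projection ?A n i \<in> lower_funs m K" by (simp add: op_of_projection m i)
  next
    fix n M :: nat and f :: "(nat \<Rightarrow> int) \<Rightarrow> int" and g :: "nat \<Rightarrow> (nat \<Rightarrow> int) \<Rightarrow> int"
    assume M: "0 < M" and f: "(n, f) \<in> lower_funs m K" and g: "\<forall>i<n. (M, g i) \<in> lower_funs m K"
    define G where "G i = (if i < n then fun_of m (M, g i) else (\<lambda>x. x 0))" for i
    have GK: "G i \<in> K" for i using g lifted_var[OF K] by (auto simp: G_def lower_funs_def)
    have H: "(\<lambda>x. fun_of m (n, f) (\<lambda>i. G i x)) \<in> K"
      by (rule lifted_subst[OF K]) (use f GK in \<open>simp_all add: lower_funs_def\<close>)
    have "depends_on_first m M (\<lambda>x. fun_of m (n, f) (\<lambda>i. G i x))"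
      unfolding depends_on_first_def
    proof (intro allI impI)
      fix x y :: "nat \<Rightarrow> int" assume xy: "\<forall>i<M. [x i = y i] (mod m)"
      show "[fun_of m (n, f) (\<lambda>i. G i x) = fun_of m (n, f) (\<lambda>i. G i y)] (mod m)"
      proof (rule depends_on_firstD[OF depends_fun_of])
        fix i assume "i < fst (n, f)"
        then have "G i = fun_of m (M, g i)" by (simp add: G_def)
        then show "[G i x = G i y] (mod m)"
          using depends_on_firstD[OF depends_fun_of, of "(M, g i)" x y m] xy by simp
      qed
    qed
    from op_of_mem_lower[OF K m M H this]
    have "op_of m M (\<lambda>x. fun_of m (n, f) (\<lambda>i. G i x)) \<in> lower_funs m K" .
    moreover have "op_of m M (\<lambda>x. fun_of m (n, f) (\<lambda>i. G i x)) = compose_op ?A n M f g"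
      unfolding op_of_def compose_op_def
    proof (intro arg_cong[of _ _ "Pair M"] restrict_ext)
      fix x assume x: "x \<in> tuples ?A M"
      then have xx: "(\<lambda>i\<in>{..<M}. x i mod m) = x"
        by (auto simp: tuples_def PiE_iff extensional_def fun_eq_iff)
      have gi: "g i x \<in> ?A" if "i < n" for i
        using g that x unfolding lower_funs_def operations_def by blast
      have "(\<lambda>i\<in>{..<n}. G i x mod m) = (\<lambda>i\<in>{..<n}. g i x)"
        using gi by (auto simp: G_def fun_of_def xx intro!: restrict_ext)
      moreover have "(\<lambda>i\<in>{..<n}. g i x) \<in> tuples ?A n" using gi by (auto simp: tuples_def)
      then have "f (\<lambda>i\<in>{..<n}. g i x) \<in> ?A"
        using f unfolding lower_funs_def operations_def by blast
      ultimately show "fun_of m (n, f) (\<lambda>i. G i x) mod m = f (\<lambda>i\<in>{..<n}. g i x)"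
        by (simp add: fun_of_def)
    qed
    ultimately show "compose_op ?A n M f g \<in> lower_funs m K" by simp
  qed
  have "{0..m - 1} = {0..<m}" by auto
  then have "op_of m 2 (\<lambda>x. x 0 + x 1) = add_op (residue_ring m)"
    by (auto simp: op_of_def add_op_def residue_ring_def intro!: restrict_ext)
  moreover have "depends_on_first m 2 (\<lambda>x. x 0 + x 1)"
    by (simp add: depends_on_first_def cong_add)
  ultimately show "add_op (residue_ring m) \<in> lower_funs m K"
    using op_of_mem_lower[OF K m _ lifted_plus[OF K], of 2] by simp
qed

text \<open>
  A clone contains the clone generated by the addition iff it contains the addition itself, so the
  clones in question correspond bijectively to the lifted clones.
\<close>

lemma card_clones_eq_card_lifted_clones:
  assumes "0 < m"
  shows "card {C. is_clone (carrier (Zmod m)) C \<and> Clo_add (Zmod m) \<subseteq> C}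
    = card {K. lifted_clone (int m) K}"
proof -
  have A: "carrier (Zmod m) = {0..<int m}" by (auto simp: residue_ring_def)
  have sub: "Clo_add (Zmod m) \<subseteq> C \<longleftrightarrow> add_op (Zmod m) \<in> C" if "is_clone (carrier (Zmod m)) C" for C
    using that hull_minimal[of "{add_op (Zmod m)}" C "is_clone (carrier (Zmod m))"]
      hull_subset[of "{add_op (Zmod m)}" "is_clone (carrier (Zmod m))"]
    unfolding Clo_add_def by auto
  show ?thesis
  proof (rule bij_betw_same_card[of "lift_ops (int m)"],
      rule bij_betw_byWitness[where f' = "lower_funs (int m)"])
    show "lift_ops (int m) ` {C. is_clone (carrier (Zmod m)) C \<and> Clo_add (Zmod m) \<subseteq> C}
      \<subseteq> {K. lifted_clone (int m) K}"
      using sub lifted_clone_lift_ops[of "int m"] assms unfolding A by auto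
    show "lower_funs (int m) ` {K. lifted_clone (int m) K}
      \<subseteq> {C. is_clone (carrier (Zmod m)) C \<and> Clo_add (Zmod m) \<subseteq> C}"
      using sub is_clone_lower_funs[of "int m"] assms unfolding A by auto
  qed (use assms in \<open>auto simp: A lower_lift lift_lower\<close>)
qed

section \<open>Periodic functions and arithmetic modulo a prime\<close>

text \<open>
  Addition alone provides the positive multiples; since values matter only modulo \<open>m\<close>, every
  integer multiple is congruent to one of them.
\<close>

lemma lifted_scale:
  assumes K: "lifted_clone m K" and m: "0 < m" and F: "F \<in> K"
  shows "(\<lambda>x. a * F x) \<in> K"
proof -
  have add: "(\<lambda>x. G x + H x) \<in> K" if "G \<in> K" "H \<in> K" for G H
    using lifted_subst[OF K lifted_plus[OF K], of "\<lambda>i. if i = 0 then G else H"] that by auto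
  have *: "(\<lambda>x. (int n + 1) * F x) \<in> K" for n
  proof (induction n)
    case 0 then show ?case using F by simp
  next
    case (Suc n)
    have "(\<lambda>x. (int n + 1) * F x + F x) = (\<lambda>x. (int (Suc n) + 1) * F x)"
      by (simp add: algebra_simps)
    then show ?case using add[OF Suc F] by simp
  qed
  have "[(int (nat ((a - 1) mod m)) + 1) = a] (mod m)"
    using m by (simp add: cong_def mod_add_left_eq)
  then have "[(int (nat ((a - 1) mod m)) + 1) * F x = a * F x] (mod m)" for x
    by (rule cong_scalar_right)
  then show ?thesis by (rule lifted_cong[OF K *])
qed

lemma lifted_add:
  assumes K: "lifted_clone m K" and "F \<in> K" "G \<in> K"
  shows "(\<lambda>x. F x + G x) \<in> K"
  using lifted_subst[OF K lifted_plus[OF K], of "\<lambda>i. if i = 0 then F else G"] assms by auto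

lemma lifted_upd:
  assumes K: "lifted_clone m K" and "F \<in> K" "g \<in> K"
  shows "(\<lambda>x. F (x(s := g x))) \<in> K"
proof -
  have "(\<lambda>x. F (\<lambda>i. (if i = s then g else (\<lambda>x. x i)) x)) \<in> K"
    by (rule lifted_subst[OF K assms(2), where G = "\<lambda>i. if i = s then g else (\<lambda>x. x i)"])
      (simp add: assms(3) lifted_var[OF K])
  moreover have "(\<lambda>i. (if i = s then g else (\<lambda>x. x i)) x) = x(s := g x)" for x
    by (rule ext) simp
  ultimately show ?thesis by simp
qed

text \<open>
  The functions from \<open>\<int>/q\<close> to \<open>\<int>/p\<close>. Representing them as \<open>q\<close>-periodic functions
  on all integers keeps dilations \<open>u(a y)\<close> free of reductions.
\<close>

definition periodic_funs :: "nat \<Rightarrow> nat \<Rightarrow> (int \<Rightarrow> int) set" where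
  "periodic_funs p q = {u. \<forall>y. u (y mod int q) = u y \<and> 0 \<le> u y \<and> u y < int p}"

lemma periodic_cong:
  assumes "u \<in> periodic_funs p q" "[v = w] (mod int q)" shows "u v = u w"
proof -
  have "u (y mod int q) = u y" for y using assms(1) by (simp add: periodic_funs_def)
  then show ?thesis using assms(2) by (metis cong_def)
qed

text \<open>
  These are the sets of unary functions of the linearly closed clonoids from \<open>\<int>/q\<close> to \<open>\<int>/p\<close>. The
  dilation by 0 puts the constant function with value \<open>u(0)\<close> into the space.
\<close>

definition invariant_spaces :: "nat \<Rightarrow> nat \<Rightarrow> (int \<Rightarrow> int) set set" where
  "invariant_spaces p q = {U. U \<subseteq> periodic_funs p q \<and> U \<noteq> {} \<and>
     (\<forall>u\<in>U. \<forall>v\<in>U. (\<lambda>y. (u y + v y) mod int p) \<in> U) \<and> (\<forall>u\<in>U. \<forall>a. (\<lambda>y. u (a * y)) \<in> U)}"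

lemma coprime_int_prime:
  assumes "Factorial_Ring.prime (p::nat)" "\<not> int p dvd c" shows "coprime c (int p)"
  using assms prime_imp_coprime[of "int p" c] by (simp add: coprime_commute)

lemma prime_inverse:
  assumes "Factorial_Ring.prime (p::nat)" "\<not> [c = 0] (mod int p)"
  obtains c' where "[c * c' = 1] (mod int p)"
proof -
  have "coprime c (int p)"
    using assms by (simp add: cong_0_iff coprime_int_prime)
  then show ?thesis using cong_solve_coprime_int that by blast
qed

lemma fermat_int:
  assumes p: "Factorial_Ring.prime (p::nat)" and a: "\<not> int p dvd a"
  shows "[a ^ (p - 1) = 1] (mod int p)"
proof -
  define b where "b = nat (a mod int p)"
  have ib: "int b = a mod int p" using p by (simp add: b_def prime_gt_0_nat)
  have "\<not> p dvd b" using a ib by (metis dvd_mod_iff dvd_refl int_dvd_int_iff)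
  then have "[b ^ (p - 1) = 1] (mod p)" using fermat_theorem p by blast
  then have "[int b ^ (p - 1) = 1] (mod int p)" using cong_int_iff[of "b ^ (p - 1)" 1 p] by simp
  then show ?thesis unfolding ib by (simp add: cong_def power_mod)
qed

lemma fermat_int_power_p:
  assumes p: "Factorial_Ring.prime (p::nat)"
  shows "[a ^ p = a] (mod int p)"
proof (cases "int p dvd a")
  case True
  then have "int p dvd a ^ p" using dvd_power[of p a] dvd_trans prime_gt_0_nat[OF p] by blast
  with True show ?thesis by (simp add: cong_def)
next
  case False
  then have "[a ^ (p - 1) * a = 1 * a] (mod int p)"
    using fermat_int[OF p] cong_scalar_right by blast
  moreover have "a ^ (p - 1) * a = a ^ p"
    using power_minus_mult[of p a] prime_gt_0_nat[OF p] by simp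
  ultimately show ?thesis by simp
qed

text \<open>
  A primitive root separates the powers with positive exponents below \<open>p\<close>. Exponent 0 has to be
  excluded, since \<open>a^0\<close> and \<open>a^(p-1)\<close> agree on all units.
\<close>

lemma separating_power:
  assumes p: "Factorial_Ring.prime (p::nat)" and jk: "0 < j" "j < p" "0 < k" "k < p" "j \<noteq> k"
  obtains a :: int where "\<not> [a ^ j = a ^ k] (mod int p)"
proof -
  obtain g where g: "residue_primroot p g" using prime_primitive_root_exists p
    by (metis prime_gt_1_nat)
  have "\<not> [j = k] (mod (p - 1))"
  proof
    assume "[j = k] (mod (p - 1))"
    then have "[(j - 1) + 1 = (k - 1) + 1] (mod (p - 1))" using jk by simp
    then have "[j - 1 = k - 1] (mod (p - 1))" by (simp only: cong_add_rcancel_nat)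
    then show False using jk by (simp add: cong_def)
  qed
  then have "\<not> [g ^ j = g ^ k] (mod p)"
    using g p order_divides_expdiff[of p g j k] by (simp add: residue_primroot_def totient_prime)
  then have "\<not> [int g ^ j = int g ^ k] (mod int p)"
    using cong_int_iff[of "g ^ j" "g ^ k" p] by simp
  then show ?thesis using that by blast
qed

text \<open>
  Lagrange interpolation modulo \<open>p\<close>: by Fermat's theorem \<open>1 - (v - a)^(p-1)\<close> is the indicator of
  \<open>v = a\<close>, and its expansion in powers of \<open>v\<close> has coefficients that do not depend on \<open>\<phi>\<close>.
\<close>

lemma interpolation:
  assumes p: "Factorial_Ring.prime (p::nat)"
  obtains c :: "nat \<Rightarrow> nat \<Rightarrow> int" where
    "\<And>\<phi> v. (\<And>v w. [v = w] (mod int p) \<Longrightarrow> [\<phi> v = \<phi> w] (mod int p)) \<Longrightarrow>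
       [\<phi> v = (\<Sum>k<p. (\<Sum>a<p. c a k * \<phi> (int a)) * v ^ k)] (mod int p)"
proof -
  define c where "c a k = (if k = 0 then 1 else 0) - int ((p - 1) choose k) * (- int a) ^ (p - 1 - k)" for a k
  have lt: "{..<p} = {..p - 1}" using prime_gt_0_nat[OF p] by auto
  have c: "(\<Sum>k<p. c a k * v ^ k) = 1 - (v - int a) ^ (p - 1)" for a v
  proof -
    have "(v - int a) ^ (p - 1) = (\<Sum>k\<le>p - 1. of_nat ((p - 1) choose k) * v ^ k * (- int a) ^ (p - 1 - k))"
      using binomial_ring[of v "- int a" "p - 1"] by simp
    moreover have "(\<Sum>k\<le>p - 1. (if k = 0 then 1 else 0) * v ^ k) = (1::int)"
    proof -
      have "(\<Sum>k\<le>p - 1. (if k = 0 then 1 else 0) * v ^ k) = (\<Sum>k\<le>p - 1. if k = 0 then 1 else 0)"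
        by (intro sum.cong) auto
      then show ?thesis by simp
    qed
    ultimately show ?thesis unfolding lt c_def
      by (simp add: algebra_simps sum_subtractf)
  qed
  show ?thesis
  proof (rule that)
    fix \<phi> :: "int \<Rightarrow> int" and v
    assume \<phi>: "\<And>v w. [v = w] (mod int p) \<Longrightarrow> [\<phi> v = \<phi> w] (mod int p)"
    define b where "b = nat (v mod int p)"
    have p0: "0 < int p" using p by (simp add: prime_gt_0_nat)
    have b: "b < p" "int b = v mod int p" using p0 by (auto simp: b_def nat_less_iff)
    have "(\<Sum>k<p. (\<Sum>a<p. c a k * \<phi> (int a)) * v ^ k) = (\<Sum>a<p. \<phi> (int a) * (\<Sum>k<p. c a k * v ^ k))"
      unfolding sum_distrib_left sum_distrib_right by (subst sum.swap) (simp add: mult_ac)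
    also have "[\<dots> = (\<Sum>a<p. if a = b then \<phi> (int a) else 0)] (mod int p)"
    proof (rule cong_sum)
      fix a assume a: "a \<in> {..<p}"
      show "[\<phi> (int a) * (\<Sum>k<p. c a k * v ^ k) = (if a = b then \<phi> (int a) else 0)] (mod int p)"
      proof (cases "a = b")
        case True
        have "int p dvd (v - int a)" unfolding True b(2) by (simp add: minus_mod_eq_mult_div)
        then have "int p dvd (v - int a) ^ (p - 1)"
          using prime_gt_1_nat[OF p] by (meson dvd_power dvd_trans zero_less_diff)
        then have "[\<phi> (int a) * (1 - (v - int a) ^ (p - 1)) = \<phi> (int a) * (1 - 0)] (mod int p)"
          by (intro cong_mult cong_diff cong_refl) (simp add: cong_0_iff)
        then show ?thesis using True by (simp add: c)
      next
        case False
        have "\<not> int p dvd v - int a"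
        proof
          assume "int p dvd v - int a"
          then have "v mod int p = int a mod int p" by (simp add: mod_eq_dvd_iff)
          then show False using False a b by simp
        qed
        then have "[\<phi> (int a) * (1 - (v - int a) ^ (p - 1)) = \<phi> (int a) * (1 - 1)] (mod int p)"
          by (intro cong_mult cong_diff cong_refl fermat_int p)
        then show ?thesis using False by (simp add: c)
      qed
    qed
    also have "(\<Sum>a<p. if a = b then \<phi> (int a) else 0) = \<phi> (int b)" using b by simp
    also have "[\<phi> (int b) = \<phi> v] (mod int p)" by (rule \<phi>) (simp add: b)
    finally show "[\<phi> v = (\<Sum>k<p. (\<Sum>a<p. c a k * \<phi> (int a)) * v ^ k)] (mod int p)"
      by (rule cong_sym)
  qed
qed

lemma cong_sum_residues:
  fixes h :: "int \<Rightarrow> int"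
  assumes q: "Factorial_Ring.prime (q::nat)" and \<beta>: "\<not> int q dvd \<beta>"
    and h: "\<And>v w. [v = w] (mod int q) \<Longrightarrow> [h v = h w] (mod m)"
  shows "[(\<Sum>b\<in>{0..<int q}. h (\<alpha> + b * \<beta>)) = (\<Sum>b\<in>{0..<int q}. h b)] (mod m)"
proof -
  define \<sigma> where "\<sigma> b = (\<alpha> + b * \<beta>) mod int q" for b
  have q0: "0 < int q" using q by (simp add: prime_gt_0_nat)
  have cop: "coprime \<beta> (int q)" using q \<beta> by (rule coprime_int_prime)
  have "inj_on \<sigma> {0..<int q}"
  proof (rule inj_onI)
    fix b b' assume bb: "b \<in> {0..<int q}" "b' \<in> {0..<int q}" "\<sigma> b = \<sigma> b'"
    then have "[\<alpha> + b * \<beta> = \<alpha> + b' * \<beta>] (mod int q)" by (simp add: \<sigma>_def cong_def)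
    then have "[b = b'] (mod int q)"
      using cop by (simp add: cong_add_lcancel cong_mult_rcancel)
    then show "b = b'" using bb by (simp add: cong_def)
  qed
  moreover have "\<sigma> ` {0..<int q} \<subseteq> {0..<int q}" using q0 by (auto simp: \<sigma>_def)
  ultimately have "bij_betw \<sigma> {0..<int q} {0..<int q}"
    by (simp add: bij_betw_def endo_inj_surj)
  then have "(\<Sum>b\<in>{0..<int q}. h b) = (\<Sum>b\<in>{0..<int q}. h (\<sigma> b))"
    by (rule sum.reindex_bij_betw[symmetric])
  moreover have "[(\<Sum>b\<in>{0..<int q}. h (\<alpha> + b * \<beta>)) = (\<Sum>b\<in>{0..<int q}. h (\<sigma> b))] (mod m)"
    by (intro cong_sum h) (simp add: \<sigma>_def)
  ultimately show ?thesis by simp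
qed

text \<open>
  If \<open>\<beta>\<close> is invertible modulo \<open>q\<close>, both \<open>\<alpha> + b \<beta>\<close> and \<open>b \<beta>\<close> run through all residues, and the two
  sums cancel. Otherwise all summands agree. The sum thus detects whether \<open>q\<close> divides \<open>\<beta>\<close>,
  using only the values of a unary function at linear forms.
\<close>

lemma line_averaging:
  fixes h :: "int \<Rightarrow> int"
  assumes q: "Factorial_Ring.prime (q::nat)"
    and h: "\<And>v w. [v = w] (mod int q) \<Longrightarrow> [h v = h w] (mod m)"
  shows "[(\<Sum>b\<in>{0..<int q}. h (\<alpha> + b * \<beta>) - h (b * \<beta>))
    = (if int q dvd \<beta> then int q * (h \<alpha> - h 0) else 0)] (mod m)"
proof (cases "int q dvd \<beta>")
  case True
  then have "[(\<Sum>b\<in>{0..<int q}. h (\<alpha> + b * \<beta>) - h (b * \<beta>)) = (\<Sum>b\<in>{0..<int q}. h \<alpha> - h 0)] (mod m)"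
    by (intro cong_sum cong_diff h) (auto simp: cong_iff_dvd_diff)
  with True show ?thesis by simp
next
  case False
  have "[(\<Sum>b\<in>{0..<int q}. h (\<alpha> + b * \<beta>)) - (\<Sum>b\<in>{0..<int q}. h (0 + b * \<beta>))
      = (\<Sum>b\<in>{0..<int q}. h b) - (\<Sum>b\<in>{0..<int q}. h b)] (mod m)"
    using q False h by (intro cong_diff cong_sum_residues)
  with False show ?thesis by (simp add: sum_subtractf)
qed

text \<open>
  The lines through the origin of the plane over \<open>\<int>/q\<close> are \<open>\<beta> = c \<alpha>\<close> for \<open>c < q\<close> and the axis \<open>\<alpha> = 0\<close>.
  The double sum is \<open>q\<close> times the part of \<open>\<phi> - \<phi>(0,0)\<close> supported on the former lines, the last sum
  is \<open>q\<close> times the part supported on the axis: on each line \<open>line_averaging\<close> cuts out the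
  indicator of that line. The right-hand side involves \<open>\<phi>\<close> only on lines, so a
  function of two variables is reduced to functions of one variable.
\<close>

lemma plane_identity:
  fixes \<phi> :: "int \<Rightarrow> int \<Rightarrow> int"
  assumes q: "Factorial_Ring.prime (q::nat)" and q': "[int q * q' = 1] (mod m)"
    and \<phi>: "\<And>v w v' w'. [v = w] (mod int q) \<Longrightarrow> [v' = w'] (mod int q) \<Longrightarrow> [\<phi> v v' = \<phi> w w'] (mod m)"
  shows "[\<phi> \<alpha> \<beta> = \<phi> 0 0
     + q' * (\<Sum>c\<in>{0..<int q}. \<Sum>b\<in>{0..<int q}.
         \<phi> (\<alpha> + b * (\<beta> - c * \<alpha>)) (c * (\<alpha> + b * (\<beta> - c * \<alpha>)))
         - \<phi> (b * (\<beta> - c * \<alpha>)) (c * (b * (\<beta> - c * \<alpha>))))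
     + q' * (\<Sum>b\<in>{0..<int q}. \<phi> 0 (\<beta> + b * \<alpha>) - \<phi> 0 (b * \<alpha>))] (mod m)"
    (is "[_ = _ + q' * ?S + q' * ?T] (mod m)")
proof -
  define s where "s = (\<Sum>c\<in>{0..<int q}. if int q dvd \<beta> - c * \<alpha> then int q * (\<phi> \<alpha> (c * \<alpha>) - \<phi> 0 0) else 0)"
  define t where "t = (if int q dvd \<alpha> then int q * (\<phi> 0 \<beta> - \<phi> 0 0) else 0)"
  have S: "[?S = s] (mod m)" unfolding s_def
  proof (rule cong_sum)
    fix c
    have "[\<phi> v (c * v) = \<phi> w (c * w)] (mod m)" if "[v = w] (mod int q)" for v w
      using \<phi> that cong_scalar_left by blast
    from line_averaging[OF q, of "\<lambda>v. \<phi> v (c * v)" m \<alpha> "\<beta> - c * \<alpha>", OF this]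
    show "[(\<Sum>b\<in>{0..<int q}. \<phi> (\<alpha> + b * (\<beta> - c * \<alpha>)) (c * (\<alpha> + b * (\<beta> - c * \<alpha>)))
         - \<phi> (b * (\<beta> - c * \<alpha>)) (c * (b * (\<beta> - c * \<alpha>))))
      = (if int q dvd \<beta> - c * \<alpha> then int q * (\<phi> \<alpha> (c * \<alpha>) - \<phi> 0 0) else 0)] (mod m)" by (simp only: mult_zero_right)
  qed
  have T: "[?T = t] (mod m)" unfolding t_def
    by (rule line_averaging[OF q]) (intro \<phi> cong_refl)
  have q0: "0 < int q" using q by (simp add: prime_gt_0_nat)
  have st: "[s + t = int q * (\<phi> \<alpha> \<beta> - \<phi> 0 0)] (mod m)"
  proof (cases "int q dvd \<alpha>")
    case True
    have "[s = (\<Sum>c\<in>{0..<int q}. 0)] (mod m)" unfolding s_def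
    proof (rule cong_sum)
      fix c
      have "[\<phi> \<alpha> (c * \<alpha>) - \<phi> 0 0 = \<phi> 0 0 - \<phi> 0 0] (mod m)"
        using True by (intro cong_diff \<phi> cong_refl) (auto simp: cong_0_iff)
      then show "[(if int q dvd \<beta> - c * \<alpha> then int q * (\<phi> \<alpha> (c * \<alpha>) - \<phi> 0 0) else 0) = 0] (mod m)"
        using cong_scalar_left[of _ 0 m "int q"] by auto
    qed
    moreover have "[t = int q * (\<phi> \<alpha> \<beta> - \<phi> 0 0)] (mod m)"
      using True unfolding t_def
      by (auto intro!: cong_scalar_left cong_diff \<phi> simp: cong_0_iff cong_sym_eq[of 0])
    ultimately show ?thesis using cong_add by fastforce
  next
    case False
    then have "coprime \<alpha> (int q)" using q by (simp add: coprime_int_prime)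
    then obtain \<alpha>' where \<alpha>': "[\<alpha> * \<alpha>' = 1] (mod int q)" using cong_solve_coprime_int by blast
    define c0 where "c0 = (\<beta> * \<alpha>') mod int q"
    have c0: "[c0 * \<alpha> = \<beta>] (mod int q)"
      using cong_scalar_left[OF \<alpha>', of \<beta>] by (simp add: c0_def cong_def mod_mult_right_eq mult_ac)
    have iff: "int q dvd \<beta> - c * \<alpha> \<longleftrightarrow> c = c0" if c: "c \<in> {0..<int q}" for c
    proof
      assume "int q dvd \<beta> - c * \<alpha>"
      then have "[\<beta> = c * \<alpha>] (mod int q)" by (simp add: cong_iff_dvd_diff)
      with c0 have "[c0 * \<alpha> = c * \<alpha>] (mod int q)" by (rule cong_trans)
      then have "[c0 = c] (mod int q)" using \<open>coprime \<alpha> (int q)\<close> by (simp add: cong_mult_rcancel)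
      then show "c = c0" using c q0 by (simp add: cong_def c0_def)
    next
      assume "c = c0"
      with c0 show "int q dvd \<beta> - c * \<alpha>" by (simp add: cong_iff_dvd_diff dvd_diff_commute)
    qed
    have "s = (\<Sum>c\<in>{0..<int q}. if c = c0 then int q * (\<phi> \<alpha> (c * \<alpha>) - \<phi> 0 0) else 0)"
      unfolding s_def using iff by (intro sum.cong) auto
    also have "\<dots> = int q * (\<phi> \<alpha> (c0 * \<alpha>) - \<phi> 0 0)" using q0 by (simp add: c0_def)
    also have "[\<dots> = int q * (\<phi> \<alpha> \<beta> - \<phi> 0 0)] (mod m)"
      by (intro cong_scalar_left cong_diff \<phi> cong_refl c0)
    finally show ?thesis using False by (simp add: t_def)
  qed
  have "[\<phi> 0 0 + q' * ?S + q' * ?T = \<phi> 0 0 + q' * s + q' * t] (mod m)"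
    using S T by (intro cong_add cong_scalar_left cong_refl)
  also have "\<phi> 0 0 + q' * s + q' * t = \<phi> 0 0 + q' * (s + t)" by (simp add: algebra_simps)
  also have "[\<dots> = \<phi> 0 0 + q' * (int q * (\<phi> \<alpha> \<beta> - \<phi> 0 0))] (mod m)"
    using st by (intro cong_add cong_scalar_left cong_refl)
  also have "\<phi> 0 0 + q' * (int q * (\<phi> \<alpha> \<beta> - \<phi> 0 0)) = \<phi> 0 0 + int q * q' * (\<phi> \<alpha> \<beta> - \<phi> 0 0)"
    by (simp add: mult_ac)
  also have "[\<dots> = \<phi> 0 0 + 1 * (\<phi> \<alpha> \<beta> - \<phi> 0 0)] (mod m)"
    using q' by (intro cong_add cong_scalar_right cong_refl)
  finally show ?thesis by (simp add: cong_sym_eq)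
qed

section \<open>Monomials in a lifted clone\<close>

locale residue_split =
  fixes p q :: nat and e :: int
  assumes p: "Factorial_Ring.prime p" and q: "Factorial_Ring.prime q" and p_neq_q: "p \<noteq> q"
    and e_mod_p: "[e = 1] (mod int p)" and e_mod_q: "[e = 0] (mod int q)"
begin

lemma p0: "0 < p" and q0: "0 < q" and pq0: "0 < int (p * q)"
  using p q by (auto simp: prime_gt_0_nat)

text \<open>
  Multiplication by \<open>e\<close> kills the \<open>q\<close>-component and preserves the \<open>p\<close>-component.
\<close>

lemma e_mult_cong_iff: "[e * a = e * b] (mod int (p * q)) \<longleftrightarrow> [a = b] (mod int p)"
proof
  assume "[e * a = e * b] (mod int (p * q))"
  then have "[e * a = e * b] (mod int p)" by (auto intro: cong_dvd_modulus)
  moreover have "[e * c = 1 * c] (mod int p)" for c using e_mod_p by (rule cong_scalar_right)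
  ultimately show "[a = b] (mod int p)" by (metis cong_def mult_1)
next
  assume "[a = b] (mod int p)"
  then have "int p dvd a - b" by (simp add: cong_iff_dvd_diff)
  moreover have "int q dvd e" using e_mod_q by (simp add: cong_0_iff)
  ultimately have "int q * int p dvd e * (a - b)" by (intro mult_dvd_mono)
  then show "[e * a = e * b] (mod int (p * q))"
    by (simp add: cong_iff_dvd_diff right_diff_distrib mult.commute)
qed

text \<open>
  The \<open>p\<close>-part of \<open>K\<close>. Membership of \<open>F\<close> depends only on the values of \<open>F\<close> modulo \<open>p\<close>.
\<close>

definition part :: "((nat \<Rightarrow> int) \<Rightarrow> int) set \<Rightarrow> ((nat \<Rightarrow> int) \<Rightarrow> int) set" where
  "part K = {F. (\<lambda>x. e * F x) \<in> K}"

text \<open>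
  \<open>F\<close> modulo \<open>p\<close> depends on each entry \<open>x i\<close> only modulo \<open>\<theta> i\<close>; the modulus 1 expresses that
  \<open>x i\<close> is not used at all.
\<close>

definition depends_modulo :: "(nat \<Rightarrow> int) \<Rightarrow> ((nat \<Rightarrow> int) \<Rightarrow> int) \<Rightarrow> bool" where
  "depends_modulo \<theta> F \<longleftrightarrow> (\<forall>x y. (\<forall>i. [x i = y i] (mod \<theta> i)) \<longrightarrow> [F x = F y] (mod int p))"

lemma depends_moduloD:
  "depends_modulo \<theta> F \<Longrightarrow> (\<And>i. [x i = y i] (mod \<theta> i)) \<Longrightarrow> [F x = F y] (mod int p)"
  unfolding depends_modulo_def by blast

definition monomial :: "(int \<Rightarrow> int) \<Rightarrow> nat \<Rightarrow> (nat \<Rightarrow> int) \<Rightarrow> int" where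
  "monomial u d x = u (x 0) * (\<Prod>i\<in>{1..d}. x i)"

text \<open>
  The space \<open>U\<^sub>d\<close> of the introduction. The entry \<open>x 0\<close> enters only modulo \<open>q\<close>, the entries
  \<open>x 1, \<dots>, x d\<close> only modulo \<open>p\<close>.
\<close>

definition coefficient_space :: "((nat \<Rightarrow> int) \<Rightarrow> int) set \<Rightarrow> nat \<Rightarrow> (int \<Rightarrow> int) set" where
  "coefficient_space K d = {u \<in> periodic_funs p q. monomial u d \<in> part K}"

context
  fixes K assumes K: "lifted_clone (int (p * q)) K"
begin

lemma part_cong: "F \<in> part K \<Longrightarrow> (\<And>x. [F x = G x] (mod int p)) \<Longrightarrow> G \<in> part K"
  unfolding part_def mem_Collect_eq by (rule lifted_cong[OF K]) (auto simp only: e_mult_cong_iff)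

lemma part_add: "F \<in> part K \<Longrightarrow> G \<in> part K \<Longrightarrow> (\<lambda>x. F x + G x) \<in> part K"
  using lifted_add[OF K, of "\<lambda>x. e * F x" "\<lambda>x. e * G x"] by (simp add: part_def distrib_left)

lemma part_scale: "F \<in> part K \<Longrightarrow> (\<lambda>x. a * F x) \<in> part K"
  using lifted_scale[OF K pq0, of "\<lambda>x. e * F x" a] by (simp add: part_def mult_ac)

lemma part_diff: "F \<in> part K \<Longrightarrow> G \<in> part K \<Longrightarrow> (\<lambda>x. F x - G x) \<in> part K"
  using part_add[of F "\<lambda>x. - 1 * G x"] part_scale[of G "- 1"] by simp

lemma lifted_zero: "(\<lambda>x. 0) \<in> K"
  using lifted_scale[OF K pq0 lifted_var[OF K], of 0] by simp

lemma part_sum: "finite I \<Longrightarrow> (\<And>i. i \<in> I \<Longrightarrow> F i \<in> part K) \<Longrightarrow> (\<lambda>x. \<Sum>i\<in>I. F i x) \<in> part K"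
proof (induction I rule: finite_induct)
  case empty
  show ?case using lifted_zero by (simp add: part_def)
next
  case (insert i I)
  then show ?case using part_add[of "F i" "\<lambda>x. \<Sum>i\<in>I. F i x"] by simp
qed

lemma part_upd: "F \<in> part K \<Longrightarrow> g \<in> K \<Longrightarrow> (\<lambda>x. F (x(s := g x))) \<in> part K"
  using lifted_upd[OF K, of "\<lambda>x. e * F x" g s] by (simp add: part_def)

lemma part_rename:
  assumes "F \<in> part K" shows "(\<lambda>x. F (\<lambda>i. x (\<sigma> i))) \<in> part K"
proof -
  have "(\<lambda>x. e * F (\<lambda>i. x (\<sigma> i))) \<in> K"
    by (rule lifted_subst[OF K, where F = "\<lambda>x. e * F x" and G = "\<lambda>i x. x (\<sigma> i)"])
      (use assms lifted_var[OF K] in \<open>simp_all add: part_def\<close>)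
  then show ?thesis by (simp add: part_def)
qed

lemma subset_part: "F \<in> K \<Longrightarrow> F \<in> part K"
  using lifted_scale[OF K pq0] by (simp add: part_def)

lemma lifted_linear: "(\<lambda>x. a * x i + b * x j) \<in> K"
  using lifted_add[OF K lifted_scale[OF K pq0 lifted_var[OF K]] lifted_scale[OF K pq0 lifted_var[OF K]]] .

text \<open>
  The operator \<open>F(a x) - a^k F(x)\<close> multiplies the term of degree \<open>i\<close> by \<open>a^i - a^k\<close>; it removes
  degree \<open>k\<close> and, for suitable \<open>a\<close>, keeps degree \<open>j\<close>. Iterating isolates degree \<open>j\<close>. Scalings cannot
  distinguish the degrees 0 and \<open>p - 1\<close>, so degree 0 is handled by substituting 0.
\<close>

lemma extract_power:
  assumes "F \<in> part K" "B \<subseteq> {..<p}"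
    and "\<And>x. [F x = (\<Sum>k\<in>B. R k x * x s ^ k)] (mod int p)"
    and "\<And>k x v. R k (x(s := v)) = R k x" and "j \<in> B"
  shows "(\<lambda>x. R j x * x s ^ j) \<in> part K"
  using assms
proof (induction "card B" arbitrary: B F R rule: less_induct)
  case less
  note F = less.prems(1) and B = less.prems(2) and sum = less.prems(3) and indep = less.prems(4)
    and j = less.prems(5)
  have fin: "finite B" using B finite_subset by blast
  define F0 where "F0 x = F (x(s := 0))" for x
  have F0: "F0 \<in> part K" unfolding F0_def using part_upd[OF F lifted_zero] .
  have F0_eq: "[F0 x = (if 0 \<in> B then R 0 x else 0)] (mod int p)" for x
  proof -
    have "(\<Sum>k\<in>B. R k (x(s := 0)) * (x(s := 0)) s ^ k) = (\<Sum>k\<in>B. if k = 0 then R 0 x else 0)"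
      by (intro sum.cong) (auto simp: indep)
    then show ?thesis using sum[of "x(s := 0)"] fin by (simp add: F0_def)
  qed
  show ?case
  proof (cases "B = {j}")
    case True
    with sum show ?thesis by (intro part_cong[OF F]) simp
  next
    case False
    with j obtain k where k: "k \<in> B" "k \<noteq> j" by blast
    have smaller: "card (B - {k}) < card B" using k fin by (intro psubset_card_mono) auto
    have sub: "B - {k} \<subseteq> {..<p}" and jk: "j \<in> B - {k}" using B j k by auto
    consider "j = 0" | "j \<noteq> 0" "k = 0" | "j \<noteq> 0" "k \<noteq> 0" by blast
    then show ?thesis
    proof cases
      case 1
      with F0_eq j show ?thesis by (intro part_cong[OF F0]) simp
    next
      case 2
      show ?thesis
      proof (rule less.hyps[OF smaller part_diff[OF F F0] sub _ indep jk])
        fix x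
        have "(\<Sum>i\<in>B. R i x * x s ^ i) = R 0 x + (\<Sum>i\<in>B - {k}. R i x * x s ^ i)"
          using k 2 fin by (simp add: sum.remove)
        with cong_diff[OF sum[of x] F0_eq[of x]]
        show "[F x - F0 x = (\<Sum>i\<in>B - {k}. R i x * x s ^ i)] (mod int p)"
          using k 2 by simp
      qed
    next
      case 3
      then obtain a :: int where a: "\<not> [a ^ j = a ^ k] (mod int p)"
        using separating_power[OF p, of j k] B j k by auto
      define F' where "F' x = F (x(s := a * x s)) - a ^ k * F x" for x
      have "(\<lambda>x. F (x(s := a * x s))) \<in> part K"
        using part_upd[OF F lifted_scale[OF K pq0 lifted_var[OF K]]] .
      then have F': "F' \<in> part K"
        unfolding F'_def using part_diff part_scale[OF F] by blast
      have "(\<lambda>x. ((a ^ j - a ^ k) * R j x) * x s ^ j) \<in> part K"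
      proof (rule less.hyps[OF smaller F' sub _ _ jk, where R = "\<lambda>i x. (a ^ i - a ^ k) * R i x"])
        fix x
        have "[F' x = (\<Sum>i\<in>B. R i x * (a * x s) ^ i) - a ^ k * (\<Sum>i\<in>B. R i x * x s ^ i)] (mod int p)"
          unfolding F'_def using sum[of "x(s := a * x s)"] sum[of x]
          by (intro cong_diff cong_scalar_left) (simp_all add: indep)
        also have "(\<Sum>i\<in>B. R i x * (a * x s) ^ i) - a ^ k * (\<Sum>i\<in>B. R i x * x s ^ i)
            = (\<Sum>i\<in>B. (a ^ i - a ^ k) * R i x * x s ^ i)"
          by (simp add: sum_distrib_left sum_subtractf[symmetric] power_mult_distrib algebra_simps)
        also have "\<dots> = (\<Sum>i\<in>B - {k}. (a ^ i - a ^ k) * R i x * x s ^ i)"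
          using k fin by (simp add: sum.remove)
        finally show "[F' x = (\<Sum>i\<in>B - {k}. (a ^ i - a ^ k) * R i x * x s ^ i)] (mod int p)" .
      qed (simp add: indep)
      moreover obtain c where c: "[(a ^ j - a ^ k) * c = 1] (mod int p)"
        using prime_inverse[OF p, of "a ^ j - a ^ k"] a by (auto simp: cong_diff_iff_cong_0)
      ultimately have "(\<lambda>x. c * (((a ^ j - a ^ k) * R j x) * x s ^ j)) \<in> part K"
        using part_scale by blast
      then show ?thesis
      proof (rule part_cong)
        fix x
        show "[c * (((a ^ j - a ^ k) * R j x) * x s ^ j) = R j x * x s ^ j] (mod int p)"
          using cong_scalar_right[OF c, of "R j x * x s ^ j"] by (simp add: mult_ac)
      qed
    qed
  qed
qed

text \<open>
  Substituting \<open>x s + x b\<close> for \<open>x s\<close>, the term of degree \<open>k\<close> in \<open>x s\<close> is \<open>(k + 1) x b (x s)^k\<close>, and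
  \<open>k + 1 < p\<close> is invertible.
\<close>

lemma polarize_step:
  assumes F: "(\<lambda>x. R x * x s ^ Suc k) \<in> part K" and k: "Suc k < p" and bs: "b \<noteq> s"
    and R: "\<And>x v. R (x(s := v)) = R x"
  shows "(\<lambda>x. R x * x b * x s ^ k) \<in> part K"
proof -
  have g: "(\<lambda>x. x s + x b) \<in> K" using lifted_linear[of 1 s 1 b] by simp
  have F': "(\<lambda>x. R x * (x s + x b) ^ Suc k) \<in> part K"
    using part_upd[OF F g, of s] by (simp add: R)
  have "(\<lambda>x. (R x * (of_nat (Suc k choose k) * x b ^ (Suc k - k))) * x s ^ k) \<in> part K"
  proof (rule extract_power[OF F', where B = "{..Suc k}"
        and R = "\<lambda>i x. R x * (of_nat (Suc k choose i) * x b ^ (Suc k - i))"])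
    fix x
    have "R x * (x s + x b) ^ Suc k
        = (\<Sum>i\<le>Suc k. R x * (of_nat (Suc k choose i) * x b ^ (Suc k - i)) * x s ^ i)"
      unfolding binomial_ring sum_distrib_left by (simp add: mult_ac)
    then show "[R x * (x s + x b) ^ Suc k
        = (\<Sum>i\<le>Suc k. R x * (of_nat (Suc k choose i) * x b ^ (Suc k - i)) * x s ^ i)] (mod int p)"
      by simp
  qed (use k bs in \<open>auto simp: R\<close>)
  moreover have "\<not> [int (Suc k) = 0] (mod int p)"
    using k by (simp add: cong_0_iff del: of_nat_Suc) (auto dest: dvd_imp_le)
  then obtain c where c: "[int (Suc k) * c = 1] (mod int p)" using prime_inverse[OF p] by blast
  ultimately have "(\<lambda>x. c * ((R x * (of_nat (Suc k choose k) * x b ^ (Suc k - k))) * x s ^ k)) \<in> part K"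
    using part_scale by blast
  then show ?thesis
  proof (rule part_cong)
    fix x
    show "[c * ((R x * (of_nat (Suc k choose k) * x b ^ (Suc k - k))) * x s ^ k)
        = R x * x b * x s ^ k] (mod int p)"
      using cong_scalar_right[OF c, of "R x * x b * x s ^ k"] by (simp add: mult_ac)
  qed
qed

text \<open>
  Repeating the step turns a power into a product of distinct fresh variables.
\<close>

lemma polarize:
  assumes "finite B" "s \<notin> B" "card B < p" "\<And>x v. R (x(s := v)) = R x"
    and "(\<lambda>x. R x * x s ^ card B) \<in> part K"
  shows "(\<lambda>x. R x * (\<Prod>i\<in>B. x i)) \<in> part K"
  using assms
proof (induction B arbitrary: R rule: finite_induct)
  case empty then show ?case by simp
next
  case (insert b B)
  have R: "R (x(s := v)) = R x" for x v by (rule insert.prems(3))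
  have "(\<lambda>x. R x * x b * x s ^ card B) \<in> part K"
    by (rule polarize_step) (use insert.prems insert.hyps in \<open>simp_all add: R\<close>)
  then have "(\<lambda>x. R x * x b * (\<Prod>i\<in>B. x i)) \<in> part K"
    by (intro insert.IH) (use insert.prems insert.hyps in \<open>simp_all add: R\<close>)
  then show ?case using insert.hyps by (simp add: mult.assoc)
qed

lemma rename_monomial:
  assumes "(\<lambda>x. u (x j) * (\<Prod>i\<in>D. x i)) \<in> part K"
    and D: "finite D" "finite D'" "card D = card D'" "j \<notin> D"
  shows "(\<lambda>x. u (x j') * (\<Prod>i\<in>D'. x i)) \<in> part K"
proof -
  obtain h where h: "bij_betw h D D'" using D finite_same_card_bij by blast
  define \<sigma> where "\<sigma> i = (if i = j then j' else h i)" for i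
  have "(\<Prod>i\<in>D. x (\<sigma> i)) = (\<Prod>i\<in>D'. x i)" for x :: "nat \<Rightarrow> int"
  proof -
    have "(\<Prod>i\<in>D. x (\<sigma> i)) = (\<Prod>i\<in>D. x (h i))" using D by (intro prod.cong) (auto simp: \<sigma>_def)
    then show ?thesis using prod.reindex_bij_betw[OF h, of x] by simp
  qed
  then show ?thesis using part_rename[OF assms(1), of \<sigma>] by (simp add: \<sigma>_def)
qed

text \<open>
  Identifying the last \<open>p\<close> of the variables produces \<open>(x d)^p\<close>, which is \<open>x d\<close>.
\<close>

lemma monomial_descend:
  assumes "monomial u (d + (p - 1)) \<in> part K" "0 < d" shows "monomial u d \<in> part K"
proof -
  define \<sigma> where "\<sigma> i = (if i \<le> d then i else d)" for i
  have "(\<lambda>x. monomial u (d + (p - 1)) (\<lambda>i. x (\<sigma> i))) \<in> part K" using part_rename[OF assms(1)] .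
  then show ?thesis
  proof (rule part_cong)
    fix x :: "nat \<Rightarrow> int"
    have "{1..d + (p - 1)} = {1..d} \<union> {d + 1..d + (p - 1)}" by auto
    then have "(\<Prod>i\<in>{1..d + (p - 1)}. x (\<sigma> i)) = (\<Prod>i\<in>{1..d}. x (\<sigma> i)) * (\<Prod>i\<in>{d + 1..d + (p - 1)}. x (\<sigma> i))"
      by (simp add: prod.union_disjoint)
    also have "(\<Prod>i\<in>{1..d}. x (\<sigma> i)) = (\<Prod>i\<in>{1..d}. x i)" by (intro prod.cong) (auto simp: \<sigma>_def)
    also have "(\<Prod>i\<in>{d + 1..d + (p - 1)}. x (\<sigma> i)) = x d ^ (p - 1)" by (simp add: \<sigma>_def)
    also have "(\<Prod>i\<in>{1..d}. x i) = (\<Prod>i\<in>{1..<d}. x i) * x d"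
      using assms(2) by (simp add: prod.last_plus mult.commute)
    finally have "(\<Prod>i\<in>{1..d + (p - 1)}. x (\<sigma> i)) = (\<Prod>i\<in>{1..<d}. x i) * x d ^ p"
      using p0 by (simp add: mult.assoc power_eq_if)
    moreover have "[(\<Prod>i\<in>{1..<d}. x i) * x d ^ p = (\<Prod>i\<in>{1..<d}. x i) * x d] (mod int p)"
      using fermat_int_power_p[OF p] by (rule cong_scalar_left)
    moreover have "(\<Prod>i\<in>{1..<d}. x i) * x d = (\<Prod>i\<in>{1..d}. x i)"
      using assms(2) by (simp add: prod.last_plus mult.commute)
    ultimately have "[(\<Prod>i\<in>{1..d + (p - 1)}. x (\<sigma> i)) = (\<Prod>i\<in>{1..d}. x i)] (mod int p)" by simp
    then show "[monomial u (d + (p - 1)) (\<lambda>i. x (\<sigma> i)) = monomial u d x] (mod int p)"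
      unfolding monomial_def by (simp add: \<sigma>_def cong_scalar_left)
  qed
qed

text \<open>
  Substituting the monomial for one variable of its own power multiplies the coefficient
  function by \<open>u\<close> and adds \<open>d - 1\<close> variables.
\<close>

lemma monomial_power:
  assumes "monomial u d \<in> part K" "0 < d"
  shows "monomial (\<lambda>y. u y ^ Suc k) (Suc k * (d - 1) + 1) \<in> part K"
proof (induction k)
  case 0
  have "monomial (\<lambda>y. u y ^ Suc 0) (Suc 0 * (d - 1) + 1) = monomial u d" using assms(2) by simp
  then show ?case using assms(1) by simp
next
  case (Suc k)
  define n where "n = Suc k * (d - 1) + 1"
  have n: "0 < n" by (simp add: n_def)
  have "(\<lambda>x. u (x 0) * (\<Prod>i\<in>{n..n + (d - 1)}. x i)) \<in> part K"
  proof (rule rename_monomial[of u 0 "{1..d}"])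
    have "monomial u d = (\<lambda>x. u (x 0) * (\<Prod>i\<in>{1..d}. x i))" by (rule ext) (rule monomial_def)
    then show "(\<lambda>x. u (x 0) * (\<Prod>i\<in>{1..d}. x i)) \<in> part K" using assms(1) by simp
  qed (use assms(2) in auto)
  then have g: "(\<lambda>x. e * (u (x 0) * (\<Prod>i\<in>{n..n + (d - 1)}. x i))) \<in> K" by (simp add: part_def)
  have nn: "Suc (Suc k) * (d - 1) + 1 = n + (d - 1)" by (simp add: n_def)
  show ?case unfolding nn
  proof (rule part_cong[OF part_upd[OF Suc[folded n_def] g, of n]])
    fix x :: "nat \<Rightarrow> int"
    let ?g = "u (x 0) * (\<Prod>i\<in>{n..n + (d - 1)}. x i)"
    have P: "(\<Prod>i\<in>{1..n}. (x(n := e * ?g)) i) = (\<Prod>i\<in>{1..<n}. x i) * (e * ?g)"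
    proof -
      have "(\<Prod>i\<in>{1..n}. (x(n := e * ?g)) i) = (\<Prod>i\<in>{1..<n}. (x(n := e * ?g)) i) * (e * ?g)"
        using n by (simp add: prod.last_plus mult.commute)
      also have "(\<Prod>i\<in>{1..<n}. (x(n := e * ?g)) i) = (\<Prod>i\<in>{1..<n}. x i)"
        by (intro prod.cong) auto
      finally show ?thesis .
    qed
    have "{1..n + (d - 1)} = {1..<n} \<union> {n..n + (d - 1)}" using n by auto
    moreover have "prod x ({1..<n} \<union> {n..n + (d - 1)}) = prod x {1..<n} * prod x {n..n + (d - 1)}"
      by (rule prod.union_disjoint) auto
    ultimately have "prod x {1..n + (d - 1)} = prod x {1..<n} * prod x {n..n + (d - 1)}"
      by (simp only:)
    moreover have "[e * ?g = 1 * ?g] (mod int p)" using e_mod_p by (rule cong_scalar_right)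
    then have "[u (x 0) ^ Suc k * ((\<Prod>i\<in>{1..<n}. x i) * (e * ?g))
        = u (x 0) ^ Suc k * ((\<Prod>i\<in>{1..<n}. x i) * (1 * ?g))] (mod int p)"
      by (intro cong_scalar_left)
    ultimately show "[monomial (\<lambda>y. u y ^ Suc k) n (x(n := e * ?g))
        = monomial (\<lambda>y. u y ^ Suc (Suc k)) (n + (d - 1)) x] (mod int p)"
      unfolding monomial_def P using n by (simp add: mult_ac)
  qed
qed

lemma monomial_descend_iter:
  "monomial u (d + (p - 1) * i) \<in> part K \<Longrightarrow> 0 < d \<Longrightarrow> monomial u d \<in> part K"
proof (induction i)
  case (Suc i)
  have "d + (p - 1) * Suc i = d + (p - 1) * i + (p - 1)" by simp
  with Suc.prems(1) have "monomial u (d + (p - 1) * i + (p - 1)) \<in> part K" by (simp only:)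
  then have "monomial u (d + (p - 1) * i) \<in> part K"
    by (rule monomial_descend) (use Suc.prems(2) in simp)
  then show ?case using Suc.IH Suc.prems(2) by simp
qed simp

text \<open>
  After \<open>p\<close> factors the coefficient function is \<open>u^p = u\<close> again, while the number of variables has
  grown to \<open>p (d - 1) + 1\<close>, which exceeds \<open>d\<close> by a positive multiple of \<open>p - 1\<close> when \<open>d \<ge> 2\<close>; descending
  in steps of \<open>p - 1\<close> reaches \<open>d + (p - 1)\<close>. For \<open>d = 1\<close> substitution adds no variables.
\<close>

lemma monomial_ascend:
  assumes "monomial u d \<in> part K" "2 \<le> d" shows "monomial u (d + (p - 1)) \<in> part K"
proof -
  have "monomial (\<lambda>y. u y ^ p) (p * (d - 1) + 1) \<in> part K"
    using monomial_power[OF assms(1), of "p - 1"] assms(2) p0 by simp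
  then have "monomial u (p * (d - 1) + 1) \<in> part K"
    by (rule part_cong) (auto simp: monomial_def intro!: cong_scalar_right fermat_int_power_p p)
  moreover have "p * (d - 1) + 1 = d + (p - 1) + (p - 1) * (d - 2)"
  proof -
    have "p = Suc (p - 1)" "d = Suc (Suc (d - 2))" using p0 assms(2) by simp_all
    then obtain p' d' where "p = Suc p'" "d = Suc (Suc d')" by blast
    then show ?thesis by (simp add: algebra_simps)
  qed
  ultimately show ?thesis using monomial_descend_iter[of u "d + (p - 1)" "d - 2"] assms(2) by simp
qed

lemma monomial_ascend_iter:
  "monomial u d \<in> part K \<Longrightarrow> 2 \<le> d \<Longrightarrow> monomial u (d + (p - 1) * i) \<in> part K"
proof (induction i)
  case (Suc i)
  have "d + (p - 1) * Suc i = d + (p - 1) * i + (p - 1)" by simp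
  moreover have "monomial u (d + (p - 1) * i + (p - 1)) \<in> part K"
    using Suc by (intro monomial_ascend) simp_all
  ultimately show ?case by (simp only:)
qed simp

end

context
  fixes K L
  assumes K: "lifted_clone (int (p * q)) K" and L: "lifted_clone (int (p * q)) L"
    and sub: "\<And>d. d \<le> p \<Longrightarrow> coefficient_space K d \<subseteq> coefficient_space L d"
begin

text \<open>
  Lowering and raising the degree by multiples of \<open>p - 1\<close> reduces any degree above \<open>p\<close> to one
  between 2 and \<open>p\<close>, where the spaces of \<open>K\<close> and \<open>L\<close> are compared by assumption.
\<close>

lemma transfer_monomial:
  assumes u: "u \<in> periodic_funs p q" and mem: "monomial u d \<in> part K"
  shows "monomial u d \<in> part L"
proof -
  have small: "monomial u d \<in> part L" if "d \<le> p" "monomial u d \<in> part K" for d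
    using sub[OF that(1)] that(2) u by (auto simp: coefficient_space_def)
  show ?thesis
  proof (cases "d \<le> p")
    case True then show ?thesis using small mem by blast
  next
    case False
    \<comment> \<open>the representative of \<open>d\<close> modulo \<open>p - 1\<close> between 2 and \<open>p\<close>\<close>
    define d0 where "d0 = 2 + (d - 2) mod (p - 1)"
    have p2: "2 \<le> p" using p by (rule prime_ge_2_nat)
    have d: "d = d0 + (p - 1) * ((d - 2) div (p - 1))"
      using False p2 by (simp add: d0_def)
    have "(d - 2) mod (p - 1) < p - 1" using p2 by (intro mod_less_divisor) simp
    then have d0: "d0 \<le> p" "2 \<le> d0" by (simp_all add: d0_def)
    have "monomial u d0 \<in> part K"
      by (rule monomial_descend_iter[OF K, of _ _ "(d - 2) div (p - 1)"]) (use mem d d0 in simp_all)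
    then have "monomial u d0 \<in> part L" using small d0 by blast
    from monomial_ascend_iter[OF L this d0(2), of "(d - 2) div (p - 1)"] show ?thesis using d by simp
  qed
qed

lemma transfer_unary:
  assumes u: "\<And>v w. [v = w] (mod int q) \<Longrightarrow> [u v = u w] (mod int p)"
    and D: "finite D" "j \<notin> D" and mem: "(\<lambda>x. u (x j) * (\<Prod>i\<in>D. x i)) \<in> part K"
  shows "(\<lambda>x. u (x j) * (\<Prod>i\<in>D. x i)) \<in> part L"
proof -
  \<comment> \<open>the representative of \<open>u\<close> with reduced values and arguments\<close>
  define u' where "u' y = u (y mod int q) mod int p" for y
  have u': "u' \<in> periodic_funs p q" using p0 by (simp add: periodic_funs_def u'_def)
  have uu': "[u y = u' y] (mod int p)" for y
    using u[of y "y mod int q"] by (simp add: u'_def)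
  have "(\<lambda>x. u' (x j) * (\<Prod>i\<in>D. x i)) \<in> part K"
    by (rule part_cong[OF K mem]) (intro cong_scalar_right uu')
  then have "(\<lambda>x. u' (x 0) * (\<Prod>i\<in>{1..card D}. x i)) \<in> part K"
    by (rule rename_monomial[OF K]) (use D in auto)
  then have "monomial u' (card D) \<in> part K" unfolding monomial_def[abs_def] .
  then have "monomial u' (card D) \<in> part L" by (rule transfer_monomial[OF u'])
  then have "(\<lambda>x. u' (x 0) * (\<Prod>i\<in>{1..card D}. x i)) \<in> part L" unfolding monomial_def[abs_def] .
  then have "(\<lambda>x. u' (x j) * (\<Prod>i\<in>D. x i)) \<in> part L"
    by (rule rename_monomial[OF L]) (use D in auto)
  then show ?thesis
    by (rule part_cong[OF L]) (intro cong_scalar_right cong_sym[OF uu'])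
qed

text \<open>
  Induction on the number of entries \<open>J\<close> on which the coefficient \<open>r\<close> depends. For two of them,
  \<open>plane_identity\<close> writes \<open>r\<close> through its restrictions to lines in their plane. Each restriction
  loses one entry, is transferred by the induction hypothesis, and is then put back onto
  the plane by linear substitutions inside \<open>L\<close>.
\<close>

lemma transfer_torsion:
  assumes "finite J" "finite D" "J \<inter> D = {}"
    and "depends_modulo (\<lambda>i. if i \<in> J then int q else 1) r"
    and "(\<lambda>x. r x * (\<Prod>i\<in>D. x i)) \<in> part K"
  shows "(\<lambda>x. r x * (\<Prod>i\<in>D. x i)) \<in> part L"
  using assms
proof (induction "card J" arbitrary: J r rule: less_induct)
  case less
  note J = less.prems(1) and D = less.prems(2) and disj = less.prems(3) and r = less.prems(4)
    and mem = less.prems(5)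
  show ?case
  proof (cases "card J \<le> 1")
    case True
    obtain j where j: "J \<subseteq> {j}" "j \<notin> D"
    proof (cases "J = {}")
      case True
      then show ?thesis using that ex_new_if_finite[OF infinite_UNIV_nat D] by blast
    next
      case False
      then have "card J = 1" using True J by (simp add: card_gt_0_iff le_antisym Suc_leI)
      then obtain j where "J = {j}" by (rule card_1_singletonE)
      then show ?thesis using that disj by blast
    qed
    define u where "u y = r (\<lambda>_. y)" for y
    have ru: "[r x = u (x j)] (mod int p)" for x
      unfolding u_def by (rule depends_moduloD[OF r]) (use j in auto)
    have "[u v = u w] (mod int p)" if "[v = w] (mod int q)" for v w
      unfolding u_def by (rule depends_moduloD[OF r]) (use that in auto)
    moreover have "(\<lambda>x. u (x j) * (\<Prod>i\<in>D. x i)) \<in> part K"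
      by (rule part_cong[OF K mem]) (intro cong_scalar_right ru)
    ultimately have "(\<lambda>x. u (x j) * (\<Prod>i\<in>D. x i)) \<in> part L"
      using D j by (intro transfer_unary) auto
    then show ?thesis by (rule part_cong[OF L]) (intro cong_scalar_right cong_sym[OF ru])
  next
    case False
    then obtain a b where ab: "a \<in> J" "b \<in> J" "a \<noteq> b"
      using card_le_Suc0_iff_eq[OF J] by auto
    have notD: "a \<notin> D" "b \<notin> D" using ab disj by auto
    have prod_upd: "(\<Prod>i\<in>D. (x(l := v)) i) = (\<Prod>i\<in>D. x i)" if "l \<notin> D" for l v and x :: "nat \<Rightarrow> int"
      using that by (intro prod.cong) auto
    define P where "P x = (\<Prod>i\<in>D. x i)" for x :: "nat \<Rightarrow> int"
    have P_upd: "P (x(a := v)) = P x" "P (x(b := v)) = P x" for x v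
      using prod_upd notD by (simp_all add: P_def)
    have shrink: "card (J - {l}) < card J" if "l \<in> J" for l
      using that J by (intro psubset_card_mono) auto
    have ray: "(\<lambda>x. r (x(b := c * x a)) * P x) \<in> part L" for c
      unfolding P_def
    proof (rule less.hyps[OF shrink[OF ab(2)]])
      show "depends_modulo (\<lambda>i. if i \<in> J - {b} then int q else 1) (\<lambda>x. r (x(b := c * x a)))"
        unfolding depends_modulo_def
      proof (intro allI impI)
        fix x y :: "nat \<Rightarrow> int"
        assume xy: "\<forall>i. [x i = y i] (mod (if i \<in> J - {b} then int q else 1))"
        have xa: "[x a = y a] (mod int q)" using xy[rule_format, of a] ab by simp
        show "[r (x(b := c * x a)) = r (y(b := c * y a))] (mod int p)"
          by (rule depends_moduloD[OF r]) (use xy xa in \<open>auto intro: cong_scalar_left split: if_splits\<close>)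
      qed
      show "(\<lambda>x. r (x(b := c * x a)) * (\<Prod>i\<in>D. x i)) \<in> part K"
        using part_upd[OF K mem lifted_scale[OF K pq0 lifted_var[OF K]], of b c a]
        by (simp only: prod_upd[OF notD(2)])
    qed (use J D disj in auto)
    have axis: "(\<lambda>x. r (x(a := 0)) * P x) \<in> part L"
      unfolding P_def
    proof (rule less.hyps[OF shrink[OF ab(1)]])
      show "depends_modulo (\<lambda>i. if i \<in> J - {a} then int q else 1) (\<lambda>x. r (x(a := 0)))"
        unfolding depends_modulo_def
      proof (intro allI impI)
        fix x y :: "nat \<Rightarrow> int"
        assume xy: "\<forall>i. [x i = y i] (mod (if i \<in> J - {a} then int q else 1))"
        show "[r (x(a := 0)) = r (y(a := 0))] (mod int p)"
          by (rule depends_moduloD[OF r]) (use xy in \<open>auto split: if_splits\<close>)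
      qed
      show "(\<lambda>x. r (x(a := 0)) * (\<Prod>i\<in>D. x i)) \<in> part K"
        using part_upd[OF K mem lifted_zero[OF K], of a] by (simp only: prod_upd[OF notD(1)])
    qed (use J D disj in auto)
    define \<phi> where "\<phi> x \<alpha> \<beta> = r (x(a := \<alpha>, b := \<beta>))" for x \<alpha> \<beta>
    \<comment> \<open>values of \<open>r\<close> on the line of slope \<open>c\<close> in the plane of \<open>a\<close> and \<open>b\<close>, at an argument \<open>g\<close> from \<open>L\<close>\<close>
    have ray': "(\<lambda>x. \<phi> x (g x) (c * g x) * P x) \<in> part L" if "g \<in> L" for g c
      using part_upd[OF L ray that, of a c] ab(3)
      by (simp add: \<phi>_def P_upd)
    have axis': "(\<lambda>x. \<phi> x 0 (g x) * P x) \<in> part L" if "g \<in> L" for g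
      using part_upd[OF L axis that, of b] ab(3)
      by (simp add: \<phi>_def P_upd fun_upd_twist)
    have lin: "(\<lambda>x. s * x a + t * x b) \<in> L" for s t
      using lifted_linear[OF L] .
    obtain q' where q': "[int q * q' = 1] (mod int p)"
    proof (rule prime_inverse[OF p, of "int q"])
      show "\<not> [int q = 0] (mod int p)"
        using primes_dvd_imp_eq[OF p q] p_neq_q by (auto simp: cong_0_iff)
    qed
    define S where "S x = (\<Sum>c\<in>{0..<int q}. \<Sum>b'\<in>{0..<int q}.
         \<phi> x (x a + b' * (x b - c * x a)) (c * (x a + b' * (x b - c * x a))) * P x
         - \<phi> x (b' * (x b - c * x a)) (c * (b' * (x b - c * x a))) * P x)" for x
    define T where "T x = (\<Sum>b'\<in>{0..<int q}. \<phi> x 0 (x b + b' * x a) * P x - \<phi> x 0 (b' * x a) * P x)" for x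
    have S: "S \<in> part L" unfolding S_def
    proof (intro part_sum[OF L] part_diff[OF L] ray')
      fix c b' :: int
      have "(\<lambda>x. x a + b' * (x b - c * x a)) = (\<lambda>x. (1 - b' * c) * x a + b' * x b)"
        by (simp add: algebra_simps)
      then show "(\<lambda>x. x a + b' * (x b - c * x a)) \<in> L" using lin by simp
      have "(\<lambda>x. b' * (x b - c * x a)) = (\<lambda>x. (- b' * c) * x a + b' * x b)"
        by (simp add: algebra_simps)
      then show "(\<lambda>x. b' * (x b - c * x a)) \<in> L"
        using lin[of "- b' * c" b'] by (simp only:)
    qed auto
    have T: "T \<in> part L" unfolding T_def
    proof (intro part_sum[OF L] part_diff[OF L] axis')
      fix b' :: int
      show "(\<lambda>x. x b + b' * x a) \<in> L" using lin[of b' 1] by (simp add: add.commute)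
      show "(\<lambda>x. b' * x a) \<in> L" using lin[of b' 0] by simp
    qed auto
    have Z: "(\<lambda>x. \<phi> x 0 0 * P x) \<in> part L" using axis'[OF lifted_zero[OF L]] .
    have "(\<lambda>x. \<phi> x 0 0 * P x + q' * S x + q' * T x) \<in> part L"
      by (intro part_add[OF L] part_scale[OF L] S T Z)
    then show ?thesis
    proof (rule part_cong[OF L])
      fix x
      have "[\<phi> x v v' = \<phi> x w w'] (mod int p)"
        if "[v = w] (mod int q)" "[v' = w'] (mod int q)" for v v' w w'
        unfolding \<phi>_def by (rule depends_moduloD[OF r]) (use that ab in auto)
      from cong_scalar_right[OF plane_identity[OF q q', of "\<phi> x" "x a" "x b", OF this], of "P x"]
      have "[\<phi> x (x a) (x b) * P x = \<phi> x 0 0 * P x + q' * S x + q' * T x] (mod int p)"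
        by (simp only: S_def T_def distrib_right mult.assoc sum_distrib_right left_diff_distrib)
      then show "[\<phi> x 0 0 * P x + q' * S x + q' * T x = r x * (\<Prod>i\<in>D. x i)] (mod int p)"
        by (simp add: \<phi>_def P_def cong_sym_eq)
    qed
  qed
qed

lemma split_modulus:
  assumes "[v = w] (mod int p)" "[v' = w'] (mod int q)"
  shows "[e * v + (1 - e) * v' = e * w + (1 - e) * w'] (mod int (p * q))"
proof -
  have "int q dvd v' - w'" using assms(2) by (simp add: cong_iff_dvd_diff)
  moreover have "int p dvd 1 - e" using cong_sym[OF e_mod_p] by (simp add: cong_iff_dvd_diff)
  ultimately have "int p * int q dvd (1 - e) * (v' - w')" by (intro mult_dvd_mono)
  then have "[(1 - e) * v' = (1 - e) * w'] (mod int (p * q))"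
    by (simp add: cong_iff_dvd_diff right_diff_distrib)
  with assms(1) show ?thesis by (intro cong_add) (simp_all only: e_mult_cong_iff)
qed

text \<open>
  Induction on the set \<open>Z\<close> of entries that are still used modulo \<open>p q\<close>. Such an entry \<open>x i\<close> is replaced
  by \<open>e x\<^sub>i + (1 - e) x\<^sub>t\<close>, which separates its two residues: \<open>x\<^sub>i\<close> now matters modulo \<open>p\<close> and the
  fresh \<open>x\<^sub>t\<close> modulo \<open>q\<close>. Interpolation in \<open>x\<^sub>i\<close>, extraction of each power and
  polarization give functions with fewer entries in \<open>Z\<close>, to which the induction hypothesis
  applies; identifying all fresh variables with \<open>x\<^sub>i\<close> in \<open>L\<close> and summing restores the function.
\<close>

lemma transfer_mixed:
  assumes "finite Z" "finite J" "finite D" "Z \<inter> J = {}" "(Z \<union> J) \<inter> D = {}"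
    and "depends_modulo (\<lambda>i. if i \<in> Z then int (p * q) else if i \<in> J then int q else 1) r"
    and "(\<lambda>x. r x * (\<Prod>i\<in>D. x i)) \<in> part K"
  shows "(\<lambda>x. r x * (\<Prod>i\<in>D. x i)) \<in> part L"
  using assms
proof (induction Z arbitrary: J D r rule: finite_induct)
  case empty
  show ?case by (rule transfer_torsion[of J]) (use empty in simp_all)
next
  case (insert i Z)
  note J = insert.prems(1) and D = insert.prems(2) and r = insert.prems(5) and mem = insert.prems(6)
  have iJD: "i \<notin> Z" "i \<notin> J" "i \<notin> D" using insert by auto
  obtain t where t: "t \<notin> insert i Z \<union> J \<union> D"
    using ex_new_if_finite[OF infinite_UNIV_nat, of "insert i Z \<union> J \<union> D"] insert.hyps J D by auto
  define P where "P x = (\<Prod>i\<in>D. x i)" for x :: "nat \<Rightarrow> int"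
  have P_upd: "P (x(i := v)) = P x" for x v
    unfolding P_def using iJD by (intro prod.cong) auto
  define r' where "r' x = r (x(i := e * x i + (1 - e) * x t))" for x
  have mem': "(\<lambda>x. r' x * P x) \<in> part K"
    using part_upd[OF K mem lifted_linear[OF K, of e i "1 - e" t], of i]
    unfolding r'_def P_def[symmetric] P_upd .
  have r'_upd: "r' (x(i := v)) = r (x(i := e * v + (1 - e) * x t))" for x v
    using t by (simp add: r'_def)
  obtain c where c: "\<And>\<phi> v. (\<And>v w. [v = w] (mod int p) \<Longrightarrow> [\<phi> v = \<phi> w] (mod int p)) \<Longrightarrow>
       [\<phi> v = (\<Sum>k<p. (\<Sum>a<p. c a k * \<phi> (int a)) * v ^ k)] (mod int p)"
    using interpolation[OF p] by blast
  define R where "R k x = (\<Sum>a<p. c a k * r' (x(i := int a)))" for k x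
  have R_upd: "R k (x(i := v)) = R k x" for k x v by (simp add: R_def)
  have r'_R: "[r' x = (\<Sum>k<p. R k x * x i ^ k)] (mod int p)" for x
  proof -
    have "[r' (x(i := v)) = r' (x(i := w))] (mod int p)" if "[v = w] (mod int p)" for v w
      unfolding r'_upd
      by (rule depends_moduloD[OF r]) (use split_modulus[OF that cong_refl] in auto)
    from c[of "\<lambda>v. r' (x(i := v))" "x i", OF this] show ?thesis by (simp add: R_def)
  qed
  have R_dep: "depends_modulo (\<lambda>l. if l \<in> Z then int (p * q) else if l \<in> insert t J then int q else 1) (R k)" for k
    unfolding depends_modulo_def R_def
  proof (intro allI impI cong_sum cong_scalar_left)
    fix x y :: "nat \<Rightarrow> int" and a
    assume xy: "\<forall>l. [x l = y l] (mod (if l \<in> Z then int (p * q) else if l \<in> insert t J then int q else 1))"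
    have xt: "[x t = y t] (mod int q)" using xy[rule_format, of t] t by simp
    have "[(x(i := e * int a + (1 - e) * x t)) l = (y(i := e * int a + (1 - e) * y t)) l]
        (mod (if l \<in> insert i Z then int (p * q) else if l \<in> J then int q else 1))" for l
      using xy[rule_format, of l] split_modulus[OF cong_refl xt] iJD t by auto
    then show "[r' (x(i := int a)) = r' (y(i := int a))] (mod int p)"
      unfolding r'_upd by (rule depends_moduloD[OF r])
  qed
  have piece: "(\<lambda>x. R k (x(t := x i)) * x i ^ k * P x) \<in> part L" if k: "k < p" for k
  proof -
    have "(\<lambda>x. (R k x * P x) * x i ^ k) \<in> part K"
    proof (rule extract_power[OF K mem', where B = "{..<p}" and R = "\<lambda>k x. R k x * P x"])
      fix x
      show "[r' x * P x = (\<Sum>k<p. R k x * P x * x i ^ k)] (mod int p)"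
        using cong_scalar_right[OF r'_R[of x], of "P x"] by (simp add: sum_distrib_left mult_ac)
    qed (use k in \<open>simp_all add: R_upd P_upd\<close>)
    moreover obtain B where B: "finite B" "card B = k" "B \<subseteq> - (insert t (insert i Z \<union> J \<union> D))"
      using infinite_arbitrarily_large[of "- (insert t (insert i Z \<union> J \<union> D))" k] insert.hyps J D
      by (auto simp: finite_compl)
    ultimately have "(\<lambda>x. (R k x * P x) * (\<Prod>l\<in>B. x l)) \<in> part K"
      using k by (intro polarize[OF K, where s = i]) (auto simp: R_upd P_upd)
    moreover have PB: "P x * (\<Prod>l\<in>B. x l) = (\<Prod>l\<in>D \<union> B. x l)" for x
      unfolding P_def using B D by (intro prod.union_disjoint[symmetric]) auto
    ultimately have "(\<lambda>x. R k x * (\<Prod>l\<in>D \<union> B. x l)) \<in> part K" by (simp only: mult.assoc)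
    then have "(\<lambda>x. R k x * (\<Prod>l\<in>D \<union> B. x l)) \<in> part L"
      by (intro insert.IH[OF _ _ _ _ R_dep]) (use J D B insert.prems insert.hyps t in auto)
    then have "(\<lambda>x. R k x * P x * (\<Prod>l\<in>B. x l)) \<in> part L" by (simp only: PB[symmetric] mult.assoc)
    from part_rename[OF L this, of "\<lambda>l. if l \<in> insert t B then i else l"]
    show ?thesis
    proof (rule part_cong[OF L])
      fix x :: "nat \<Rightarrow> int"
      let ?y = "\<lambda>l. x (if l \<in> insert t B then i else l)"
      have "P ?y = P x" unfolding P_def using t B by (intro prod.cong) auto
      moreover have "(\<Prod>l\<in>B. ?y l) = x i ^ k" using B by simp
      moreover have "[R k ?y = R k (x(t := x i))] (mod int p)"
        by (rule depends_moduloD[OF R_dep]) (use B t in auto)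
      ultimately show "[R k ?y * P ?y * (\<Prod>l\<in>B. ?y l) = R k (x(t := x i)) * x i ^ k * P x] (mod int p)"
        using cong_scalar_right[of "R k ?y" "R k (x(t := x i))" "int p" "x i ^ k * P x"]
        by (simp add: mult_ac)
    qed
  qed
  have "(\<lambda>x. \<Sum>k<p. R k (x(t := x i)) * x i ^ k * P x) \<in> part L"
    by (rule part_sum[OF L]) (use piece in auto)
  then show ?case
  proof (rule part_cong[OF L])
    fix x
    have ti: "t \<noteq> i" using t by auto
    have "r' (x(t := x i)) = r (x(t := x i))"
    proof -
      have "(x(t := x i))(i := e * x i + (1 - e) * x i) = x(t := x i)"
        using ti by (auto simp: fun_eq_iff algebra_simps)
      then show ?thesis using ti by (simp add: r'_def)
    qed
    moreover have "[r (x(t := x i)) = r x] (mod int p)"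
      by (rule depends_moduloD[OF r]) (use t in auto)
    ultimately have "[r' (x(t := x i)) = r x] (mod int p)" by simp
    with cong_sym[OF r'_R[of "x(t := x i)"]]
    have "[(\<Sum>k<p. R k (x(t := x i)) * (x(t := x i)) i ^ k) = r x] (mod int p)"
      by (rule cong_trans)
    then have "[(\<Sum>k<p. R k (x(t := x i)) * x i ^ k) = r x] (mod int p)" using ti by simp
    from cong_scalar_right[OF this, of "P x"]
    show "[(\<Sum>k<p. R k (x(t := x i)) * x i ^ k * P x) = r x * (\<Prod>i\<in>D. x i)] (mod int p)"
      by (simp add: P_def sum_distrib_right)
  qed
qed

lemma transfer_component:
  assumes F: "F \<in> K" shows "(\<lambda>x. e * F x) \<in> L"
proof -
  obtain N where N: "depends_on_first (int (p * q)) N F" using lifted_depends[OF K F] by blast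
  have "(\<lambda>x. F x * (\<Prod>i\<in>{}. x i)) \<in> part L"
  proof (rule transfer_mixed[of "{..<N}" "{}" "{}"])
    show "depends_modulo (\<lambda>i. if i \<in> {..<N} then int (p * q) else if i \<in> {} then int q else 1) F"
      unfolding depends_modulo_def
    proof (intro allI impI)
      fix x y :: "nat \<Rightarrow> int"
      assume xy: "\<forall>i. [x i = y i] (mod (if i \<in> {..<N} then int (p * q) else if i \<in> {} then int q else 1))"
      have "[F x = F y] (mod int (p * q))"
      proof (rule depends_on_firstD[OF N])
        fix i assume "i < N"
        then show "[x i = y i] (mod int (p * q))" using xy[rule_format, of i] by simp
      qed
      then show "[F x = F y] (mod int p)" by (rule cong_dvd_modulus) simp
    qed
  qed (use subset_part[OF K F] in simp_all)
  then show ?thesis by (simp add: part_def)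
qed

end

lemma swapped: "residue_split q p (1 - e)"
proof
  show "[1 - e = 1] (mod int q)" using cong_diff[OF cong_refl[of 1] e_mod_q] by simp
  show "[1 - e = 0] (mod int p)" using cong_diff[OF cong_refl[of 1] e_mod_p] by simp
qed (use p q p_neq_q in auto)

text \<open>
  Applied in both directions, this makes the two families of coefficient spaces a complete
  invariant of the clone.
\<close>

lemma lifted_clone_subsetI:
  assumes K: "lifted_clone (int (p * q)) K" and L: "lifted_clone (int (p * q)) L"
    and "\<And>d. d \<le> p \<Longrightarrow> coefficient_space K d \<subseteq> coefficient_space L d"
    and "\<And>d. d \<le> q \<Longrightarrow> residue_split.coefficient_space q p (1 - e) K d
                    \<subseteq> residue_split.coefficient_space q p (1 - e) L d"
  shows "K \<subseteq> L"
proof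
  fix F assume F: "F \<in> K"
  interpret swap: residue_split q p "1 - e" by (rule swapped)
  have "(\<lambda>x. e * F x) \<in> L" by (rule transfer_component[OF K L assms(3) F])
  moreover have "(\<lambda>x. (1 - e) * F x) \<in> L"
    using swap.transfer_component[of K L F] K L assms(4) F by (simp add: mult.commute)
  ultimately have "(\<lambda>x. e * F x + (1 - e) * F x) \<in> L" by (rule lifted_add[OF L])
  then show "F \<in> L" by (simp add: algebra_simps)
qed

end

context
  fixes p q :: nat and U :: "(int \<Rightarrow> int) set"
  assumes U: "U \<in> invariant_spaces p q" and p0: "0 < p"
begin

lemma invariant_space_periodic: "u \<in> U \<Longrightarrow> u \<in> periodic_funs p q"
  using U by (auto simp: invariant_spaces_def)

lemma invariant_space_add:
  assumes "(\<lambda>t. f t mod int p) \<in> U" "(\<lambda>t. g t mod int p) \<in> U"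
  shows "(\<lambda>t. (f t + g t) mod int p) \<in> U"
proof -
  have "(\<lambda>t. (f t mod int p + g t mod int p) mod int p) \<in> U"
    using U assms by (simp add: invariant_spaces_def)
  then show ?thesis by (simp add: mod_add_eq)
qed

lemma invariant_space_dilate: "u \<in> U \<Longrightarrow> (\<lambda>t. u (a * t)) \<in> U"
  using U by (simp add: invariant_spaces_def)

lemma invariant_space_scale:
  assumes f: "(\<lambda>t. f t mod int p) \<in> U"
  shows "(\<lambda>t. (a * f t) mod int p) \<in> U"
proof -
  have *: "(\<lambda>t. ((int n + 1) * f t) mod int p) \<in> U" for n
  proof (induction n)
    case 0 then show ?case using f by simp
  next
    case (Suc n)
    have "(int (Suc n) + 1) * f t = (int n + 1) * f t + f t" for t by (simp add: algebra_simps)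
    then show ?case using invariant_space_add[OF Suc f] by simp
  qed
  have "((int (nat ((a - 1) mod int p)) + 1) * f t) mod int p = (a * f t) mod int p" for t
  proof -
    have "[int (nat ((a - 1) mod int p)) + 1 = a] (mod int p)"
      using p0 by (simp add: cong_def mod_add_left_eq)
    from cong_scalar_right[OF this, of "f t"] show ?thesis by (simp add: cong_def)
  qed
  then show ?thesis using *[of "nat ((a - 1) mod int p)"] by simp
qed

lemma invariant_space_mod: "u \<in> U \<Longrightarrow> (\<lambda>t. u t mod int p) \<in> U"
  using invariant_space_periodic[of u] by (simp add: periodic_funs_def)

lemma invariant_space_zero: "(\<lambda>t. 0) \<in> U"
proof -
  obtain u where "u \<in> U" using U by (auto simp: invariant_spaces_def)
  from invariant_space_scale[OF invariant_space_mod[OF this], of 0] show ?thesis by simp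
qed

lemma invariant_space_sum:
  "finite I \<Longrightarrow> (\<And>i. i \<in> I \<Longrightarrow> (\<lambda>t. f i t mod int p) \<in> U) \<Longrightarrow> (\<lambda>t. (\<Sum>i\<in>I. f i t) mod int p) \<in> U"
proof (induction I rule: finite_induct)
  case empty then show ?case using invariant_space_zero by simp
next
  case (insert i I)
  then show ?case using invariant_space_add[of "f i" "\<lambda>t. \<Sum>i\<in>I. f i t"] by simp
qed

end

lemma zero_invariant_space: "0 < p \<Longrightarrow> {\<lambda>_. 0} \<in> invariant_spaces p q"
  by (auto simp: invariant_spaces_def periodic_funs_def)

context residue_split
begin

lemma coefficient_space_invariant:
  assumes K: "lifted_clone (int (p * q)) K"
  shows "coefficient_space K d \<in> invariant_spaces p q"
  unfolding invariant_spaces_def mem_Collect_eq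
proof (intro conjI ballI allI)
  show "coefficient_space K d \<subseteq> periodic_funs p q" by (auto simp: coefficient_space_def)
  have "monomial (\<lambda>_. 0) d = (\<lambda>x. 0)" by (simp add: monomial_def fun_eq_iff)
  then have "(\<lambda>_. 0) \<in> coefficient_space K d"
    using lifted_zero[OF K] p0 by (simp add: coefficient_space_def part_def periodic_funs_def)
  then show "coefficient_space K d \<noteq> {}" by blast
next
  fix u v assume uv: "u \<in> coefficient_space K d" "v \<in> coefficient_space K d"
  then have "(\<lambda>x. monomial u d x + monomial v d x) \<in> part K"
    by (intro part_add[OF K]) (auto simp: coefficient_space_def)
  then have "monomial (\<lambda>y. (u y + v y) mod int p) d \<in> part K"
  proof (rule part_cong[OF K])
    fix x
    have "[(u (x 0) + v (x 0)) * (\<Prod>i\<in>{1..d}. x i)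
        = ((u (x 0) + v (x 0)) mod int p) * (\<Prod>i\<in>{1..d}. x i)] (mod int p)"
      by (intro cong_scalar_right) simp
    then show "[monomial u d x + monomial v d x = monomial (\<lambda>y. (u y + v y) mod int p) d x] (mod int p)"
      by (simp add: monomial_def distrib_right)
  qed
  then show "(\<lambda>y. (u y + v y) mod int p) \<in> coefficient_space K d"
    using uv p0 by (simp add: coefficient_space_def periodic_funs_def)
next
  fix u and a :: int assume u: "u \<in> coefficient_space K d"
  have "(\<lambda>x. monomial u d (x(0 := a * x 0))) \<in> part K"
    by (rule part_upd[OF K _ lifted_scale[OF K pq0 lifted_var[OF K]]])
      (use u in \<open>simp add: coefficient_space_def\<close>)
  moreover have "monomial u d (x(0 := a * x 0)) = monomial (\<lambda>y. u (a * y)) d x" for x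
    unfolding monomial_def by (auto intro!: prod.cong)
  ultimately have "monomial (\<lambda>y. u (a * y)) d \<in> part K" by simp
  moreover have "(\<lambda>y. u (a * y)) \<in> periodic_funs p q"
  proof -
    have per: "u (y mod int q) = u y \<and> 0 \<le> u y \<and> u y < int p" for y
      using u by (auto simp: coefficient_space_def periodic_funs_def)
    have "u (a * (y mod int q)) = u (a * y)" for y
      using per[of "a * (y mod int q)"] per[of "a * y"] by (simp add: mod_mult_right_eq)
    then show ?thesis using per by (simp add: periodic_funs_def)
  qed
  ultimately show "(\<lambda>y. u (a * y)) \<in> coefficient_space K d" by (simp add: coefficient_space_def)
qed

text \<open>
  \<open>F\<close> is a linear form plus \<open>e c\<close>, where \<open>c\<close> modulo \<open>p\<close> is a function of the arguments modulo \<open>q\<close>.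
  Membership of \<open>c\<close> in the clonoid belonging to \<open>U\<close> is tested on the lines through the
  origin, which avoids generating the clonoid from \<open>U\<close>: the test is obviously
  stable under linear substitutions and linear combinations.
\<close>

definition affine_witness ::
  "(int \<Rightarrow> int) set \<Rightarrow> ((nat \<Rightarrow> int) \<Rightarrow> int) \<Rightarrow> nat \<Rightarrow> (nat \<Rightarrow> int) \<Rightarrow> ((nat \<Rightarrow> int) \<Rightarrow> int) \<Rightarrow> bool"
where
  "affine_witness U F N a c \<longleftrightarrow>
     (\<forall>i\<ge>N. a i = 0) \<and>
     (\<forall>x. [F x = (\<Sum>i<N. a i * x i) + e * c x] (mod int (p * q))) \<and>
     (\<forall>x y. (\<forall>i<N. [x i = y i] (mod int q)) \<longrightarrow> [c x = c y] (mod int p)) \<and>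
     (\<forall>v. (\<lambda>t. c (\<lambda>i. t * v i) mod int p) \<in> U)"

definition affine_clone :: "(int \<Rightarrow> int) set \<Rightarrow> ((nat \<Rightarrow> int) \<Rightarrow> int) set" where
  "affine_clone U = {F. \<exists>N a c. affine_witness U F N a c}"

lemma affine_witnessD:
  assumes "affine_witness U F N a c"
  shows "\<And>i. N \<le> i \<Longrightarrow> a i = 0"
    and "\<And>x. [F x = (\<Sum>i<N. a i * x i) + e * c x] (mod int (p * q))"
    and "\<And>x y. (\<And>i. i < N \<Longrightarrow> [x i = y i] (mod int q)) \<Longrightarrow> [c x = c y] (mod int p)"
    and "\<And>v. (\<lambda>t. c (\<lambda>i. t * v i) mod int p) \<in> U"
  using assms unfolding affine_witness_def by simp_all

lemma affine_cloneI: "affine_witness U F N a c \<Longrightarrow> F \<in> affine_clone U"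
  unfolding affine_clone_def by blast

lemma affine_cloneE:
  assumes "F \<in> affine_clone U" obtains N a c where "affine_witness U F N a c"
  using assms unfolding affine_clone_def by blast

text \<open>
  In a composition, \<open>c\<close> sees its arguments only modulo \<open>q\<close>, where they are linear because \<open>e\<close>
  vanishes there; and the outer linear form maps the inner functions \<open>g\<^sub>i\<close> to a linear combination.
\<close>

lemma lifted_clone_affine_clone:
  assumes U: "U \<in> invariant_spaces p q"
  shows "lifted_clone (int (p * q)) (affine_clone U)"
  unfolding lifted_clone_def
proof (intro conjI ballI allI impI)
  fix F assume "F \<in> affine_clone U"
  then obtain N a c where "affine_witness U F N a c" by (rule affine_cloneE)
  note F = affine_witnessD(2)[OF this] and c = affine_witnessD(3)[OF this]
  have "depends_on_first (int (p * q)) N F"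
    unfolding depends_on_first_def
  proof (intro allI impI)
    fix x y :: "nat \<Rightarrow> int" assume xy: "\<forall>i<N. [x i = y i] (mod int (p * q))"
    have "[x i = y i] (mod int q)" if "i < N" for i
      using xy that by (auto intro: cong_dvd_modulus)
    then have "[c x = c y] (mod int p)" by (rule c)
    then have "[e * c x = e * c y] (mod int (p * q))" by (simp only: e_mult_cong_iff)
    moreover have "[(\<Sum>i<N. a i * x i) = (\<Sum>i<N. a i * y i)] (mod int (p * q))"
      using xy by (intro cong_sum cong_scalar_left) simp
    ultimately have "[(\<Sum>i<N. a i * x i) + e * c x = (\<Sum>i<N. a i * y i) + e * c y] (mod int (p * q))"
      by (intro cong_add)
    then show "[F x = F y] (mod int (p * q))"
      using F[of x] F[of y] by (simp add: cong_def)
  qed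
  then show "\<exists>N. depends_on_first (int (p * q)) N F" by blast
next
  fix j :: nat
  have "(\<Sum>i<Suc j. (if i = j then 1 else 0) * x i) = x j" for x :: "nat \<Rightarrow> int" by simp
  then have "affine_witness U (\<lambda>x. x j) (Suc j) (\<lambda>i. if i = j then 1 else 0) (\<lambda>_. 0)"
    using invariant_space_zero[OF U p0] by (simp add: affine_witness_def)
  then show "(\<lambda>x. x j) \<in> affine_clone U" by (rule affine_cloneI)
next
  have "(\<Sum>i<2. (if i < 2 then 1 else 0) * x i) = x 0 + x 1" for x :: "nat \<Rightarrow> int"
    by (simp add: numeral_2_eq_2)
  then have "affine_witness U (\<lambda>x. x 0 + x 1) 2 (\<lambda>i. if i < 2 then 1 else 0) (\<lambda>_. 0)"
    using invariant_space_zero[OF U p0] by (simp add: affine_witness_def)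
  then show "(\<lambda>x. x 0 + x 1) \<in> affine_clone U" by (rule affine_cloneI)
next
  fix F G assume F: "F \<in> affine_clone U" and FG: "\<forall>x. [F x = G x] (mod int (p * q))"
  from F obtain N a c where "affine_witness U F N a c" by (rule affine_cloneE)
  then have "affine_witness U G N a c"
    using FG unfolding affine_witness_def by (simp add: cong_def)
  then show "G \<in> affine_clone U" by (rule affine_cloneI)
next
  fix F and G :: "nat \<Rightarrow> (nat \<Rightarrow> int) \<Rightarrow> int"
  assume F: "F \<in> affine_clone U" and G: "\<forall>i. G i \<in> affine_clone U"
  from F obtain N a c where w: "affine_witness U F N a c" by (rule affine_cloneE)
  note F = affine_witnessD(2)[OF w] and c = affine_witnessD(3)[OF w] and cU = affine_witnessD(4)[OF w]
  have "\<forall>i. \<exists>N b g. affine_witness U (G i) N b g"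
    using G by (simp add: affine_clone_def)
  then obtain n b g where w': "\<And>i. affine_witness U (G i) (n i) (b i) (g i)"
    by metis
  note b = affine_witnessD(1)[OF w'] and G = affine_witnessD(2)[OF w']
    and g = affine_witnessD(3)[OF w'] and gU = affine_witnessD(4)[OF w']
  \<comment> \<open>any common bound of the \<open>n i\<close> would do\<close>
  define M where "M = (\<Sum>i<N. n i)"
  have nM: "n i \<le> M" if "i < N" for i unfolding M_def using that by (simp add: member_le_sum)
  define lin where "lin i x = (\<Sum>j<M. b i j * x j)" for i and x :: "nat \<Rightarrow> int"
  have lin: "[G i x = lin i x + e * g i x] (mod int (p * q))" if "i < N" for i x
  proof -
    have "(\<Sum>j<n i. b i j * x j) = lin i x"
      unfolding lin_def using nM[OF that] b by (intro sum.mono_neutral_left) auto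
    then show ?thesis using G[of i x] by simp
  qed
  define a' where "a' j = (\<Sum>i<N. a i * b i j)" for j
  define c' where "c' x = (\<Sum>i<N. a i * g i x) + c (\<lambda>i. lin i x)" for x
  have "a' j = 0" if "j \<ge> M" for j
    unfolding a'_def using b nM that by (intro sum.neutral) (auto intro: order_trans)
  moreover have "[F (\<lambda>i. G i x) = (\<Sum>j<M. a' j * x j) + e * c' x] (mod int (p * q))" for x
  proof -
    have "[G i x = lin i x] (mod int q)" if "i < N" for i
    proof -
      have "[G i x = lin i x + e * g i x] (mod int q)"
        using lin[OF that] by (rule cong_dvd_modulus) simp
      also have "[lin i x + e * g i x = lin i x + 0 * g i x] (mod int q)"
        using e_mod_q by (intro cong_add cong_scalar_right cong_refl)
      finally show ?thesis by simp
    qed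
    then have "[c (\<lambda>i. G i x) = c (\<lambda>i. lin i x)] (mod int p)" by (rule c)
    then have "[e * c (\<lambda>i. G i x) = e * c (\<lambda>i. lin i x)] (mod int (p * q))"
      by (simp only: e_mult_cong_iff)
    moreover have "[(\<Sum>i<N. a i * G i x) = (\<Sum>i<N. a i * (lin i x + e * g i x))] (mod int (p * q))"
      using lin by (intro cong_sum cong_scalar_left) simp
    ultimately have "[(\<Sum>i<N. a i * G i x) + e * c (\<lambda>i. G i x)
        = (\<Sum>i<N. a i * (lin i x + e * g i x)) + e * c (\<lambda>i. lin i x)] (mod int (p * q))"
      by (intro cong_add)
    also have "(\<Sum>i<N. a i * (lin i x + e * g i x)) + e * c (\<lambda>i. lin i x)
        = (\<Sum>i<N. a i * lin i x) + e * c' x"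
      by (simp add: c'_def algebra_simps sum.distrib sum_distrib_left)
    also have "(\<Sum>i<N. a i * lin i x) = (\<Sum>j<M. a' j * x j)"
      unfolding lin_def a'_def sum_distrib_left sum_distrib_right
      by (subst sum.swap) (simp add: mult_ac)
    finally show ?thesis using F[of "\<lambda>i. G i x"] by (simp add: cong_def)
  qed
  moreover have "[c' x = c' y] (mod int p)" if xy: "\<forall>j<M. [x j = y j] (mod int q)" for x y
    unfolding c'_def
  proof (intro cong_add cong_sum cong_scalar_left)
    fix i assume "i \<in> {..<N}"
    then show "[g i x = g i y] (mod int p)" using nM[of i] xy by (intro g) auto
  next
    have "[lin i x = lin i y] (mod int q)" for i
      unfolding lin_def using xy by (intro cong_sum cong_scalar_left) auto
    then show "[c (\<lambda>i. lin i x) = c (\<lambda>i. lin i y)] (mod int p)" by (intro c)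
  qed
  moreover have "(\<lambda>t. c' (\<lambda>j. t * v j) mod int p) \<in> U" for v
  proof -
    have "lin i (\<lambda>j. t * v j) = t * lin i v" for i t
      by (simp add: lin_def sum_distrib_left mult_ac)
    moreover have "(\<lambda>t. ((\<Sum>i<N. a i * g i (\<lambda>j. t * v j)) + c (\<lambda>i. t * lin i v)) mod int p) \<in> U"
      by (intro invariant_space_add[OF U p0] invariant_space_sum[OF U p0]
          invariant_space_scale[OF U p0] gU cU) simp
    ultimately show ?thesis by (simp add: c'_def)
  qed
  ultimately have "affine_witness U (\<lambda>x. F (\<lambda>i. G i x)) M a' c'"
    unfolding affine_witness_def by simp
  then show "(\<lambda>x. F (\<lambda>i. G i x)) \<in> affine_clone U" by (rule affine_cloneI)
qed

text \<open>
  If \<open>e u\<close> is a linear form plus \<open>e c\<close>, evaluating at multiples of \<open>1 - e\<close> makes the linear form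
  vanish modulo \<open>p\<close> without changing the arguments modulo \<open>q\<close>. So \<open>u\<close> is \<open>c\<close> on a line.
\<close>

lemma coefficient_space_affine_clone:
  assumes U: "U \<in> invariant_spaces p q"
  shows "coefficient_space (affine_clone U) 0 = U"
proof (intro subset_antisym subsetI)
  fix u assume u: "u \<in> U"
  have per: "u \<in> periodic_funs p q" by (rule invariant_space_periodic[OF U p0 u])
  have "affine_witness U (\<lambda>x. e * u (x 0)) 1 (\<lambda>_. 0) (\<lambda>x. u (x 0))"
    unfolding affine_witness_def
  proof (intro conjI allI impI)
    fix x y :: "nat \<Rightarrow> int" assume "\<forall>i<1. [x i = y i] (mod int q)"
    then have "u (x 0) = u (y 0)" by (intro periodic_cong[OF per]) simp
    then show "[u (x 0) = u (y 0)] (mod int p)" by simp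
  next
    fix v :: "nat \<Rightarrow> int"
    show "(\<lambda>t. u (t * v 0) mod int p) \<in> U"
      using invariant_space_mod[OF U p0 invariant_space_dilate[OF U p0 u, of "v 0"]]
      by (simp add: mult.commute)
  qed simp_all
  then have "(\<lambda>x. e * u (x 0)) \<in> affine_clone U" by (rule affine_cloneI)
  then show "u \<in> coefficient_space (affine_clone U) 0"
    using per by (simp add: coefficient_space_def part_def monomial_def)
next
  fix u assume "u \<in> coefficient_space (affine_clone U) 0"
  then have per: "u \<in> periodic_funs p q" and "(\<lambda>x. e * u (x 0)) \<in> affine_clone U"
    by (simp_all add: coefficient_space_def part_def monomial_def)
  from this(2) obtain N a c where w: "affine_witness U (\<lambda>x. e * u (x 0)) N a c"
    by (rule affine_cloneE)
  note F = affine_witnessD(2)[OF w] and c = affine_witnessD(3)[OF w] and cU = affine_witnessD(4)[OF w]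
  define v where "v i = (if i = (0::nat) then 1 else 0 :: int)" for i
  have e1: "[(1 - e) * t = t] (mod int q)" for t
    using cong_scalar_right[OF cong_diff[OF cong_refl[of 1] e_mod_q], of t] by simp
  have "u t = c (\<lambda>i. t * v i) mod int p" for t
  proof -
    \<comment> \<open>congruent to \<open>t v\<close> modulo \<open>q\<close> and to 0 modulo \<open>p\<close>\<close>
    let ?x = "\<lambda>i. (1 - e) * t * v i"
    have "[e * u (?x 0) = (\<Sum>i<N. a i * ?x i) + e * c ?x] (mod int p)"
      using F[of ?x] by (rule cong_dvd_modulus) simp
    also have "[(\<Sum>i<N. a i * ?x i) + e * c ?x = (\<Sum>i<N. a i * (0 * t * v i)) + 1 * c (\<lambda>i. t * v i)] (mod int p)"
    proof (rule cong_add)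
      have "[1 - e = 0] (mod int p)" using cong_diff[OF cong_refl[of 1] e_mod_p] by simp
      then show "[(\<Sum>i<N. a i * ?x i) = (\<Sum>i<N. a i * (0 * t * v i))] (mod int p)"
        by (intro cong_sum cong_scalar_left cong_scalar_right)
      have "[c ?x = c (\<lambda>i. t * v i)] (mod int p)"
        by (intro c cong_scalar_right e1)
      with e_mod_p show "[e * c ?x = 1 * c (\<lambda>i. t * v i)] (mod int p)" by (rule cong_mult)
    qed
    finally have "[e * u ((1 - e) * t) = c (\<lambda>i. t * v i)] (mod int p)" by (simp add: v_def)
    moreover have "u ((1 - e) * t) = u t" by (rule periodic_cong[OF per e1])
    moreover have "[e * u t = 1 * u t] (mod int p)" using e_mod_p by (rule cong_scalar_right)
    moreover have "u t mod int p = u t" using per by (simp add: periodic_funs_def)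
    ultimately show ?thesis by (simp add: cong_def)
  qed
  then have "u = (\<lambda>t. c (\<lambda>i. t * v i) mod int p)" by blast
  then show "u \<in> U" using cU by simp
qed

text \<open>
  Modulo \<open>q\<close> only the linear form is left, and it vanishes at multiples of \<open>e\<close>, which represent all
  residues modulo \<open>p\<close>.
\<close>

lemma other_coefficient_space_affine_clone:
  assumes U: "U \<in> invariant_spaces p q"
  shows "residue_split.coefficient_space q p (1 - e) (affine_clone U) 0 = {\<lambda>_. 0}"
proof -
  interpret swap: residue_split q p "1 - e" by (rule swapped)
  have "w = (\<lambda>_. 0)" if "w \<in> swap.coefficient_space (affine_clone U) 0" for w
  proof -
    from that have per: "w \<in> periodic_funs q p" and "(\<lambda>x. (1 - e) * w (x 0)) \<in> affine_clone U"
      by (simp_all add: swap.coefficient_space_def swap.part_def swap.monomial_def)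
    from this(2) obtain N a c where w: "affine_witness U (\<lambda>x. (1 - e) * w (x 0)) N a c"
      by (rule affine_cloneE)
    note F = affine_witnessD(2)[OF w]
    define v where "v i = (if i = (0::nat) then 1 else 0 :: int)" for i
    have "w t = 0" for t
    proof -
      \<comment> \<open>congruent to \<open>t v\<close> modulo \<open>p\<close> and to 0 modulo \<open>q\<close>\<close>
      let ?x = "\<lambda>i. e * t * v i"
      have "[(1 - e) * w (?x 0) = (\<Sum>i<N. a i * ?x i) + e * c ?x] (mod int q)"
        using F[of ?x] by (rule cong_dvd_modulus) simp
      also have "[(\<Sum>i<N. a i * ?x i) + e * c ?x = (\<Sum>i<N. a i * (0 * t * v i)) + 0 * c ?x] (mod int q)"
        by (intro cong_add cong_sum cong_scalar_left cong_scalar_right e_mod_q)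
      finally have "[(1 - e) * w (e * t) = 0] (mod int q)" by (simp add: v_def)
      moreover have "w (e * t) = w t"
        using periodic_cong[OF per cong_scalar_right[OF e_mod_p, of t]] by simp
      moreover have "[(1 - e) * w t = 1 * w t] (mod int q)"
        using swap.e_mod_p by (rule cong_scalar_right)
      moreover have "w t mod int q = w t" using per by (simp add: periodic_funs_def)
      ultimately show ?thesis by (simp add: cong_def)
    qed
    then show ?thesis by blast
  qed
  moreover have "(\<lambda>_. 0) \<in> swap.coefficient_space (affine_clone U) 0"
    using invariant_space_zero[OF swap.coefficient_space_invariant swap.p0]
      lifted_clone_affine_clone[OF U] by (simp add: mult.commute)
  ultimately show ?thesis by blast
qed

definition coefficient_spaces where
  "coefficient_spaces K = (\<lambda>d\<in>{..p}. coefficient_space K d)"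

lemma card_lifted_clones_upper:
  assumes fin: "finite (invariant_spaces p q)" "finite (invariant_spaces q p)"
  shows "finite {K. lifted_clone (int (p * q)) K}"
    and "card {K. lifted_clone (int (p * q)) K}
      \<le> card (invariant_spaces p q) ^ (p + 1) * card (invariant_spaces q p) ^ (q + 1)"
proof -
  interpret swap: residue_split q p "1 - e" by (rule swapped)
  let ?\<Phi> = "\<lambda>K. (coefficient_spaces K, swap.coefficient_spaces K)"
  let ?T = "({..p} \<rightarrow>\<^sub>E invariant_spaces p q) \<times> ({..q} \<rightarrow>\<^sub>E invariant_spaces q p)"
  have inj: "inj_on ?\<Phi> {K. lifted_clone (int (p * q)) K}"
  proof (rule inj_onI)
    fix K L assume K: "K \<in> {K. lifted_clone (int (p * q)) K}" and L: "L \<in> {K. lifted_clone (int (p * q)) K}"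
      and eq: "?\<Phi> K = ?\<Phi> L"
    have e1: "coefficient_spaces K = coefficient_spaces L"
      and e2: "swap.coefficient_spaces K = swap.coefficient_spaces L" using eq by simp_all
    have 1: "coefficient_space K d = coefficient_space L d" if "d \<le> p" for d
      using fun_cong[OF e1, of d] that
      by (simp add: coefficient_spaces_def)
    have 2: "swap.coefficient_space K d = swap.coefficient_space L d" if "d \<le> q" for d
      using fun_cong[OF e2, of d] that
      by (simp add: swap.coefficient_spaces_def)
    show "K = L"
      using lifted_clone_subsetI[of K L] lifted_clone_subsetI[of L K] K L 1 2 by auto
  qed
  have sub: "?\<Phi> ` {K. lifted_clone (int (p * q)) K} \<subseteq> ?T"
    using coefficient_space_invariant swap.coefficient_space_invariant
    by (auto simp: coefficient_spaces_def swap.coefficient_spaces_def mult.commute)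
  have finT: "finite ?T" using fin by (intro finite_cartesian_product finite_PiE) auto
  show "finite {K. lifted_clone (int (p * q)) K}" using inj sub finT by (rule inj_on_finite)
  have "card {K. lifted_clone (int (p * q)) K} \<le> card ?T" using inj sub finT by (rule card_inj_on_le)
  then show "card {K. lifted_clone (int (p * q)) K}
      \<le> card (invariant_spaces p q) ^ (p + 1) * card (invariant_spaces q p) ^ (q + 1)"
    by (simp add: card_cartesian_product card_PiE)
qed

text \<open>
  The pair of the coefficient spaces in degree 0 takes all values \<open>(U, 0)\<close> and \<open>(0, U)\<close>; these two
  families of pairs share exactly one element.
\<close>

lemma card_lifted_clones_lower:
  assumes fin: "finite (invariant_spaces p q)" "finite (invariant_spaces q p)"
  shows "card (invariant_spaces p q) + card (invariant_spaces q p) - 1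
    \<le> card {K. lifted_clone (int (p * q)) K}"
proof -
  interpret swap: residue_split q p "1 - e" by (rule swapped)
  \<comment> \<open>the pair of spaces in degree 0 already distinguishes the affine clones\<close>
  let ?\<Phi> = "\<lambda>K. (coefficient_space K 0, swap.coefficient_space K 0)"
  let ?A = "(\<lambda>U. (U, {\<lambda>_ :: int. 0 :: int})) ` invariant_spaces p q"
  let ?B = "Pair {\<lambda>_ :: int. 0 :: int} ` invariant_spaces q p"
  have "(U, {\<lambda>_. 0}) \<in> ?\<Phi> ` {K. lifted_clone (int (p * q)) K}" if "U \<in> invariant_spaces p q" for U
    using that lifted_clone_affine_clone coefficient_space_affine_clone other_coefficient_space_affine_clone
    by (intro image_eqI[of _ _ "affine_clone U"]) auto
  moreover have "({\<lambda>_. 0}, U) \<in> ?\<Phi> ` {K. lifted_clone (int (p * q)) K}" if "U \<in> invariant_spaces q p" for U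
    using that swap.lifted_clone_affine_clone swap.coefficient_space_affine_clone
      swap.other_coefficient_space_affine_clone
    by (intro image_eqI[of _ _ "swap.affine_clone U"]) (auto simp: mult.commute)
  ultimately have "?A \<union> ?B \<subseteq> ?\<Phi> ` {K. lifted_clone (int (p * q)) K}" by blast
  then have "card (?A \<union> ?B) \<le> card (?\<Phi> ` {K. lifted_clone (int (p * q)) K})"
    using card_lifted_clones_upper(1)[OF fin] by (intro card_mono) auto
  also have "\<dots> \<le> card {K. lifted_clone (int (p * q)) K}"
    using card_lifted_clones_upper(1)[OF fin] by (rule card_image_le)
  finally have le: "card (?A \<union> ?B) \<le> card {K. lifted_clone (int (p * q)) K}" .
  have "card ?A = card (invariant_spaces p q)" "card ?B = card (invariant_spaces q p)"
    by (auto intro!: card_image inj_onI)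
  moreover have "card (?A \<inter> ?B) \<le> card {({\<lambda>_. 0 :: int}, {\<lambda>_. 0 :: int}) :: (int \<Rightarrow> int) set \<times> (int \<Rightarrow> int) set}"
    by (intro card_mono) auto
  moreover have "card {({\<lambda>_. 0 :: int}, {\<lambda>_. 0 :: int}) :: (int \<Rightarrow> int) set \<times> (int \<Rightarrow> int) set} = 1"
    by simp
  moreover have "card ?A + card ?B = card (?A \<union> ?B) + card (?A \<inter> ?B)"
    by (rule card_Un_Int) (use fin in auto)
  ultimately show ?thesis using le by linarith
qed

end

section \<open>Ideals containing a product of irreducible elements\<close>

context principal_domain
begin

lemma irreducible_divides_mult:
  assumes "f \<in> carrier R" "ring_irreducible f" "a \<in> carrier R" "b \<in> carrier R" "f divides (a \<otimes> b)"
  shows "f divides a \<or> f divides b"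
  using assms primeness_condition[of f] unfolding ring_prime_def Divisibility.prime_def by blast

lemma irreducible_divides_power:
  assumes f: "f \<in> carrier R" "ring_irreducible f" and a: "a \<in> carrier R"
  shows "f divides (a [^] (n::nat)) \<Longrightarrow> f divides a"
proof (induction n)
  case 0
  then have "f \<in> Units R" using f(1) by (simp add: divides_one)
  then show ?case using ring_irreducibleE(4)[OF f] by blast
next
  case (Suc n)
  then show ?case using irreducible_divides_mult[OF f, of "a [^] n" a] a by auto
qed

lemma irreducible_divides_irreducible:
  assumes f: "f \<in> carrier R" "ring_irreducible f" and g: "g \<in> carrier R" "ring_irreducible g"
    and dvd: "g divides f"
  shows "g \<sim> f"
proof -
  obtain c where c: "c \<in> carrier R" "f = g \<otimes> c" using dvd unfolding factor_def by blast
  have "c \<in> Units R"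
    using ring_irreducibleE(5)[OF f g(1) c(1) c(2)] ring_irreducibleE(4)[OF g] by blast
  then have "g = f \<otimes> inv c" "inv c \<in> carrier R"
    using c g(1) by (simp_all add: m_assoc)
  then have "f divides g" unfolding factor_def by blast
  with dvd show ?thesis unfolding associated_def by blast
qed

lemma finprod_power_closed:
  "(\<And>i. i \<in> S \<Longrightarrow> f i \<in> carrier R) \<Longrightarrow> (\<Otimes>i\<in>S. f i [^] (j i :: nat)) \<in> carrier R"
  by (rule finprod_closed) (simp add: Pi_I)

lemma finprod_power_insert:
  assumes "finite S" "i \<notin> S" "\<And>l. l \<in> insert i S \<Longrightarrow> f l \<in> carrier R"
  shows "(\<Otimes>i\<in>insert i S. f i [^] (j i :: nat)) = f i [^] j i \<otimes> (\<Otimes>i\<in>S. f i [^] j i)"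
  by (rule finprod_insert) (use assms in \<open>simp_all add: Pi_I\<close>)

lemma irreducible_divides_finprod:
  assumes "finite S" and f: "\<And>i. i \<in> S \<Longrightarrow> f i \<in> carrier R" "\<And>i. i \<in> S \<Longrightarrow> ring_irreducible (f i)"
    and g: "g \<in> carrier R" "ring_irreducible g"
    and dvd: "g divides (\<Otimes>i\<in>S. f i [^] (j i :: nat))"
  shows "\<exists>i\<in>S. g \<sim> f i"
  using assms(1) f dvd
proof (induction S rule: finite_induct)
  case empty
  from empty.prems(3) have "g divides \<one>" by simp
  then have "g \<in> Units R" using g(1) by (simp add: divides_one)
  then show ?case using ring_irreducibleE(4)[OF g] by blast
next
  case (insert i S)
  have rest: "(\<Otimes>i\<in>S. f i [^] j i) \<in> carrier R"
    by (rule finprod_power_closed) (simp add: insert.prems(1))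
  have fi: "f i \<in> carrier R" "ring_irreducible (f i)" by (simp_all add: insert.prems(1,2))
  have "(\<Otimes>i\<in>insert i S. f i [^] j i) = f i [^] j i \<otimes> (\<Otimes>i\<in>S. f i [^] j i)"
    by (rule finprod_power_insert) (simp_all add: insert.hyps insert.prems(1))
  then have "g divides f i [^] j i \<or> g divides (\<Otimes>i\<in>S. f i [^] j i)"
    using insert.prems(3) irreducible_divides_mult[OF g _ rest, of "f i [^] j i"] fi by simp
  then show ?case
  proof
    assume "g divides f i [^] j i"
    then have "g divides f i" by (rule irreducible_divides_power[OF g fi(1)])
    then show ?thesis using irreducible_divides_irreducible[OF fi g] by blast
  next
    assume "g divides (\<Otimes>i\<in>S. f i [^] j i)"
    then have "\<exists>i\<in>S. g \<sim> f i" by (intro insert.IH) (simp_all add: insert.prems(1,2))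
    then show ?thesis by blast
  qed
qed

text \<open>
  A divisor of \<open>f^k b\<close> either absorbs a factor \<open>f\<close> or, \<open>f\<close> being prime, its cofactor does.
\<close>

lemma divisor_of_power_mult:
  assumes f: "f \<in> carrier R" "ring_irreducible f" and b: "b \<in> carrier R"
  shows "a \<in> carrier R \<Longrightarrow> a divides (f [^] k \<otimes> b) \<Longrightarrow>
    \<exists>j\<le>k::nat. \<exists>a'\<in>carrier R. a = f [^] j \<otimes> a' \<and> a' divides b"
proof (induction k arbitrary: a)
  case 0
  then show ?case using b by (intro exI[of _ 0]) auto
next
  case (Suc k)
  have f0: "f \<in> carrier R - {\<zero>}" using f ring_irreducibleE(1) by auto
  have eq: "f [^] Suc k \<otimes> b = f \<otimes> (f [^] k \<otimes> b)"
    using f(1) b nat_pow_Suc2[of f k] by (simp add: m_assoc)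
  show ?case
  proof (cases "f divides a")
    case True
    then obtain a1 where a1: "a1 \<in> carrier R" "a = f \<otimes> a1" unfolding factor_def by blast
    then have "a1 divides (f [^] k \<otimes> b)"
      using Suc.prems(2) mult_divides[OF a1(1) _ f0, of "f [^] k \<otimes> b"] f(1) b unfolding eq by auto
    then obtain j a' where j: "j \<le> k" "a' \<in> carrier R" "a1 = f [^] j \<otimes> a'" "a' divides b"
      using Suc.IH[OF a1(1)] by blast
    then have "a = f [^] Suc j \<otimes> a'" using a1(2) f(1) nat_pow_Suc2[of f j] by (simp add: m_assoc)
    then show ?thesis using j by (intro exI[of _ "Suc j"]) auto
  next
    case False
    obtain c where c: "c \<in> carrier R" "f \<otimes> (f [^] k \<otimes> b) = a \<otimes> c"
      using Suc.prems(2) unfolding eq factor_def by blast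
    have "f divides (a \<otimes> c)" using c(2)[symmetric] f(1) b unfolding factor_def by auto
    then have "f divides c" using irreducible_divides_mult[OF f Suc.prems(1) c(1)] False by blast
    then obtain c1 where c1: "c1 \<in> carrier R" "c = f \<otimes> c1" unfolding factor_def by blast
    have "f \<otimes> (f [^] k \<otimes> b) = f \<otimes> (a \<otimes> c1)"
      using c(2) c1 f(1) Suc.prems(1) by (simp add: m_lcomm)
    then have "f [^] k \<otimes> b = a \<otimes> c1" using f0 b c1(1) Suc.prems(1) by (subst (asm) m_lcancel) auto
    then have "a divides (f [^] k \<otimes> b)" using c1(1) unfolding factor_def by blast
    then obtain j a' where "j \<le> k" "a' \<in> carrier R" "a = f [^] j \<otimes> a'" "a' divides b"
      using Suc.IH[OF Suc.prems(1)] by blast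
    then show ?thesis by (intro exI[of _ j]) auto
  qed
qed

lemma divisor_of_finprod:
  assumes "finite S" and "\<And>i. i \<in> S \<Longrightarrow> f i \<in> carrier R" "\<And>i. i \<in> S \<Longrightarrow> ring_irreducible (f i)"
    and "a \<in> carrier R" "a divides (\<Otimes>i\<in>S. f i [^] (k i :: nat))"
  shows "\<exists>j. (\<forall>i\<in>S. j i \<le> k i) \<and> a \<sim> (\<Otimes>i\<in>S. f i [^] (j i :: nat))"
  using assms
proof (induction S arbitrary: a rule: finite_induct)
  case empty
  from empty.prems(3,4) show ?case using one_divides[of a] by (simp add: associated_def)
next
  case (insert i S)
  have cl: "(\<Otimes>i\<in>S. f i [^] (j i :: nat)) \<in> carrier R" for j
    by (rule finprod_power_closed) (simp add: insert.prems(1))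
  have fi: "f i \<in> carrier R" "ring_irreducible (f i)" by (simp_all add: insert.prems(1,2))
  have ins: "(\<Otimes>i\<in>insert i S. f i [^] (j i :: nat)) = f i [^] j i \<otimes> (\<Otimes>i\<in>S. f i [^] j i)" for j
    by (rule finprod_power_insert) (simp_all add: insert.hyps insert.prems(1))
  obtain j0 a' where a': "j0 \<le> k i" "a' \<in> carrier R" "a = f i [^] j0 \<otimes> a'"
      "a' divides (\<Otimes>i\<in>S. f i [^] k i)"
    using divisor_of_power_mult[OF fi cl insert.prems(3)] insert.prems(4) unfolding ins by blast
  obtain j where j: "\<forall>i\<in>S. j i \<le> k i" "a' \<sim> (\<Otimes>i\<in>S. f i [^] j i)"
  proof -
    have "\<exists>j. (\<forall>i\<in>S. j i \<le> k i) \<and> a' \<sim> (\<Otimes>i\<in>S. f i [^] (j i :: nat))"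
      by (rule insert.IH[OF _ _ a'(2,4)]) (simp_all add: insert.prems(1,2))
    then show ?thesis using that by blast
  qed
  define j' where "j' = j(i := j0)"
  have "(\<Otimes>i\<in>S. f i [^] j' i) = (\<Otimes>i\<in>S. f i [^] j i)"
  proof (rule finprod_cong')
    show "(\<lambda>i. f i [^] j i) \<in> S \<rightarrow> carrier R" by (simp add: Pi_I insert.prems(1))
    show "f i' [^] j' i' = f i' [^] j i'" if "i' \<in> S" for i'
      using that insert.hyps(2) by (auto simp: j'_def)
  qed simp
  then have "(\<Otimes>i\<in>insert i S. f i [^] j' i) = f i [^] j0 \<otimes> (\<Otimes>i\<in>S. f i [^] j i)"
    unfolding ins by (simp add: j'_def)
  moreover have "a \<sim> f i [^] j0 \<otimes> (\<Otimes>i\<in>S. f i [^] j i)"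
    using j(2) divides_mult[OF a'(2), of "f i [^] j0"] divides_mult[OF cl, of "f i [^] j0"] fi(1)
    unfolding a'(3) associated_def by auto
  moreover have "\<forall>i\<in>insert i S. j' i \<le> k i" using j(1) a'(1) by (auto simp: j'_def)
  ultimately show ?case by (intro exI[of _ j']) simp
qed

text \<open>
  If some exponent were too large, cancelling the common power of \<open>f i\<close> would make \<open>f i\<close> divide a
  product of powers of the other irreducible elements, hence be associated to one of them.
\<close>

lemma finprod_power_divides_imp_le:
  assumes S: "finite S" and f: "\<And>i. i \<in> S \<Longrightarrow> f i \<in> carrier R" "\<And>i. i \<in> S \<Longrightarrow> ring_irreducible (f i)"
    and distinct: "\<And>i j. i \<in> S \<Longrightarrow> j \<in> S \<Longrightarrow> i \<noteq> j \<Longrightarrow> \<not> f i \<sim> f j"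
    and dvd: "(\<Otimes>i\<in>S. f i [^] (j' i :: nat)) divides (\<Otimes>i\<in>S. f i [^] (j i :: nat))" and i: "i \<in> S"
  shows "j' i \<le> j i"
proof (rule ccontr)
  assume "\<not> j' i \<le> j i"
  then obtain l where l: "j' i = j i + Suc l" using less_imp_Suc_add by fastforce
  have fi: "f i \<in> carrier R" "ring_irreducible (f i)" "f i \<noteq> \<zero>" using f i ring_irreducibleE(1) by auto
  have cl: "(\<Otimes>i\<in>S - {i}. f i [^] (j i :: nat)) \<in> carrier R" for j
    by (rule finprod_power_closed) (simp add: f(1))
  have rem: "(\<Otimes>i\<in>S. f i [^] (j i :: nat)) = f i [^] j i \<otimes> (\<Otimes>i\<in>S - {i}. f i [^] j i)" for j
    using finprod_power_insert[of "S - {i}" i f j] S i f(1) by (simp add: insert_absorb)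
  have "f i [^] n \<noteq> \<zero>" for n :: nat
    by (induction n) (use fi(1,3) in \<open>simp_all add: integral_iff\<close>)
  then have pow: "f i [^] j i \<in> carrier R - {\<zero>}" using fi(1) by simp
  have split: "f i [^] j' i = f i [^] j i \<otimes> (f i \<otimes> f i [^] l)"
    using fi(1) nat_pow_mult[of "f i" "j i" "Suc l"] nat_pow_Suc2[of "f i" l] by (simp add: l)
  have "(\<Otimes>i\<in>S. f i [^] j' i) = f i [^] j i \<otimes> (f i \<otimes> (f i [^] l \<otimes> (\<Otimes>i\<in>S - {i}. f i [^] j' i)))"
    unfolding rem split using fi(1) cl by (simp add: m_assoc)
  with dvd have "(f i \<otimes> (f i [^] l \<otimes> (\<Otimes>i\<in>S - {i}. f i [^] j' i))) divides (\<Otimes>i\<in>S - {i}. f i [^] j i)"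
    unfolding rem[of j] using mult_divides[OF _ cl pow] fi(1) cl by simp
  moreover have "f i divides (f i \<otimes> (f i [^] l \<otimes> (\<Otimes>i\<in>S - {i}. f i [^] j' i)))"
    using fi(1) cl unfolding factor_def by auto
  ultimately have "f i divides (\<Otimes>i\<in>S - {i}. f i [^] j i)"
    using divides_trans fi(1) by blast
  then have "\<exists>l\<in>S - {i}. f i \<sim> f l"
    by (intro irreducible_divides_finprod) (simp_all add: S f fi)
  then show False using distinct i by blast
qed

text \<open>
  All ideals are principal, and \<open>PIdl a\<close> contains the product iff \<open>a\<close> divides it. The divisors up to
  units are the products with smaller exponents.
\<close>

theorem card_ideals_containing:
  assumes S: "finite S" and f: "\<And>i. i \<in> S \<Longrightarrow> f i \<in> carrier R" "\<And>i. i \<in> S \<Longrightarrow> ring_irreducible (f i)"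
    and distinct: "\<And>i j. i \<in> S \<Longrightarrow> j \<in> S \<Longrightarrow> i \<noteq> j \<Longrightarrow> \<not> f i \<sim> f j"
  shows "card {I. ideal I R \<and> (\<Otimes>i\<in>S. f i [^] (k i :: nat)) \<in> I} = (\<Prod>i\<in>S. k i + 1)"
proof -
  let ?F = "\<lambda>j :: _ \<Rightarrow> nat. \<Otimes>i\<in>S. f i [^] j i"
  have cl: "?F j \<in> carrier R" for j by (rule finprod_power_closed) (simp add: f(1))
  have mem_iff: "?F k \<in> PIdl a \<longleftrightarrow> a divides ?F k" if "a \<in> carrier R" for a
    using that m_comm[of a] unfolding cgenideal_def factor_def by auto
  have "bij_betw (\<lambda>j. PIdl (?F j)) (\<Pi>\<^sub>E i\<in>S. {..k i}) {I. ideal I R \<and> ?F k \<in> I}"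
    unfolding bij_betw_def
  proof (intro conjI inj_onI subset_antisym subsetI)
    fix j j' assume jj: "j \<in> (\<Pi>\<^sub>E i\<in>S. {..k i})" "j' \<in> (\<Pi>\<^sub>E i\<in>S. {..k i})" "PIdl (?F j) = PIdl (?F j')"
    then have "?F j \<sim> ?F j'" using associated_iff_same_ideal[OF cl cl] by blast
    then have "j i = j' i" if "i \<in> S" for i
      using finprod_power_divides_imp_le[where j = j and j' = j', OF S f distinct _ that]
        finprod_power_divides_imp_le[where j = j' and j' = j, OF S f distinct _ that]
      unfolding associated_def by (simp add: le_antisym)
    then show "j = j'" using jj(1,2) by (rule PiE_ext[rotated 2])
  next
    fix I assume "I \<in> (\<lambda>j. PIdl (?F j)) ` (\<Pi>\<^sub>E i\<in>S. {..k i})"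
    then obtain j where j: "j \<in> (\<Pi>\<^sub>E i\<in>S. {..k i})" "I = PIdl (?F j)" by (elim imageE)
    have "?F k = ?F j \<otimes> ?F (\<lambda>i. k i - j i)"
    proof -
      have "?F j \<otimes> ?F (\<lambda>i. k i - j i) = (\<Otimes>i\<in>S. f i [^] j i \<otimes> f i [^] (k i - j i))"
        by (rule finprod_multf[symmetric]) (simp_all add: Pi_I f(1))
      also have "\<dots> = ?F k"
      proof (rule finprod_cong')
        show "(\<lambda>i. f i [^] k i) \<in> S \<rightarrow> carrier R" by (simp add: Pi_I f(1))
        show "f i [^] j i \<otimes> f i [^] (k i - j i) = f i [^] k i" if "i \<in> S" for i
          using that f(1)[OF that] j(1) by (simp add: nat_pow_mult PiE_iff)
      qed simp
      finally show ?thesis by simp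
    qed
    then have "?F j divides ?F k" unfolding factor_def by (rule bexI) (rule cl)
    then show "I \<in> {I. ideal I R \<and> ?F k \<in> I}" using j(2) mem_iff[OF cl] cgenideal_ideal[OF cl] by simp
  next
    fix I assume "I \<in> {I. ideal I R \<and> ?F k \<in> I}"
    then have I: "ideal I R" "?F k \<in> I" by simp_all
    obtain a where a: "a \<in> carrier R" "I = PIdl a" using exists_gen[OF I(1)] by (elim bexE)
    have "a divides ?F k" using I(2) mem_iff[OF a(1)] a(2) by simp
    with a(1) have "\<exists>j. (\<forall>i\<in>S. j i \<le> k i) \<and> a \<sim> ?F j"
      by (intro divisor_of_finprod) (simp_all add: S f)
    then obtain j where j: "\<forall>i\<in>S. j i \<le> k i" "a \<sim> ?F j" by (elim exE conjE)
    let ?j = "restrict j S"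
    have Fj: "?F ?j = ?F j" by (rule finprod_cong') (simp_all add: Pi_I f(1))
    have "PIdl a = PIdl (?F j)" using j(2) associated_iff_same_ideal[OF a(1) cl] by (simp only:)
    then have "I = PIdl (?F ?j)" unfolding Fj a(2) .
    moreover have "?j \<in> (\<Pi>\<^sub>E i\<in>S. {..k i})" using j(1) by auto
    ultimately show "I \<in> (\<lambda>j. PIdl (?F j)) ` (\<Pi>\<^sub>E i\<in>S. {..k i})" by (rule image_eqI)
  qed
  then have "card {I. ideal I R \<and> ?F k \<in> I} = card (\<Pi>\<^sub>E i\<in>S. {..k i})"
    by (rule bij_betw_same_card[symmetric])
  then show ?thesis using S by (simp add: card_PiE)
qed

end

section \<open>Polynomials acting on periodic functions\<close>

locale cyclic_action =
  fixes p q g :: nat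
  assumes p: "Factorial_Ring.prime p" and q: "Factorial_Ring.prime q" and g: "residue_primroot q g"
begin

sublocale R: residues_prime p "Zmod p"
  using p by unfold_locales

abbreviation "PR \<equiv> poly_ring (Zmod p)"

sublocale P: principal_domain "poly_ring (Zmod p)"
  using R.univ_poly_is_principal[OF R.carrier_is_subfield] .

lemma p1: "1 < p" and q1: "1 < q"
  using prime_gt_1_nat[OF p] prime_gt_1_nat[OF q] by simp_all

lemma coeff_bounds:
  assumes "f \<in> carrier PR" shows "0 \<le> R.coeff f i" "R.coeff f i < int p"
proof -
  have "R.coeff f i \<in> carrier (Zmod p)"
    using assms R.poly_coeff_in_carrier[OF R.carrier_is_subring] univ_poly_carrier by blast
  then show "0 \<le> R.coeff f i" "R.coeff f i < int p" by (auto simp: R.res_carrier_eq)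
qed

text \<open>
  A polynomial \<open>\<Sum>\<^sub>i f\<^sub>i X^i\<close> becomes the function \<open>y \<mapsto> \<Sum> {f\<^sub>i | g^i = y mod q}\<close>; this is the quotient
  map to \<open>\<int>\<^sub>p[X]/(X^(q-1) - 1)\<close>, whose elements are read as functions on the powers of \<open>g\<close>,
  extended by 0. Multiplication by \<open>X\<close> becomes the dilation by the inverse of \<open>g\<close>.
\<close>

definition act :: "int list \<Rightarrow> int \<Rightarrow> int" where
  "act f y = (\<Sum>i<length f. if [int g ^ i = y] (mod int q) then R.coeff f i else 0) mod int p"

lemma act_eq_sum:
  assumes "length f \<le> N"
  shows "act f y = (\<Sum>i<N. if [int g ^ i = y] (mod int q) then R.coeff f i else 0) mod int p"
proof -
  have "(\<Sum>i<length f. if [int g ^ i = y] (mod int q) then R.coeff f i else 0)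
      = (\<Sum>i<N. if [int g ^ i = y] (mod int q) then R.coeff f i else 0)"
    using assms R.coeff_length by (intro sum.mono_neutral_left) (auto simp: R.res_zero_eq)
  then show ?thesis by (simp add: act_def)
qed

lemma act_mod: "act f y mod int p = act f y"
  by (simp add: act_def)

lemma set_carrier: "f \<in> carrier PR \<Longrightarrow> set f \<subseteq> carrier (Zmod p)"
  using R.polynomial_in_carrier[OF R.carrier_is_subring] univ_poly_carrier by blast

lemma act_zero: "act \<zero>\<^bsub>PR\<^esub> = (\<lambda>_. 0)"
  by (simp add: act_def univ_poly_zero fun_eq_iff)

lemma act_add:
  assumes "f \<in> carrier PR" "h \<in> carrier PR"
  shows "act (f \<oplus>\<^bsub>PR\<^esub> h) y = (act f y + act h y) mod int p"
proof -
  define N where "N = max (length f) (length h)"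
  have len: "length (f \<oplus>\<^bsub>PR\<^esub> h) \<le> N"
    unfolding univ_poly_add N_def by (rule R.poly_add_length_le)
  have coeff: "R.coeff (f \<oplus>\<^bsub>PR\<^esub> h) i = (R.coeff f i + R.coeff h i) mod int p" for i
    unfolding univ_poly_add using R.poly_add_coeff[OF set_carrier set_carrier, OF assms]
    by (simp add: R.res_add_eq)
  have "[(\<Sum>i<N. if [int g ^ i = y] (mod int q) then R.coeff (f \<oplus>\<^bsub>PR\<^esub> h) i else 0)
      = (\<Sum>i<N. (if [int g ^ i = y] (mod int q) then R.coeff f i else 0)
          + (if [int g ^ i = y] (mod int q) then R.coeff h i else 0))] (mod int p)"
    by (rule cong_sum) (simp add: coeff)
  then show ?thesis
    unfolding act_eq_sum[OF len] act_eq_sum[of f N, simplified N_def, OF max.cobounded1, folded N_def]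
      act_eq_sum[of h N, simplified N_def, OF max.cobounded2, folded N_def]
    by (simp add: sum.distrib cong_def mod_add_eq)
qed

lemma act_periodic: "act f \<in> periodic_funs p q"
  using p1 by (simp add: periodic_funs_def act_def cong_def)

lemma g_coprime: "coprime (int g) (int q)"
  using g by (simp add: residue_primroot_def coprime_commute)

lemma act_at_0: "act f 0 = 0"
proof -
  have "\<not> [int g ^ i = 0] (mod int q)" for i
  proof
    assume "[int g ^ i = 0] (mod int q)"
    then have "int q dvd int g ^ i" by (simp add: cong_0_iff)
    moreover have "coprime (int g ^ i) (int q)" using g_coprime by simp
    ultimately have "is_unit (int q)" by (meson coprime_common_divisor dvd_refl)
    then show False using q1 by simp
  qed
  then show ?thesis by (simp add: act_def)
qed

lemma act_var:
  assumes f: "f \<in> carrier PR"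
  shows "act (f \<otimes>\<^bsub>PR\<^esub> X\<^bsub>Zmod p\<^esub>) (int g * y) = act f y"
proof (cases "f = []")
  case True
  then show ?thesis using R.poly_mult_var[OF R.carrier_is_subring f] by (simp add: act_def)
next
  case False
  then have eq: "f \<otimes>\<^bsub>PR\<^esub> X\<^bsub>Zmod p\<^esub> = f @ [0]"
    using R.poly_mult_var[OF R.carrier_is_subring f] by (simp add: R.res_zero_eq)
  have c0: "R.coeff (f @ [0]) 0 = 0" and cS: "R.coeff (f @ [0]) (Suc i) = R.coeff f i" for i
    by (simp_all add: R.append_coeff)
  have iff: "[int g ^ Suc i = int g * y] (mod int q) \<longleftrightarrow> [int g ^ i = y] (mod int q)" for i
    using cong_mult_lcancel[OF g_coprime] by simp
  show ?thesis
    unfolding eq act_def length_append_singleton sum.lessThan_Suc_shift cS iff c0 by simp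
qed

lemma discrete_log:
  assumes "\<not> int q dvd a" obtains i where "i < q - 1" "[int g ^ i = a] (mod int q)"
proof -
  define b where "b = nat (a mod int q)"
  have ib: "int b = a mod int q" using q1 by (simp add: b_def)
  have "\<not> q dvd b" using assms ib
    by (metis dvd_mod_iff dvd_refl int_dvd_int_iff)
  moreover have "b < q" using ib q1 by (metis of_nat_0_less_iff of_nat_less_iff order_less_trans pos_mod_bound zero_less_one)
  ultimately have "b \<in> totatives q"
    using q by (auto simp: totatives_prime intro: Nat.gr0I)
  then obtain i where "i < q - 1" "b = g ^ i mod q"
    using residue_primroot_is_generator[OF q1 g] q by (auto simp: bij_betw_def totient_prime)
  then have "int b = int g ^ i mod int q" by (simp add: zmod_int)
  with ib have "[int g ^ i = a] (mod int q)" by (simp add: cong_def)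
  then show ?thesis using \<open>i < q - 1\<close> that by blast
qed

lemma discrete_log_unique:
  assumes "i < q - 1" "j < q - 1" "[int g ^ i = int g ^ j] (mod int q)" shows "i = j"
proof -
  have "[g ^ i = g ^ j] (mod q)" using assms(3) cong_int_iff[of "g ^ i" "g ^ j" q] by simp
  then have "g ^ i mod q = g ^ j mod q" by (simp add: cong_def)
  then show ?thesis
    using residue_primroot_is_generator[OF q1 g] q assms(1,2)
    by (auto simp: bij_betw_def totient_prime inj_on_def)
qed

lemma sum_discrete_log:
  assumes "i < q - 1"
  shows "(\<Sum>j<q - 1. if [int g ^ j = int g ^ i] (mod int q) then h j else (0::int)) = h i"
proof -
  have "(\<Sum>j<q - 1. if [int g ^ j = int g ^ i] (mod int q) then h j else 0) = (\<Sum>j<q - 1. if j = i then h j else 0)"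
    using discrete_log_unique assms by (intro sum.cong) auto
  then show ?thesis using assms by simp
qed

lemma act_surj:
  assumes u: "u \<in> periodic_funs p q" "u 0 = 0"
  obtains f where "f \<in> carrier PR" "act f = u"
proof -
  \<comment> \<open>coefficient lists start with the leading coefficient\<close>
  define l where "l = map (\<lambda>i. u (int g ^ i)) (rev [0..<q - 1])"
  define f where "f = R.normalize l"
  have bounds: "0 \<le> u y" "u y < int p" for y using u(1) by (simp_all add: periodic_funs_def)
  have "set l \<subseteq> carrier (Zmod p)" using bounds by (auto simp: l_def R.res_carrier_eq)
  then have f: "f \<in> carrier PR"
    using R.normalize_gives_polynomial univ_poly_carrier unfolding f_def by blast
  have len: "length f \<le> q - 1" using R.normalize_length_le[of l] by (simp add: f_def l_def)
  have coeff: "R.coeff f i = u (int g ^ i)" if "i < q - 1" for i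
  proof -
    have "R.coeff l i = l ! (q - 1 - 1 - i)" using R.coeff_nth[of i l] that by (simp add: l_def)
    also have "\<dots> = u (int g ^ i)"
    proof -
      have "rev [0..<q - 1] ! (q - 1 - 1 - i) = i" using that by (subst rev_nth) auto
      then show ?thesis using that unfolding l_def by (subst nth_map) auto
    qed
    finally show ?thesis using R.normalize_coeff[of l] by (simp add: f_def)
  qed
  have "act f y = u y" for y
  proof (cases "int q dvd y")
    case True
    then have "u y = u 0" "act f y = act f 0"
      using u(1) act_periodic[of f] by (metis (mono_tags, lifting) dvd_imp_mod_0 mem_Collect_eq periodic_funs_def)+
    then show ?thesis using u(2) act_at_0 by simp
  next
    case False
    then obtain i where i: "i < q - 1" "[int g ^ i = y] (mod int q)" by (rule discrete_log)
    have per: "v y = v (int g ^ i)" if "v \<in> periodic_funs p q" for v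
      using that i(2) unfolding periodic_funs_def cong_def by (metis (mono_tags, lifting) mem_Collect_eq)
    have "act f (int g ^ i) = (\<Sum>j<q - 1. if [int g ^ j = int g ^ i] (mod int q) then R.coeff f j else 0) mod int p"
      by (rule act_eq_sum[OF len])
    also have "\<dots> = u (int g ^ i)"
      unfolding sum_discrete_log[OF i(1)] coeff[OF i(1)] using bounds by simp
    finally show ?thesis using per[OF u(1)] per[OF act_periodic] by simp
  qed
  then have "act f = u" by blast
  with f show ?thesis by (rule that)
qed

text \<open>
  Below degree \<open>q - 1\<close> the powers of \<open>g\<close> are distinct, so the function shows every
  coefficient, in particular the leading one.
\<close>

lemma act_injective:
  assumes f: "f \<in> carrier PR" "length f \<le> q - 1" and zero: "act f = (\<lambda>_. 0)" shows "f = []"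
proof (rule ccontr)
  assume "f \<noteq> []"
  then have deg: "length f - 1 < q - 1" using f(2) by (cases f) auto
  have "act f (int g ^ (length f - 1)) = R.coeff f (length f - 1) mod int p"
    unfolding act_eq_sum[OF f(2)] sum_discrete_log[OF deg] ..
  then have "R.coeff f (length f - 1) = 0"
    using zero coeff_bounds[OF f(1)] by simp
  then have "lead_coeff f = 0" using R.lead_coeff_simp[OF \<open>f \<noteq> []\<close>] by simp
  moreover have "lead_coeff f \<noteq> 0"
    using f(1) \<open>f \<noteq> []\<close> univ_poly_carrier[of "Zmod p" "carrier (Zmod p)" f]
    by (simp add: polynomial_def R.res_zero_eq)
  ultimately show False by simp
qed

lemma act_const_mult:
  assumes f: "f \<in> carrier PR" and a: "a \<in> carrier (Zmod p)"
  shows "act (R.poly_mult f [a]) y = (a * act f y) mod int p"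
proof -
  have eq: "R.poly_mult f [a] = R.normalize (map (\<lambda>b. a \<otimes>\<^bsub>Zmod p\<^esub> b) f)"
    by (rule R.poly_mult_const'(2)[OF set_carrier[OF f] a])
  have len: "length (R.poly_mult f [a]) \<le> length f"
    unfolding eq using R.normalize_length_le by (metis length_map)
  have coeff: "R.coeff (R.poly_mult f [a]) i = (a * R.coeff f i) mod int p" for i
    unfolding eq R.normalize_coeff[symmetric] R.scalar_coeff[OF a] R.res_mult_eq ..
  have "[(\<Sum>i<length f. if [int g ^ i = y] (mod int q) then R.coeff (R.poly_mult f [a]) i else 0)
     = (\<Sum>i<length f. a * (if [int g ^ i = y] (mod int q) then R.coeff f i else 0))] (mod int p)"
    by (rule cong_sum) (simp add: coeff)
  then show ?thesis
    unfolding act_eq_sum[OF len] act_eq_sum[of f "length f", OF order_refl]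
    by (simp add: sum_distrib_left[symmetric] cong_def mod_mult_right_eq)
qed

lemma g_inverse: obtains g' where "[int g * g' = 1] (mod int q)"
  using cong_solve_coprime_int[OF g_coprime] by blast

lemma act_var_pow_mem:
  assumes U: "U \<in> invariant_spaces p q" and "f \<in> carrier PR" "act f \<in> U"
  shows "act (f \<otimes>\<^bsub>PR\<^esub> (X\<^bsub>Zmod p\<^esub> [^]\<^bsub>PR\<^esub> (n::nat))) \<in> U"
proof (induction n)
  case 0 then show ?case using assms by simp
next
  case (Suc n)
  have X: "X\<^bsub>Zmod p\<^esub> \<in> carrier PR" by (rule R.var_closed(1)[OF R.carrier_is_subring])
  obtain g' where g': "[int g * g' = 1] (mod int q)" by (rule g_inverse)
  let ?h = "f \<otimes>\<^bsub>PR\<^esub> (X\<^bsub>Zmod p\<^esub> [^]\<^bsub>PR\<^esub> n)"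
  have h: "?h \<in> carrier PR" using X assms(2) by simp
  have "act (?h \<otimes>\<^bsub>PR\<^esub> X\<^bsub>Zmod p\<^esub>) y = act ?h (g' * y)" for y
  proof -
    have "[int g * (g' * y) = y] (mod int q)" using cong_scalar_right[OF g', of y] by (simp add: mult.assoc)
    then have "act (?h \<otimes>\<^bsub>PR\<^esub> X\<^bsub>Zmod p\<^esub>) (int g * (g' * y)) = act (?h \<otimes>\<^bsub>PR\<^esub> X\<^bsub>Zmod p\<^esub>) y"
      unfolding act_def by (simp add: cong_def)
    then show ?thesis using act_var[OF h] by simp
  qed
  then have "act (?h \<otimes>\<^bsub>PR\<^esub> X\<^bsub>Zmod p\<^esub>) = (\<lambda>y. act ?h (g' * y))" by blast
  moreover have "(\<lambda>y. act ?h (g' * y)) \<in> U"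
    using Suc U p1 by (intro invariant_space_dilate) auto
  moreover have "f \<otimes>\<^bsub>PR\<^esub> (X\<^bsub>Zmod p\<^esub> [^]\<^bsub>PR\<^esub> Suc n) = ?h \<otimes>\<^bsub>PR\<^esub> X\<^bsub>Zmod p\<^esub>"
    using X assms(2) by (simp add: P.m_assoc)
  ultimately show ?case by simp
qed

text \<open>
  An invariant space pulls back to a set closed under multiplication by polynomials: constants
  act by scaling and powers of \<open>X\<close> by dilations, and a polynomial is its leading monomial plus a
  shorter polynomial.
\<close>

lemma act_mult_mem:
  assumes U: "U \<in> invariant_spaces p q" and f: "f \<in> carrier PR" "act f \<in> U" and k: "k \<in> carrier PR"
  shows "act (f \<otimes>\<^bsub>PR\<^esub> k) \<in> U"
  using k
proof (induction "length k" arbitrary: k rule: less_induct)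
  case less
  have p0: "0 < p" using p1 by simp
  show ?case
  proof (cases k)
    case Nil
    then have "k = \<zero>\<^bsub>PR\<^esub>" by (simp add: univ_poly_zero)
    then have "f \<otimes>\<^bsub>PR\<^esub> k = \<zero>\<^bsub>PR\<^esub>" by (simp only: P.r_null[OF f(1)])
    then show ?thesis using act_zero invariant_space_zero[OF U p0] by simp
  next
    case (Cons a k')
    have kc: "set (a # k') \<subseteq> carrier (Zmod p)" using set_carrier[OF less.prems] Cons by simp
    have a: "a \<in> carrier (Zmod p) - {\<zero>\<^bsub>Zmod p\<^esub>}"
      using less.prems Cons univ_poly_carrier R.lead_coeff_in_carrier[OF R.carrier_is_subring] by blast
    let ?m = "R.monom a (length k')" and ?k = "R.normalize k'"
    have nk: "?k \<in> carrier PR"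
      using R.normalize_gives_polynomial kc univ_poly_carrier by (metis set_subset_Cons subset_trans)
    have eqm: "?m = [a] \<otimes>\<^bsub>PR\<^esub> (X\<^bsub>Zmod p\<^esub> [^]\<^bsub>PR\<^esub> length k')"
      by (rule R.monom_eq_var_pow[OF R.carrier_is_subring a])
    have ac: "[a] \<in> carrier PR"
      using R.const_is_polynomial[OF a] univ_poly_carrier by blast
    have X: "X\<^bsub>Zmod p\<^esub> \<in> carrier PR" by (rule R.var_closed(1)[OF R.carrier_is_subring])
    have mc: "?m \<in> carrier PR" unfolding eqm using ac X by simp
    have "k = ?m \<oplus>\<^bsub>PR\<^esub> ?k"
    proof -
      have "?m \<oplus>\<^bsub>PR\<^esub> ?k = R.poly_add ?m k'"
        unfolding univ_poly_add using R.poly_add_normalize(2)[of ?m k'] kc set_carrier[OF mc] by simp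
      also have "\<dots> = k" using R.poly_add_monom[of k' a] kc a Cons by simp
      finally show ?thesis by simp
    qed
    then have "f \<otimes>\<^bsub>PR\<^esub> k = (f \<otimes>\<^bsub>PR\<^esub> [a]) \<otimes>\<^bsub>PR\<^esub> (X\<^bsub>Zmod p\<^esub> [^]\<^bsub>PR\<^esub> length k') \<oplus>\<^bsub>PR\<^esub> f \<otimes>\<^bsub>PR\<^esub> ?k"
      using f(1) ac X nk mc by (simp add: P.r_distr eqm P.m_assoc)
    moreover have "act ((f \<otimes>\<^bsub>PR\<^esub> [a]) \<otimes>\<^bsub>PR\<^esub> (X\<^bsub>Zmod p\<^esub> [^]\<^bsub>PR\<^esub> length k')) \<in> U"
    proof (rule act_var_pow_mem[OF U])
      show "f \<otimes>\<^bsub>PR\<^esub> [a] \<in> carrier PR" using f(1) ac by simp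
      have "act (f \<otimes>\<^bsub>PR\<^esub> [a]) = (\<lambda>y. (a * act f y) mod int p)"
        unfolding univ_poly_mult using act_const_mult[OF f(1)] a by blast
      moreover have "(\<lambda>y. (a * act f y) mod int p) \<in> U"
        using invariant_space_scale[OF U p0 invariant_space_mod[OF U p0 f(2)]] .
      ultimately show "act (f \<otimes>\<^bsub>PR\<^esub> [a]) \<in> U" by simp
    qed
    moreover have "act (f \<otimes>\<^bsub>PR\<^esub> ?k) \<in> U"
      using R.normalize_length_le[of k'] Cons by (intro less.hyps nk) simp
    moreover have "(f \<otimes>\<^bsub>PR\<^esub> [a]) \<otimes>\<^bsub>PR\<^esub> (X\<^bsub>Zmod p\<^esub> [^]\<^bsub>PR\<^esub> length k') \<in> carrier PR"
      "f \<otimes>\<^bsub>PR\<^esub> ?k \<in> carrier PR"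
      using f(1) ac X nk by simp_all
    ultimately have "act (f \<otimes>\<^bsub>PR\<^esub> k) = (\<lambda>y. (act ((f \<otimes>\<^bsub>PR\<^esub> [a]) \<otimes>\<^bsub>PR\<^esub> (X\<^bsub>Zmod p\<^esub> [^]\<^bsub>PR\<^esub> length k')) y
        + act (f \<otimes>\<^bsub>PR\<^esub> ?k) y) mod int p)"
      using act_add by (simp add: fun_eq_iff)
    then show ?thesis
      using invariant_space_add[OF U p0 invariant_space_mod[OF U p0] invariant_space_mod[OF U p0]]
        \<open>act ((f \<otimes>\<^bsub>PR\<^esub> [a]) \<otimes>\<^bsub>PR\<^esub> (X\<^bsub>Zmod p\<^esub> [^]\<^bsub>PR\<^esub> length k')) \<in> U\<close> \<open>act (f \<otimes>\<^bsub>PR\<^esub> ?k) \<in> U\<close>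
      by simp
  qed
qed

section \<open>Counting invariant spaces\<close>

abbreviation "H \<equiv> X_pow_minus_one (Zmod p) (q - 1)"

lemma X_closed: "X\<^bsub>Zmod p\<^esub> \<in> carrier PR"
  by (rule R.var_closed(1)[OF R.carrier_is_subring])

lemma H_closed: "H \<in> carrier PR"
  unfolding X_pow_minus_one_def using X_closed by simp

lemma H_plus_one: "H \<oplus>\<^bsub>PR\<^esub> \<one>\<^bsub>PR\<^esub> = X\<^bsub>Zmod p\<^esub> [^]\<^bsub>PR\<^esub> (q - 1)"
  unfolding X_pow_minus_one_def a_minus_def using X_closed by (simp add: P.a_assoc P.l_neg)

lemma act_var_pow: "act (X\<^bsub>Zmod p\<^esub> [^]\<^bsub>PR\<^esub> (n::nat)) y = (if [int g ^ n = y] (mod int q) then 1 else 0)"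
proof -
  have eq: "X\<^bsub>Zmod p\<^esub> [^]\<^bsub>PR\<^esub> n = R.monom 1 n"
    using R.unitary_monom_eq_var_pow[OF R.carrier_is_subring, of n] by (simp add: R.res_one_eq)
  have "length (R.monom 1 n) = Suc n" by (simp add: R.monom_def)
  then have "act (R.monom 1 n) y = (\<Sum>i<Suc n. if [int g ^ i = y] (mod int q) then R.coeff (R.monom 1 n) i else 0) mod int p"
    unfolding act_def by simp
  also have "(\<Sum>i<Suc n. if [int g ^ i = y] (mod int q) then R.coeff (R.monom 1 n) i else 0)
      = (\<Sum>i<Suc n. if i = n then (if [int g ^ n = y] (mod int q) then 1 else 0) else 0)"
    by (intro sum.cong) (auto simp: R.monom_coeff R.res_zero_eq)
  finally show ?thesis using p1 by (simp add: eq)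
qed

lemma act_H: "act H = (\<lambda>_. 0)"
proof
  fix y
  have "[int g ^ (q - 1) = 1] (mod int q)"
  proof (rule fermat_int[OF q])
    show "\<not> int q dvd int g"
    proof
      assume "int q dvd int g"
      then have "is_unit (int q)" using g_coprime by (meson coprime_common_divisor dvd_refl)
      then show False using q1 by simp
    qed
  qed
  then have "act (X\<^bsub>Zmod p\<^esub> [^]\<^bsub>PR\<^esub> (q - 1)) y = act \<one>\<^bsub>PR\<^esub> y"
    using act_var_pow[of "q - 1" y] act_var_pow[of 0 y] by (simp add: cong_def)
  then have "(act H y + act \<one>\<^bsub>PR\<^esub> y) mod int p = act \<one>\<^bsub>PR\<^esub> y"
    using act_add[OF H_closed P.one_closed, of y] unfolding H_plus_one by simp
  then have "[act H y + act \<one>\<^bsub>PR\<^esub> y = 0 + act \<one>\<^bsub>PR\<^esub> y] (mod int p)"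
    using act_def by (simp add: cong_def)
  then have "[act H y = 0] (mod int p)" by (simp only: cong_add_rcancel)
  then show "act H y = 0" by (simp add: cong_def act_def)
qed

lemma degree_var_pow: "length (X\<^bsub>Zmod p\<^esub> [^]\<^bsub>PR\<^esub> (n::nat)) = Suc n"
  using R.unitary_monom_eq_var_pow[OF R.carrier_is_subring, of n, symmetric] by (simp add: R.monom_def)

lemma H_nonzero: "H \<noteq> \<zero>\<^bsub>PR\<^esub>"
proof
  assume "H = \<zero>\<^bsub>PR\<^esub>"
  then have "\<one>\<^bsub>PR\<^esub> = X\<^bsub>Zmod p\<^esub> [^]\<^bsub>PR\<^esub> (q - 1)" using H_plus_one by simp
  then have "length (\<one>\<^bsub>PR\<^esub>) = Suc (q - 1)" using degree_var_pow by simp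
  then show False using q1 by (simp add: univ_poly_one)
qed

lemma length_H: "length H \<le> q"
proof -
  have "length H \<le> max (length (X\<^bsub>Zmod p\<^esub> [^]\<^bsub>PR\<^esub> (q - 1))) (length (\<ominus>\<^bsub>PR\<^esub> \<one>\<^bsub>PR\<^esub>))"
    unfolding X_pow_minus_one_def a_minus_def univ_poly_add by (rule R.poly_add_length_le)
  also have "length (\<ominus>\<^bsub>PR\<^esub> \<one>\<^bsub>PR\<^esub>) = 1"
    using R.univ_poly_a_inv_length[OF R.carrier_is_subring P.one_closed] by (simp add: univ_poly_one)
  finally show ?thesis using q1 degree_var_pow[of "q - 1"] by simp
qed

text \<open>
  The remainder of division by \<open>X^(q-1) - 1\<close> also acts as 0, and its degree is below \<open>q - 1\<close>.
\<close>

lemma act_zero_imp_divides: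
  assumes f: "f \<in> carrier PR" and zero: "act f = (\<lambda>_. 0)"
  shows "\<exists>k\<in>carrier PR. f = H \<otimes>\<^bsub>PR\<^esub> k"
proof -
  obtain k r where k: "k \<in> carrier PR" and r: "r \<in> carrier PR"
    and eq: "f = (H \<otimes>\<^bsub>PR\<^esub> k) \<oplus>\<^bsub>PR\<^esub> r" and deg: "r = \<zero>\<^bsub>PR\<^esub> \<or> degree r < degree H"
    using R.field_long_division_theorem_shell[OF R.carrier_is_subfield f H_closed H_nonzero] by blast
  have "act (H \<otimes>\<^bsub>PR\<^esub> k) \<in> {\<lambda>_. 0}"
  proof (rule act_mult_mem[OF _ H_closed _ k])
    show "{\<lambda>_. 0} \<in> invariant_spaces p q" using p1 by (simp add: zero_invariant_space)
    show "act H \<in> {\<lambda>_. 0}" by (simp only: act_H singleton_iff)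
  qed
  then have "act f y = act r y" for y
    using act_add[of "H \<otimes>\<^bsub>PR\<^esub> k" r y] H_closed k r eq by (simp add: act_def)
  then have "act r = (\<lambda>_. 0)" using zero by auto
  moreover have "length r \<le> q - 1" using deg length_H by (auto simp: univ_poly_zero)
  ultimately have "r = \<zero>\<^bsub>PR\<^esub>" using act_injective[OF r] by (simp add: univ_poly_zero)
  then have "f = H \<otimes>\<^bsub>PR\<^esub> k" using eq H_closed k by simp
  with k show ?thesis by blast
qed

definition act_preimage :: "(int \<Rightarrow> int) set \<Rightarrow> int list set" where
  "act_preimage U = {f \<in> carrier PR. act f \<in> U}"

lemma act_preimage_ideal:
  assumes U: "U \<in> invariant_spaces p q"
  shows "ideal (act_preimage U) PR" and "H \<in> act_preimage U"
proof -
  have p0: "0 < p" using p1 by simp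
  note add = invariant_space_add[OF U p0 invariant_space_mod[OF U p0] invariant_space_mod[OF U p0]]
  have mult: "f \<otimes>\<^bsub>PR\<^esub> k \<in> act_preimage U" if "f \<in> act_preimage U" "k \<in> carrier PR" for f k
    using that act_mult_mem[OF U] by (simp add: act_preimage_def)
  show "H \<in> act_preimage U"
    using invariant_space_zero[OF U p0] H_closed act_H by (simp add: act_preimage_def)
  show "ideal (act_preimage U) PR"
  proof (rule idealI)
    show "ring PR" by (rule P.ring_axioms)
    show "subgroup (act_preimage U) (add_monoid PR)"
    proof (rule P.add.subgroupI)
      show "act_preimage U \<subseteq> carrier PR" by (auto simp: act_preimage_def)
      show "act_preimage U \<noteq> {}" using \<open>H \<in> act_preimage U\<close> by blast
    next
      fix f assume f: "f \<in> act_preimage U"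
      have "\<ominus>\<^bsub>PR\<^esub> f = f \<otimes>\<^bsub>PR\<^esub> (\<ominus>\<^bsub>PR\<^esub> \<one>\<^bsub>PR\<^esub>)"
        using f by (simp add: act_preimage_def P.r_minus)
      then show "\<ominus>\<^bsub>PR\<^esub> f \<in> act_preimage U" using mult[OF f] by simp
    next
      fix f h assume fh: "f \<in> act_preimage U" "h \<in> act_preimage U"
      then have "act (f \<oplus>\<^bsub>PR\<^esub> h) = (\<lambda>y. (act f y + act h y) mod int p)"
        using act_add by (auto simp: act_preimage_def)
      then show "f \<oplus>\<^bsub>PR\<^esub> h \<in> act_preimage U"
        using fh add by (simp add: act_preimage_def)
    qed
  next
    fix f k assume "f \<in> act_preimage U" "k \<in> carrier PR"
    then show "f \<otimes>\<^bsub>PR\<^esub> k \<in> act_preimage U" by (rule mult)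
    then show "k \<otimes>\<^bsub>PR\<^esub> f \<in> act_preimage U"
      using P.m_comm[of k f] \<open>f \<in> act_preimage U\<close> \<open>k \<in> carrier PR\<close> by (simp add: act_preimage_def)
  qed
qed

text \<open>
  Any \<open>u\<close> in \<open>U\<close> is the sum of the constant \<open>u(0)\<close>, which is a member by dilation by 0, and of a function
  vanishing at 0, which comes from a polynomial. A nonzero constant is a member iff the constant 1
  is.
\<close>

lemma invariant_space_subsetI:
  assumes U: "U \<in> invariant_spaces p q" and U': "U' \<in> invariant_spaces p q"
    and one: "(\<lambda>_. 1) \<in> U \<Longrightarrow> (\<lambda>_. 1) \<in> U'" and sub: "act_preimage U \<subseteq> act_preimage U'"
  shows "U \<subseteq> U'"
proof
  fix u assume u: "u \<in> U"
  have p0: "0 < p" using p1 by simp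
  have per: "u \<in> periodic_funs p q" by (rule invariant_space_periodic[OF U p0 u])
  have ub: "0 \<le> u y" "u y < int p" "u (y mod int q) = u y" for y
    using per by (simp_all add: periodic_funs_def)
  have const: "(\<lambda>_. u 0) \<in> U" using invariant_space_dilate[OF U p0 u, of 0] by simp
  \<comment> \<open>the part of \<open>u\<close> that vanishes at 0\<close>
  let ?d = "\<lambda>t. (u t + - 1 * u 0) mod int p"
  have d: "?d \<in> U"
    by (intro invariant_space_add[OF U p0] invariant_space_scale[OF U p0] invariant_space_mod[OF U p0] u const)
  obtain f where f: "f \<in> carrier PR" "act f = ?d"
    using act_surj[OF invariant_space_periodic[OF U p0 d]] by auto
  have d': "?d \<in> U'" using sub f d by (auto simp: act_preimage_def)
  have "(\<lambda>_. u 0) \<in> U'"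
  proof (cases "u 0 = 0")
    case True
    then show ?thesis using invariant_space_zero[OF U' p0] by simp
  next
    case False
    then have "\<not> [u 0 = 0] (mod int p)" using ub[of 0] by (simp add: cong_def)
    then obtain c where c: "[u 0 * c = 1] (mod int p)" using prime_inverse[OF p] by blast
    have "(\<lambda>_. (c * u 0) mod int p) \<in> U"
      using invariant_space_scale[OF U p0 invariant_space_mod[OF U p0 const]] .
    then have "(\<lambda>_. 1) \<in> U" using c p1 by (simp add: cong_def mult.commute)
    then have "(\<lambda>_. 1) \<in> U'" by (rule one)
    from invariant_space_scale[OF U' p0 invariant_space_mod[OF U' p0 this], of "u 0"]
    show ?thesis using ub by simp
  qed
  from invariant_space_add[OF U' p0 invariant_space_mod[OF U' p0 d'] invariant_space_mod[OF U' p0 this]]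
  have "(\<lambda>t. (?d t + u 0) mod int p) \<in> U'" .
  moreover have "(?d t + u 0) mod int p = u t" for t
    using ub[of t] by (simp add: mod_add_left_eq)
  ultimately show "u \<in> U'" by simp
qed

text \<open>
  The functions whose deviation from their value at 0 comes from \<open>I\<close>; the flag \<open>b\<close> decides
  whether values other than 0 are allowed at 0.
\<close>

definition space_of :: "bool \<Rightarrow> int list set \<Rightarrow> (int \<Rightarrow> int) set" where
  "space_of b I = {u \<in> periodic_funs p q. (b \<or> u 0 = 0) \<and> (\<exists>f\<in>I. \<forall>y. act f y = (u y - u 0) mod int p)}"

text \<open>
  A dilation by a unit is multiplication by a power of \<open>X\<close>, and the dilation by 0 leaves a constant.
  That \<open>I\<close> is recovered exactly uses that \<open>I\<close> contains the kernel of the action, which is generated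
  by \<open>H\<close>.
\<close>

lemma space_of:
  assumes I: "ideal I PR" and HI: "H \<in> I"
  shows "space_of b I \<in> invariant_spaces p q"
    and "(\<lambda>_. 1) \<in> space_of b I \<longleftrightarrow> b"
    and "act_preimage (space_of b I) = I"
proof -
  interpret I: ideal I PR by (rule I)
  have zero: "\<zero>\<^bsub>PR\<^esub> \<in> I" by (rule I.zero_closed)
  have p0: "0 < int p" using p1 by simp
  show one: "(\<lambda>_. 1) \<in> space_of b I \<longleftrightarrow> b"
    using zero p1 by (auto simp: space_of_def periodic_funs_def act_zero intro!: bexI[of _ "\<zero>\<^bsub>PR\<^esub>"])
  show "space_of b I \<in> invariant_spaces p q"
    unfolding invariant_spaces_def mem_Collect_eq
  proof (intro conjI ballI allI)
    show "space_of b I \<subseteq> periodic_funs p q" by (auto simp: space_of_def)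
    have "(\<lambda>_. 0) \<in> space_of b I"
      using zero p0 by (auto simp: space_of_def periodic_funs_def act_zero intro!: bexI[of _ "\<zero>\<^bsub>PR\<^esub>"])
    then show "space_of b I \<noteq> {}" by blast
  next
    fix u v assume uv: "u \<in> space_of b I" "v \<in> space_of b I"
    then obtain f h where f: "f \<in> I" "\<And>y. act f y = (u y - u 0) mod int p"
      and h: "h \<in> I" "\<And>y. act h y = (v y - v 0) mod int p" by (auto simp: space_of_def)
    have "act (f \<oplus>\<^bsub>PR\<^esub> h) y = ((u y + v y) mod int p - (u 0 + v 0) mod int p) mod int p" for y
    proof -
      have "[(u y - u 0) mod int p + (v y - v 0) mod int p = (u y - u 0) + (v y - v 0)] (mod int p)"
        by (intro cong_add) simp_all
      also have "(u y - u 0) + (v y - v 0) = (u y + v y) - (u 0 + v 0)" by simp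
      also have "[(u y + v y) - (u 0 + v 0) = (u y + v y) mod int p - (u 0 + v 0) mod int p] (mod int p)"
        by (intro cong_diff) simp_all
      finally show ?thesis
        using act_add[OF I.Icarr[OF f(1)] I.Icarr[OF h(1)], of y] f(2) h(2) by (simp only: cong_def)
    qed
    then show "(\<lambda>y. (u y + v y) mod int p) \<in> space_of b I"
      using uv p0 I.a_closed[OF f(1) h(1)]
      by (auto simp: space_of_def periodic_funs_def)
  next
    fix u and a :: int assume u: "u \<in> space_of b I"
    then have per: "u \<in> periodic_funs p q" by (simp add: space_of_def)
    obtain f where f: "f \<in> I" "\<And>y. act f y = (u y - u 0) mod int p" using u by (auto simp: space_of_def)
    have fc: "f \<in> carrier PR" by (rule I.Icarr[OF f(1)])
    obtain h where h: "h \<in> I" "\<And>y. act h y = act f (a * y)"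
    proof (cases "int q dvd a")
      case True
      have "act f (a * y) = act f 0" for y
        using True unfolding act_def by (simp add: cong_def)
      then show ?thesis using that[OF zero] by (simp add: act_zero act_at_0)
    next
      case False
      then have "coprime a (int q)" by (rule coprime_int_prime[OF q])
      then obtain a' where a': "[a * a' = 1] (mod int q)" using cong_solve_coprime_int by blast
      have "\<not> int q dvd a'"
      proof
        assume "int q dvd a'"
        then have "[a * a' = 0] (mod int q)" by (simp add: cong_0_iff)
        then show False using a' q1 by (simp add: cong_def)
      qed
      then obtain n where n: "[int g ^ n = a'] (mod int q)" by (rule discrete_log)
      have shift: "act (f \<otimes>\<^bsub>PR\<^esub> (X\<^bsub>Zmod p\<^esub> [^]\<^bsub>PR\<^esub> n)) (int g ^ n * y) = act f y" for n y
      proof (induction n arbitrary: y)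
        case 0 then show ?case using fc by simp
      next
        case (Suc n)
        have "f \<otimes>\<^bsub>PR\<^esub> (X\<^bsub>Zmod p\<^esub> [^]\<^bsub>PR\<^esub> Suc n) = (f \<otimes>\<^bsub>PR\<^esub> (X\<^bsub>Zmod p\<^esub> [^]\<^bsub>PR\<^esub> n)) \<otimes>\<^bsub>PR\<^esub> X\<^bsub>Zmod p\<^esub>"
          using X_closed fc by (simp add: P.m_assoc)
        then show ?case
          using Suc act_var[of "f \<otimes>\<^bsub>PR\<^esub> (X\<^bsub>Zmod p\<^esub> [^]\<^bsub>PR\<^esub> n)" "int g ^ n * y"] X_closed fc
          by (simp add: mult.assoc)
      qed
      let ?h = "f \<otimes>\<^bsub>PR\<^esub> (X\<^bsub>Zmod p\<^esub> [^]\<^bsub>PR\<^esub> n)"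
      have "act ?h y = act f (a * y)" for y
      proof -
        have "[int g ^ n * (a * y) = a' * (a * y)] (mod int q)" using n by (rule cong_scalar_right)
        also have "[a' * (a * y) = 1 * y] (mod int q)"
          using cong_scalar_right[OF a', of y] by (simp add: mult_ac)
        finally have "act ?h (int g ^ n * (a * y)) = act ?h y"
          unfolding act_def by (simp add: cong_def)
        then show ?thesis using shift by simp
      qed
      moreover have "?h \<in> I" using f(1) X_closed by (intro I.I_r_closed) auto
      ultimately show ?thesis using that by blast
    qed
    have "u (a * (y mod int q)) = u (a * y)" for y
      by (rule periodic_cong[OF per]) (simp add: cong_def mod_mult_right_eq)
    then show "(\<lambda>y. u (a * y)) \<in> space_of b I"
      using u h f(2) by (auto simp: space_of_def periodic_funs_def)
  qed
  show "act_preimage (space_of b I) = I"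
  proof (intro subset_antisym subsetI)
    fix f assume f: "f \<in> I"
    then show "f \<in> act_preimage (space_of b I)"
      using I.Icarr[OF f] act_periodic[of f]
      by (auto simp: act_preimage_def space_of_def act_at_0 act_mod intro!: bexI[of _ f])
  next
    fix f assume "f \<in> act_preimage (space_of b I)"
    then have f: "f \<in> carrier PR" and "act f \<in> space_of b I" by (simp_all add: act_preimage_def)
    then obtain h where h: "h \<in> I" and eq: "\<And>y. act h y = (act f y - act f 0) mod int p"
      by (auto simp: space_of_def)
    have hc: "h \<in> carrier PR" by (rule I.Icarr[OF h])
    let ?d = "f \<ominus>\<^bsub>PR\<^esub> h"
    have fd: "f = ?d \<oplus>\<^bsub>PR\<^esub> h" using f hc by (simp add: P.minus_eq P.a_assoc P.l_neg)
    have "act ?d y = 0" for y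
    proof -
      have "act h y = act f y" using eq[of y] by (simp add: act_at_0 act_mod)
      moreover have "act f y = (act ?d y + act h y) mod int p"
        using act_add[of ?d h y] f hc fd[symmetric] by simp
      ultimately have "[act ?d y + act h y = 0 + act h y] (mod int p)" by (simp add: cong_def act_mod)
      then have "[act ?d y = 0] (mod int p)" by (simp only: cong_add_rcancel)
      then show ?thesis by (simp add: cong_def act_def)
    qed
    then obtain k where "k \<in> carrier PR" "?d = H \<otimes>\<^bsub>PR\<^esub> k"
      using act_zero_imp_divides[of ?d] f hc by auto
    then have "?d \<in> I" using HI I.I_r_closed by simp
    from I.a_closed[OF this h] show "f \<in> I" unfolding fd[symmetric] .
  qed
qed

lemma card_invariant_spaces_eq_card_ideals:
  "card (invariant_spaces p q) = 2 * card {I. ideal I PR \<and> H \<in> I}"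
proof -
  let ?\<Psi> = "\<lambda>U. ((\<lambda>_. 1) \<in> U, act_preimage U)"
  have "bij_betw ?\<Psi> (invariant_spaces p q) (UNIV \<times> {I. ideal I PR \<and> H \<in> I})"
  proof (rule bij_betw_imageI)
    show "inj_on ?\<Psi> (invariant_spaces p q)"
    proof (rule inj_onI)
      fix U U' assume "U \<in> invariant_spaces p q" "U' \<in> invariant_spaces p q" "?\<Psi> U = ?\<Psi> U'"
      then show "U = U'"
        using invariant_space_subsetI[of U U'] invariant_space_subsetI[of U' U] by auto
    qed
    show "?\<Psi> ` invariant_spaces p q = UNIV \<times> {I. ideal I PR \<and> H \<in> I}"
    proof (intro subset_antisym subsetI)
      fix z assume "z \<in> ?\<Psi> ` invariant_spaces p q"
      then show "z \<in> UNIV \<times> {I. ideal I PR \<and> H \<in> I}" using act_preimage_ideal by auto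
    next
      fix z assume "z \<in> (UNIV :: bool set) \<times> {I. ideal I PR \<and> H \<in> I}"
      then obtain b I where z: "z = (b, I)" "ideal I PR" "H \<in> I" by auto
      then show "z \<in> ?\<Psi> ` invariant_spaces p q"
        using space_of[OF z(2,3), of b] by (intro image_eqI[of _ _ "space_of b I"]) auto
    qed
  qed
  then have "card (invariant_spaces p q) = card ((UNIV :: bool set) \<times> {I. ideal I PR \<and> H \<in> I})"
    by (rule bij_betw_same_card)
  then show ?thesis by (simp add: card_cartesian_product)
qed

lemma card_invariant_spaces_factorization:
  assumes fac: "irreducible_factorization (Zmod p) H n f k"
  shows "card (invariant_spaces p q) = 2 * (\<Prod>i = 1..n. k i + 1)"
proof -
  have H: "H = (\<Otimes>\<^bsub>PR\<^esub>i\<in>{1..n}. f i [^]\<^bsub>PR\<^esub> k i)"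
    and f: "\<And>i. i \<in> {1..n} \<Longrightarrow> f i \<in> carrier PR" "\<And>i. i \<in> {1..n} \<Longrightarrow> pirreducible\<^bsub>Zmod p\<^esub> (carrier (Zmod p)) (f i)"
    and distinct: "\<And>i j. i \<in> {1..n} \<Longrightarrow> j \<in> {1..n} \<Longrightarrow> i \<noteq> j \<Longrightarrow> \<not> f i \<sim>\<^bsub>PR\<^esub> f j"
    using fac unfolding irreducible_factorization_def by blast+
  have "card {I. ideal I PR \<and> (\<Otimes>\<^bsub>PR\<^esub>i\<in>{1..n}. f i [^]\<^bsub>PR\<^esub> k i) \<in> I} = (\<Prod>i = 1..n. k i + 1)"
    by (rule P.card_ideals_containing) (simp_all add: f distinct)
  then show ?thesis unfolding card_invariant_spaces_eq_card_ideals H[symmetric] by simp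
qed

lemma sum_exponents_le_degree:
  assumes "finite S"
    and "\<And>i. i \<in> S \<Longrightarrow> f i \<in> carrier PR \<and> pirreducible\<^bsub>Zmod p\<^esub> (carrier (Zmod p)) (f i)"
  shows "(\<Otimes>\<^bsub>PR\<^esub>i\<in>S. f i [^]\<^bsub>PR\<^esub> (k i :: nat)) \<noteq> [] \<and>
    (\<Sum>i\<in>S. k i) \<le> degree (\<Otimes>\<^bsub>PR\<^esub>i\<in>S. f i [^]\<^bsub>PR\<^esub> k i)"
  using assms
proof (induction S rule: finite_induct)
  case empty
  show ?case by (simp add: univ_poly_one)
next
  case (insert i S)
  have fi: "f i \<in> carrier PR" "pirreducible\<^bsub>Zmod p\<^esub> (carrier (Zmod p)) (f i)"
    using insert.prems[of i] by simp_all
  let ?A = "f i [^]\<^bsub>PR\<^esub> k i" and ?B = "\<Otimes>\<^bsub>PR\<^esub>i\<in>S. f i [^]\<^bsub>PR\<^esub> k i"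
  have eq: "(\<Otimes>\<^bsub>PR\<^esub>i\<in>insert i S. f i [^]\<^bsub>PR\<^esub> k i) = ?A \<otimes>\<^bsub>PR\<^esub> ?B"
    by (rule P.finprod_power_insert) (use insert in auto)
  have Ac: "?A \<in> carrier PR" using fi(1) by simp
  have Bc: "?B \<in> carrier PR" by (rule P.finprod_power_closed) (use insert.prems in auto)
  have IH: "?B \<noteq> []" "(\<Sum>i\<in>S. k i) \<le> degree ?B" using insert by auto
  have "f i \<noteq> []" using R.pirreducibleE(1)[OF R.carrier_is_subring fi] .
  then have A0: "?A \<noteq> []" by (rule R.polynomial_pow_not_zero[OF fi(1)])
  have "1 \<le> degree (f i)" by (rule R.pirreducible_degree[OF R.carrier_is_subfield fi])
  then have kA: "k i \<le> degree ?A" using R.polynomial_pow_degree[OF fi(1), of "k i"] by simp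
  have deg: "degree (?A \<otimes>\<^bsub>PR\<^esub> ?B) = degree ?A + degree ?B"
    using R.poly_mult_degree_eq[OF R.carrier_is_subring, of ?A ?B] Ac Bc A0 IH(1)
    by (simp add: univ_poly_mult univ_poly_carrier)
  have "?A \<otimes>\<^bsub>PR\<^esub> ?B \<noteq> []"
    using P.integral[OF _ Ac Bc] A0 IH(1) by (auto simp: univ_poly_zero)
  then show ?case using deg kA IH(2) insert.hyps unfolding eq by simp
qed

text \<open>
  Irreducible polynomials have positive degree, so the exponents add up to at most the degree of
  \<open>X^(q-1) - 1\<close>; and \<open>k + 1 \<le> 2^k\<close>.
\<close>

lemma prod_exponents_le:
  assumes fac: "irreducible_factorization (Zmod p) H n f k"
  shows "(\<Prod>i = 1..n. k i + 1) \<le> 2 ^ (q - 1)"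
proof -
  have H: "H = (\<Otimes>\<^bsub>PR\<^esub>i\<in>{1..n}. f i [^]\<^bsub>PR\<^esub> k i)"
    and f: "\<And>i. i \<in> {1..n} \<Longrightarrow> f i \<in> carrier PR \<and> pirreducible\<^bsub>Zmod p\<^esub> (carrier (Zmod p)) (f i)"
    using fac unfolding irreducible_factorization_def by blast+
  have "(\<Sum>i = 1..n. k i) \<le> degree H"
    using sum_exponents_le_degree[of "{1..n}" f k] f unfolding H by blast
  also have "\<dots> \<le> q - 1" using length_H by simp
  finally have le: "(\<Sum>i = 1..n. k i) \<le> q - 1" .
  have "(\<Prod>i = 1..n. k i + 1) \<le> (\<Prod>i = 1..n. 2 ^ k i)"
  proof (rule prod_mono)
    fix i
    have "Suc (k i) \<le> 2 ^ k i" by (rule Suc_leI[OF less_exp])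
    then show "0 \<le> k i + 1 \<and> k i + 1 \<le> 2 ^ k i" by simp
  qed
  also have "\<dots> = 2 ^ (\<Sum>i = 1..n. k i)" by (simp add: power_sum)
  also have "\<dots> \<le> 2 ^ (q - 1)" using le by (intro power_increasing) auto
  finally show ?thesis .
qed

end

section \<open>The number of clones\<close>

lemma card_invariant_spaces:
  assumes p: "Factorial_Ring.prime p" and q: "Factorial_Ring.prime q"
    and fac: "irreducible_factorization (Zmod p) (X_pow_minus_one (Zmod p) (q - 1)) n f k"
  shows "card (invariant_spaces p q) = 2 * (\<Prod>i = 1..n. k i + 1)"
    and "(\<Prod>i = 1..n. k i + 1) \<le> 2 ^ (q - 1)"
proof -
  obtain g where "residue_primroot q g" using prime_primitive_root_exists[OF prime_gt_1_nat[OF q] q] by blast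
  then interpret cyclic_action p q g using p q by unfold_locales
  show "card (invariant_spaces p q) = 2 * (\<Prod>i = 1..n. k i + 1)"
    by (rule card_invariant_spaces_factorization[OF fac])
  show "(\<Prod>i = 1..n. k i + 1) \<le> 2 ^ (q - 1)" by (rule prod_exponents_le[OF fac])
qed

theorem corollary1p5:
  fixes p q n s k :: nat
    and P R :: "nat \<Rightarrow> int list"
    and e d :: "nat \<Rightarrow> nat"
  assumes "Factorial_Ring.prime p" and "Factorial_Ring.prime q" and "p \<noteq> q"
    and "irreducible_factorization (Zmod p) (X_pow_minus_one (Zmod p) (q - 1)) n P e"
    and "irreducible_factorization (Zmod q) (X_pow_minus_one (Zmod q) (p - 1)) s R d"
    and "k = card {C. is_clone (carrier (Zmod (p * q))) C \<and> Clo_add (Zmod (p * q)) \<subseteq> C}"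
  shows "2 * ((\<Prod>i=1..n. (e i + 1)) + (\<Prod>i=1..s. (d i + 1))) - 1 \<le> k
    \<and> k \<le> 2 ^ (p + q + 2) * (\<Prod>i=1..n. (e i + 1) ^ (p + 1)) * (\<Prod>i=1..s. (d i + 1) ^ (q + 1))
    \<and> 2 ^ (p + q + 2) * (\<Prod>i=1..n. (e i + 1) ^ (p + 1)) * (\<Prod>i=1..s. (d i + 1) ^ (q + 1))
        \<le> 2 ^ (2 * q * p + q + p)"
proof -
  note p = assms(1) and q = assms(2)
  define E where "E = (\<Prod>i=1..n. e i + 1)"
  define D where "D = (\<Prod>i=1..s. d i + 1)"
  have cE: "card (invariant_spaces p q) = 2 * E" and lE: "E \<le> 2 ^ (q - 1)"
    using card_invariant_spaces[OF p q assms(4)] by (simp_all add: E_def)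
  have cD: "card (invariant_spaces q p) = 2 * D" and lD: "D \<le> 2 ^ (p - 1)"
    using card_invariant_spaces[OF q p assms(5)] by (simp_all add: D_def)
  have "0 < E" "0 < D" by (simp_all add: E_def D_def prod_pos)
  then have fin: "finite (invariant_spaces p q)" "finite (invariant_spaces q p)"
    using cE cD by (simp_all add: card_ge_0_finite)
  \<comment> \<open>by the Chinese remainder theorem the idempotent \<open>e\<close> is a multiple of \<open>q\<close>\<close>
  have "coprime (int q) (int p)" using p q assms(3) by (simp add: primes_coprime coprime_commute)
  then obtain c where c: "[int q * c = 1] (mod int p)" using cong_solve_coprime_int by blast
  interpret residue_split p q "int q * c"
    using p q assms(3) c by unfold_locales (simp_all add: cong_0_iff)
  have k: "k = card {K. lifted_clone (int (p * q)) K}"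
    unfolding assms(6) using p0 q0 by (intro card_clones_eq_card_lifted_clones) simp
  have prod_power: "(\<Prod>i=1..n. (e i + 1) ^ (p + 1)) = E ^ (p + 1)" "(\<Prod>i=1..s. (d i + 1) ^ (q + 1)) = D ^ (q + 1)"
    by (simp_all only: E_def D_def prod_power_distrib)
  have "2 * (E + D) - 1 \<le> k"
    using card_lifted_clones_lower[OF fin] unfolding cE cD k by simp
  moreover have "k \<le> 2 ^ (p + q + 2) * E ^ (p + 1) * D ^ (q + 1)"
  proof -
    have "k \<le> (2 * E) ^ (p + 1) * (2 * D) ^ (q + 1)"
      using card_lifted_clones_upper(2)[OF fin] unfolding cE cD k .
    also have "\<dots> = 2 ^ (p + q + 2) * E ^ (p + 1) * D ^ (q + 1)"
      by (simp add: power_mult_distrib power_add mult_ac)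
    finally show ?thesis .
  qed
  moreover have "2 ^ (p + q + 2) * E ^ (p + 1) * D ^ (q + 1) \<le> 2 ^ (2 * q * p + q + p)"
  proof -
    have "2 ^ (p + q + 2) * E ^ (p + 1) * D ^ (q + 1)
        \<le> 2 ^ (p + q + 2) * (2 ^ (q - 1)) ^ (p + 1) * (2 ^ (p - 1)) ^ (q + 1)"
      using lE lD by (intro mult_mono power_mono) auto
    also have "\<dots> = 2 ^ (p + q + 2 + (q - 1) * (p + 1) + (p - 1) * (q + 1))"
      by (simp only: power_add power_mult)
    also have "p + q + 2 + (q - 1) * (p + 1) + (p - 1) * (q + 1) = 2 * q * p + q + p"
    proof -
      obtain p' q' where "p = Suc p'" "q = Suc q'" using p0 q0 by (meson gr0_conv_Suc)
      then show ?thesis by (simp add: algebra_simps)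
    qed
    finally show ?thesis .
  qed
  ultimately show ?thesis unfolding prod_power E_def[symmetric] D_def[symmetric] by simp
qed

end
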